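(* Let $b:\mathbb{R}\to\mathbb{R}$ and $\sigma:\mathbb{R}\to(0,\infty)$ be continuous functions with period 1, and let $X$ be a weak solution of $dX_t=b(X_t)\,dt+\sigma(X_t)\,dW_t$, $X_0=y\in\mathbb{R}$. Then (i) for any $u\ge 0$, $$\frac{P(T^+\le u,\,T^+<T^-)}{P(T^-\le u,\,T^-<T^+)}=\frac{P(T^+<T^-)}{P(T^-<T^+)}=\exp\left(2\int_0^1\frac{b(y)}{\sigma^2(y)}\,dy\right);$$ (ii) for any $u\ge0$, $P(T^+\le u\mid T^+<T^-)=P(T^-\le u\mid T^-<T^+)$.
   Context: $W$ is a standard one-dimensional Brownian motion; the SDE has a weak solution unique in law. Cycle forming times: $T_0=0$ and for $n\ge1$, $T_n=\inf\{t\ge T_{n-1}:|X_t-X_{T_{n-1}}|=1\}$. $X$ forms the forward cycle at time $T_n$ if $X_{T_n}-X_{T_{n-1}}=1$ and the backward cycle if $X_{T_n}-X_{T_{n-1}}=-1$. Let $\nu^+=\inf\{n\ge1: X_{T_n}-X_{T_{n-1}}=1\}$, $\nu^-=\inf\{n\ge1: X_{T_n}-X_{T_{n-1}}=-1\}$, and define the forming times of the forward and backward cycles by $T^+=T_{\nu^+}$, $T^-=T_{\nu^-}$.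
   Formalization: The first ratio in (i) is 0/0 at u=0, so it is stated as P(T^+≤u,T^+<T^-)=exp(2∫b/σ²)·P(T^-≤u,T^-<T^+) for all u≥0; this gives the ratio whenever its denominator is nonzero, and nonvanishing for u>0 is not separately stated. *)

theory Defs
  imports "HOL-Probability.Probability"
begin

definition conv_in_prob :: "'a measure \<Rightarrow> (nat \<Rightarrow> 'a \<Rightarrow> real) \<Rightarrow> ('a \<Rightarrow> real) \<Rightarrow> bool" where
  "conv_in_prob M S Z \<longleftrightarrow>
     (\<forall>e>0. (\<lambda>n. measure M {\<omega> \<in> space M. \<bar>S n \<omega> - Z \<omega>\<bar> > e}) \<longlonglongrightarrow> 0)"

text \<open>A filtration on the probability space M, indexed by time t (only t >= 0 matters).\<close>
definition is_filtration :: "'a measure \<Rightarrow> (real \<Rightarrow> 'a measure) \<Rightarrow> bool" where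
  "is_filtration M F \<longleftrightarrow> filtration (space M) F \<and> (\<forall>t. sets (F t) \<subseteq> sets M)"

definition brownian_motion :: "'a measure \<Rightarrow> (real \<Rightarrow> 'a measure) \<Rightarrow> (real \<Rightarrow> 'a \<Rightarrow> real) \<Rightarrow> bool" where
  "brownian_motion M F W \<longleftrightarrow>
     (\<forall>\<omega>\<in>space M. W 0 \<omega> = 0) \<and>
     (\<forall>\<omega>\<in>space M. continuous_on {0..} (\<lambda>t. W t \<omega>)) \<and>
     (\<forall>t\<ge>0. W t \<in> borel_measurable (F t)) \<and>
     (\<forall>s t A B. 0 \<le> s \<longrightarrow> s < t \<longrightarrow> A \<in> sets (F s) \<longrightarrow> B \<in> sets borel \<longrightarrow>
        measure M (A \<inter> {\<omega> \<in> space M. W t \<omega> - W s \<omega> \<in> B}) =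
        measure M A * measure (density lborel (normal_density 0 (sqrt (t - s)))) B)"

definition ito_sum :: "(real \<Rightarrow> 'a \<Rightarrow> real) \<Rightarrow> (real \<Rightarrow> 'a \<Rightarrow> real) \<Rightarrow> real \<Rightarrow> nat \<Rightarrow> 'a \<Rightarrow> real" where
  "ito_sum H W t n \<omega> =
     (\<Sum>k<2^n. H (real k * t / 2^n) \<omega> *
        (W (real (Suc k) * t / 2^n) \<omega> - W (real k * t / 2^n) \<omega>))"

text \<open>X is a (weak) solution of dX = b(X) dt + s(X) dW, X_0 = y, on the filtered probability
  space (M, F) driven by the F-Brownian motion W: X has continuous paths, is adapted, and
  for every t >= 0, X_t - y - int_0^t b(X_u) du equals the Ito integral int_0^t s(X_u) dW_u
  (the limit in probability of the left-point Riemann sums).\<close>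
definition sde_solution ::
  "'a measure \<Rightarrow> (real \<Rightarrow> 'a measure) \<Rightarrow> (real \<Rightarrow> 'a \<Rightarrow> real) \<Rightarrow>
   (real \<Rightarrow> real) \<Rightarrow> (real \<Rightarrow> real) \<Rightarrow> real \<Rightarrow> (real \<Rightarrow> 'a \<Rightarrow> real) \<Rightarrow> bool" where
  "sde_solution M F W b s y X \<longleftrightarrow>
     prob_space M \<and> is_filtration M F \<and> brownian_motion M F W \<and>
     (\<forall>\<omega>\<in>space M. X 0 \<omega> = y) \<and>
     (\<forall>\<omega>\<in>space M. continuous_on {0..} (\<lambda>t. X t \<omega>)) \<and>
     (\<forall>t\<ge>0. X t \<in> borel_measurable (F t)) \<and>
     (\<forall>t\<ge>0. conv_in_prob M (ito_sum (\<lambda>u \<omega>. s (X u \<omega>)) W t)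
                (\<lambda>\<omega>. X t \<omega> - y - integral {0..t} (\<lambda>u. b (X u \<omega>))))"

text \<open>Cycle forming times of a path x (value \<infinity> if the infimum is over the empty set).\<close>
fun cyc_time :: "(real \<Rightarrow> real) \<Rightarrow> nat \<Rightarrow> ereal" where
  "cyc_time x 0 = 0"
| "cyc_time x (Suc n) =
     (if cyc_time x n = \<infinity> then \<infinity>
      else Inf {ereal t | t. real_of_ereal (cyc_time x n) \<le> t \<and>
                 \<bar>x t - x (real_of_ereal (cyc_time x n))\<bar> = 1})"

text \<open>Increment of the path over the n-th cycle (n >= 1), when T_n is finite.\<close>
definition cyc_incr :: "(real \<Rightarrow> real) \<Rightarrow> nat \<Rightarrow> real" where
  "cyc_incr x n = x (real_of_ereal (cyc_time x n)) - x (real_of_ereal (cyc_time x (n - 1)))"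

definition forward_at :: "(real \<Rightarrow> real) \<Rightarrow> nat \<Rightarrow> bool" where
  "forward_at x n \<longleftrightarrow> 1 \<le> n \<and> cyc_time x n < \<infinity> \<and> cyc_incr x n = 1"

definition backward_at :: "(real \<Rightarrow> real) \<Rightarrow> nat \<Rightarrow> bool" where
  "backward_at x n \<longleftrightarrow> 1 \<le> n \<and> cyc_time x n < \<infinity> \<and> cyc_incr x n = -1"

definition T_plus :: "(real \<Rightarrow> real) \<Rightarrow> ereal" where
  "T_plus x = (if \<exists>n. forward_at x n then cyc_time x (LEAST n. forward_at x n) else \<infinity>)"

definition T_minus :: "(real \<Rightarrow> real) \<Rightarrow> ereal" where
  "T_minus x = (if \<exists>n. backward_at x n then cyc_time x (LEAST n. backward_at x n) else \<infinity>)"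

end

theory Submission
  imports Defs
begin

text \<open>
  Let \<open>T\<close> be the exit time of \<open>X\<close> from \<open>(y - 1, y + 1)\<close>. The event \<open>T\<^sup>+ \<le> u, T\<^sup>+ < T\<^sup>-\<close> is
  \<open>T \<le> u, X\<^sub>T = y + 1\<close>, so everything concerns the joint law of \<open>T\<close> and \<open>X\<^sub>T\<close>.
  If \<open>f\<close> solves \<open>\<sigma>\<^sup>2 f'' / 2 + b f' = \<alpha> f\<close>, then \<open>exp (- \<alpha> t) f (X t)\<close> stopped at \<open>T\<close> is a martingale,
  whence \<open>f y = f (y + 1) A + f (y - 1) B\<close>, where \<open>A\<close> and \<open>B\<close> are the integrals of \<open>exp (- \<alpha> T)\<close> over the
  exits at \<open>y + 1\<close> and at \<open>y - 1\<close>. Take \<open>f y = 0\<close>. By periodicity \<open>x \<mapsto> f (x - 1)\<close> solves the same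
  equation, and comparing the Wronskian of the two solutions at \<open>y\<close> and \<open>y + 1\<close> gives
  \<open>f (y + 1) exp c = - f (y - 1)\<close> with \<open>c = 2 \<integral> b / \<sigma>\<^sup>2\<close>, that is \<open>A = exp c * B\<close> for every \<open>\<alpha> > 0\<close>.
  Uniqueness of Laplace transforms turns this into the identity for all \<open>u\<close>. A solution with \<open>f y = 1\<close>
  shows that \<open>A\<close> and \<open>B\<close> do not both vanish.

  The martingale identity is obtained without stochastic integrals: \<open>X\<close> is a limit in probability of
  Riemann sums, for which second-order Taylor expansion and discrete moment computations give the
  generator up to an error \<open>o(h)\<close> on a time step \<open>h\<close>, and the steps before \<open>T\<close> telescope.
\<close>

section \<open>The first cycle of a path\<close>

text \<open>The Riemann sums converge in probability only, so expectations pass to the limit for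
  bounded Lipschitz test functions; solutions of the eigenvalue equation are therefore cut off away
  from \<open>[y - 1, y + 1]\<close>, which leaves a bounded and uniformly continuous second
  derivative. A horizon \<open>R\<close> takes about \<open>R / h\<close> steps, so the error of one
  step must be \<open>o(h)\<close> uniformly in its starting time and in the event on which it is
  taken. That event is survival at the left end of the step: it belongs to the past, and on it the
  equation holds at the current position. The discrete process thus stops at the first grid point
  not before \<open>T\<close>, and continuity of the paths removes this overshoot as the mesh tends
  to zero. Finiteness of \<open>T\<close> is never established beforehand: paths that do not exit
  are truncated at \<open>R\<close>, and the discount gives them weight zero as \<open>R\<close>
  grows.\<close>

declare cyc_time.simps(2) [simp del]

lemma cyc_time_mono_Suc: "cyc_time x n \<le> cyc_time x (Suc n)" if "0 \<le> cyc_time x n"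
proof (cases "cyc_time x n = \<infinity>")
  case False
  with that obtain r where r: "cyc_time x n = ereal r" by (cases "cyc_time x n") auto
  then show ?thesis by (auto simp: cyc_time.simps(2) intro!: Inf_greatest)
qed (simp add: cyc_time.simps(2))

lemma cyc_time_nonneg: "0 \<le> cyc_time x n"
proof (induction n)
  case (Suc n)
  then show ?case using order_trans[OF Suc.IH cyc_time_mono_Suc[OF Suc.IH]] by blast
qed simp

lemma cyc_time_mono: "m \<le> n \<Longrightarrow> cyc_time x m \<le> cyc_time x n"
  by (rule lift_Suc_mono_le[of "cyc_time x"]) (auto intro: cyc_time_mono_Suc cyc_time_nonneg)

text \<open>By continuity the times at which the path is at distance 1 from \<open>x r\<close> form
  a closed set, nonempty because the infimum is finite, so the infimum is a minimum. Before it the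
  distance stays below 1, since exceeding 1 would mean passing through 1.\<close>

lemma cyc_time_Suc_attained:
  assumes x: "continuous_on {0..} x" and n: "cyc_time x n = ereal r"
    and S: "cyc_time x (Suc n) = ereal t"
  shows "r < t" and "\<bar>x t - x r\<bar> = 1"
    and "\<And>s. r \<le> s \<Longrightarrow> s < t \<Longrightarrow> \<bar>x s - x r\<bar> < 1"
proof -
  have r0: "0 \<le> r" using cyc_time_nonneg[of x n] n by simp
  define A where "A = {t. r \<le> t \<and> \<bar>x t - x r\<bar> = 1}"
  have "{ereal t | t. real_of_ereal (cyc_time x n) \<le> t \<and>
      \<bar>x t - x (real_of_ereal (cyc_time x n))\<bar> = 1} = ereal ` A"
    using n by (auto simp: A_def)
  with S n have I: "Inf (ereal ` A) = ereal t" by (simp add: cyc_time.simps(2))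
  have ne: "A \<noteq> {}"
  proof
    assume "A = {}" then have "Inf (ereal ` A) = \<infinity>" by (simp add: top_ereal_def)
    with I show False by simp
  qed
  have cl: "closed A"
  proof -
    have "continuous_on {r..} (\<lambda>t. \<bar>x t - x r\<bar>)"
      using r0 by (intro continuous_intros continuous_on_subset[OF x]) auto
    from continuous_closed_preimage[OF this, of "{1}"]
    have "closed ({r..} \<inter> (\<lambda>t. \<bar>x t - x r\<bar>) -` {1})" by simp
    also have "{r..} \<inter> (\<lambda>t. \<bar>x t - x r\<bar>) -` {1} = A" by (auto simp: A_def)
    finally show ?thesis .
  qed
  have bb: "bdd_below A" by (rule bdd_belowI[of _ r]) (simp add: A_def)
  have "Inf A = t"
    using I ereal_Inf'[OF bb ne] by simp
  then have tA: "t \<in> A" using closed_contains_Inf[OF ne bb cl] by simp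
  have lb: "t \<le> s" if "s \<in> A" for s
    using cInf_lower[OF that bb] \<open>Inf A = t\<close> by simp
  show "\<bar>x t - x r\<bar> = 1" using tA by (simp add: A_def)
  moreover have "r \<le> t" using tA by (simp add: A_def)
  ultimately show "r < t" by (cases "r = t") auto
  fix s assume s: "r \<le> s" "s < t"
  show "\<bar>x s - x r\<bar> < 1"
  proof (rule ccontr)
    assume "\<not> ?thesis"
    moreover have "continuous_on {r..s} (\<lambda>t. \<bar>x t - x r\<bar>)"
      using r0 by (intro continuous_intros continuous_on_subset[OF x]) auto
    ultimately obtain z where "r \<le> z" "z \<le> s" "\<bar>x z - x r\<bar> = 1"
      using IVT'[of "\<lambda>t. \<bar>x t - x r\<bar>" r 1 s] s by auto
    then show False using lb[of z] s by (simp add: A_def)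
  qed
qed

lemma cyc_time_Suc_le:
  assumes "cyc_time x n = ereal r" "r \<le> t" "\<bar>x t - x r\<bar> = 1"
  shows "cyc_time x (Suc n) \<le> ereal t"
  using assms by (auto simp: cyc_time.simps(2) intro!: Inf_lower)

text \<open>Turns a statement about an infimum over the whole future into one about the path up to
  \<open>t\<close>; this makes survival at time \<open>t\<close> an event of the past.\<close>

lemma first_cycle_gt_iff:
  assumes x: "continuous_on {0..} x" and "0 \<le> t"
  shows "ereal t < cyc_time x 1 \<longleftrightarrow> (\<forall>s\<in>{0..t}. \<bar>x s - x 0\<bar> < 1)"
proof
  have c0: "cyc_time x 0 = ereal 0" by (simp add: zero_ereal_def)
  assume l: "ereal t < cyc_time x 1"
  show "\<forall>s\<in>{0..t}. \<bar>x s - x 0\<bar> < 1"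
  proof (rule ccontr)
    assume "\<not> ?thesis"
    then obtain s where s: "0 \<le> s" "s \<le> t" "\<bar>x s - x 0\<bar> \<ge> 1" by auto
    have "continuous_on {0..s} (\<lambda>t. \<bar>x t - x 0\<bar>)"
      by (intro continuous_intros continuous_on_subset[OF x]) auto
    then obtain z where z: "0 \<le> z" "z \<le> s" "\<bar>x z - x 0\<bar> = 1"
      using IVT'[of "\<lambda>t. \<bar>x t - x 0\<bar>" 0 1 s] s by auto
    from cyc_time_Suc_le[OF c0 z(1) z(3)] have "cyc_time x 1 \<le> ereal z" by simp
    also have "\<dots> \<le> ereal t" using z s by simp
    finally show False using l by simp
  qed
next
  have c0: "cyc_time x 0 = ereal 0" by (simp add: zero_ereal_def)
  assume r: "\<forall>s\<in>{0..t}. \<bar>x s - x 0\<bar> < 1"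
  show "ereal t < cyc_time x 1"
  proof (rule ccontr)
    assume "\<not> ?thesis"
    then obtain q where q: "cyc_time x 1 = ereal q" "q \<le> t"
      using cyc_time_nonneg[of x 1] by (cases "cyc_time x 1") auto
    from cyc_time_Suc_attained[OF x c0] q(1) have "\<bar>x q - x 0\<bar> = 1" "0 < q" by auto
    with r[rule_format, of q] q show False by simp
  qed
qed

text \<open>Strict, because another cycle requires the path to travel a distance 1. It separates
  \<open>T_plus\<close> from \<open>T_minus\<close>: the direction not taken first is formed at the
  second cycle or later.\<close>

lemma cyc_time_gt_first:
  assumes x: "continuous_on {0..} x" and "cyc_time x 1 = ereal r" "2 \<le> n"
  shows "cyc_time x 1 < cyc_time x n"
proof -
  have "cyc_time x 1 < cyc_time x 2"
  proof (cases "cyc_time x 2")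
    case (real t)
    then show ?thesis using cyc_time_Suc_attained(1)[OF x assms(2), of t] assms(2)
      by (simp add: numeral_2_eq_2)
  qed (use cyc_time_nonneg[of x 2] assms in auto)
  also have "\<dots> \<le> cyc_time x n" using assms by (intro cyc_time_mono)
  finally show ?thesis .
qed

text \<open>The first cycle decides the competition: the opposite direction is formed strictly later
  or never. Without a first cycle both times are infinite and neither strict inequality
  holds.\<close>

lemma first_cycle_cases:
  assumes x: "continuous_on {0..} x"
  shows "T_plus x < T_minus x \<longleftrightarrow> (\<exists>r. cyc_time x 1 = ereal r \<and> x r = x 0 + 1)"
    and "T_minus x < T_plus x \<longleftrightarrow> (\<exists>r. cyc_time x 1 = ereal r \<and> x r = x 0 - 1)"
    and "T_plus x < T_minus x \<Longrightarrow> T_plus x = cyc_time x 1"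
    and "T_minus x < T_plus x \<Longrightarrow> T_minus x = cyc_time x 1"
proof -
  have c0: "cyc_time x 0 = ereal 0" by (simp add: zero_ereal_def)
  have "cyc_time x 1 \<le> T_plus x" if "\<exists>n. forward_at x n"
  proof -
    have "1 \<le> (LEAST n. forward_at x n)" using LeastI_ex[OF that] by (simp only: forward_at_def)
    with that show ?thesis by (simp add: T_plus_def cyc_time_mono)
  qed
  moreover have "cyc_time x 1 \<le> T_minus x" if "\<exists>n. backward_at x n"
  proof -
    have "1 \<le> (LEAST n. backward_at x n)" using LeastI_ex[OF that] by (simp only: backward_at_def)
    with that show ?thesis by (simp add: T_minus_def cyc_time_mono)
  qed
  ultimately have ge: "cyc_time x 1 \<le> T_plus x" "cyc_time x 1 \<le> T_minus x"
    by (auto simp: T_plus_def T_minus_def)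
  have plus: "T_plus x = cyc_time x 1 \<and> T_plus x < T_minus x" if "cyc_time x 1 = ereal r" "x r = x 0 + 1" for r
  proof -
    have f: "forward_at x 1" using that c0 by (simp add: forward_at_def cyc_incr_def)
    have nb: "\<not> backward_at x 1" using that c0 by (simp add: backward_at_def cyc_incr_def)
    have "(LEAST n. forward_at x n) = 1"
      by (rule Least_equality) (use f in \<open>auto simp: forward_at_def\<close>)
    then have 1: "T_plus x = cyc_time x 1" using f by (auto simp: T_plus_def)
    have "cyc_time x 1 < T_minus x"
    proof (cases "\<exists>n. backward_at x n")
      case True
      let ?n = "LEAST n. backward_at x n"
      have b: "backward_at x ?n" using True by (rule LeastI_ex)
      have "2 \<le> ?n" using b nb by (cases "?n = 1") (auto simp: backward_at_def)
      from cyc_time_gt_first[OF x that(1) this] True show ?thesis by (simp add: T_minus_def)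
    qed (use that in \<open>simp add: T_minus_def\<close>)
    with 1 show ?thesis by simp
  qed
  have minus: "T_minus x = cyc_time x 1 \<and> T_minus x < T_plus x" if "cyc_time x 1 = ereal r" "x r = x 0 - 1" for r
  proof -
    have f: "backward_at x 1" using that c0 by (simp add: backward_at_def cyc_incr_def)
    have nb: "\<not> forward_at x 1" using that c0 by (simp add: forward_at_def cyc_incr_def)
    have "(LEAST n. backward_at x n) = 1"
      by (rule Least_equality) (use f in \<open>auto simp: backward_at_def\<close>)
    then have 1: "T_minus x = cyc_time x 1" using f by (auto simp: T_minus_def)
    have "cyc_time x 1 < T_plus x"
    proof (cases "\<exists>n. forward_at x n")
      case True
      let ?n = "LEAST n. forward_at x n"
      have b: "forward_at x ?n" using True by (rule LeastI_ex)
      have "2 \<le> ?n" using b nb by (cases "?n = 1") (auto simp: forward_at_def)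
      from cyc_time_gt_first[OF x that(1) this] True show ?thesis by (simp add: T_plus_def)
    qed (use that in \<open>simp add: T_plus_def\<close>)
    with 1 show ?thesis by simp
  qed
  have none: "T_plus x = \<infinity> \<and> T_minus x = \<infinity>" if "cyc_time x 1 = \<infinity>"
    using that ge by simp
  have fin: "x r = x 0 + 1 \<or> x r = x 0 - 1" if "cyc_time x 1 = ereal r" for r
    using cyc_time_Suc_attained(2)[OF x c0, of r] that by (auto simp: abs_if split: if_splits)
  have "cyc_time x 1 = \<infinity> \<or> (\<exists>r. cyc_time x 1 = ereal r)"
    using cyc_time_nonneg[of x 1] by (cases "cyc_time x 1") auto
  then consider (inf) "cyc_time x 1 = \<infinity>" | (p) r where "cyc_time x 1 = ereal r" "x r = x 0 + 1"
    | (m) r where "cyc_time x 1 = ereal r" "x r = x 0 - 1" using fin by blast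
  then have "(T_plus x < T_minus x \<longleftrightarrow> (\<exists>r. cyc_time x 1 = ereal r \<and> x r = x 0 + 1)) \<and>
    (T_minus x < T_plus x \<longleftrightarrow> (\<exists>r. cyc_time x 1 = ereal r \<and> x r = x 0 - 1)) \<and>
    (T_plus x < T_minus x \<longrightarrow> T_plus x = cyc_time x 1) \<and>
    (T_minus x < T_plus x \<longrightarrow> T_minus x = cyc_time x 1)"
  proof cases
    case inf
    with none[OF inf] show ?thesis by simp
  next
    case p
    from plus[OF p] have a: "T_plus x = cyc_time x 1" "T_plus x < T_minus x" by auto
    then have "\<not> T_minus x < T_plus x" by simp
    with a p show ?thesis by auto
  next
    case m
    from minus[OF m] have a: "T_minus x = cyc_time x 1" "T_minus x < T_plus x" by auto
    then have "\<not> T_plus x < T_minus x" by simp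
    with a m show ?thesis by auto
  qed
  then show "T_plus x < T_minus x \<longleftrightarrow> (\<exists>r. cyc_time x 1 = ereal r \<and> x r = x 0 + 1)"
    and "T_minus x < T_plus x \<longleftrightarrow> (\<exists>r. cyc_time x 1 = ereal r \<and> x r = x 0 - 1)"
    and "T_plus x < T_minus x \<Longrightarrow> T_plus x = cyc_time x 1"
    and "T_minus x < T_plus x \<Longrightarrow> T_minus x = cyc_time x 1"
    by blast+
qed

section \<open>Brownian increments\<close>

locale filtered_brownian_motion = prob_space M
  for M :: "'a measure" and F :: "real \<Rightarrow> 'a measure" and W :: "real \<Rightarrow> 'a \<Rightarrow> real" +
  assumes filt: "is_filtration M F"
    and bm: "brownian_motion M F W"
begin

lemma subalgebra_F: "subalgebra M (F t)"
  using filt filtration.space_F[of "space M" F t]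
  by (auto simp: is_filtration_def subalgebra_def)

lemma space_F [simp]: "space (F t) = space M"
  using subalgebra_F[of t] by (simp add: subalgebra_def)

lemma sets_F_mono: "s \<le> t \<Longrightarrow> sets (F s) \<subseteq> sets (F t)"
  using filt filtration.sets_F_mono[of "space M" F s t] by (auto simp: is_filtration_def)

lemma sets_F_M: "A \<in> sets (F t) \<Longrightarrow> A \<in> sets M"
  using subalgebra_F[of t] by (auto simp: subalgebra_def)

lemma measurable_F_M: "Y \<in> borel_measurable (F t) \<Longrightarrow> Y \<in> borel_measurable M"
  by (rule measurable_from_subalg[OF subalgebra_F])

lemma measurable_F_mono: "Y \<in> borel_measurable (F s) \<Longrightarrow> s \<le> t \<Longrightarrow> Y \<in> borel_measurable (F t)"
  by (rule measurable_from_subalg[of "F t" "F s"]) (auto simp: subalgebra_def dest: sets_F_mono)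

lemma W_measurable: "0 \<le> t \<Longrightarrow> W t \<in> borel_measurable (F t)"
  using bm by (auto simp: brownian_motion_def)

lemma W_measurable_M [measurable]: "0 \<le> t \<Longrightarrow> W t \<in> borel_measurable M"
  using W_measurable measurable_F_M by blast

lemma increment_prob:
  assumes "0 \<le> s" "s < t" "A \<in> sets (F s)" "B \<in> sets borel"
  shows "prob (A \<inter> {\<omega> \<in> space M. W t \<omega> - W s \<omega> \<in> B}) =
    prob A * measure (density lborel (normal_density 0 (sqrt (t - s)))) B"
  using bm assms by (auto simp: brownian_motion_def)

lemma increment_distr:
  assumes "0 \<le> s" "s < t"
  shows "distr M borel (\<lambda>\<omega>. W t \<omega> - W s \<omega>) = density lborel (normal_density 0 (sqrt (t - s)))"
    (is "?D = ?N")
proof (rule measure_eqI)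
  interpret N: prob_space ?N using assms by (intro prob_space_normal_density) auto
  have m [measurable]: "(\<lambda>\<omega>. W t \<omega> - W s \<omega>) \<in> borel_measurable M"
    using assms by simp
  interpret D: prob_space ?D by (rule prob_space_distr) (rule m)
  fix B assume "B \<in> sets ?D"
  then have B: "B \<in> sets borel" by simp
  have "space M \<in> sets (F s)" using sets.top[of "F s"] by simp
  from increment_prob[OF assms this B]
  have "prob {\<omega> \<in> space M. W t \<omega> - W s \<omega> \<in> B} = measure ?N B"
    by (simp add: prob_space Int_absorb1)
  moreover have "measure ?D B = prob {\<omega> \<in> space M. W t \<omega> - W s \<omega> \<in> B}"
    using B by (subst measure_distr[OF m]) (auto intro!: arg_cong[where f=prob])
  ultimately show "emeasure ?D B = emeasure ?N B"
    by (simp add: N.emeasure_eq_measure D.emeasure_eq_measure)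
qed simp

text \<open>The definition of Brownian motion gives the product formula for every event of
  \<open>F s\<close>, in particular for preimages under \<open>Y\<close>. These preimages, and those
  under the increment, are stable under intersection, so the formula extends to the generated
  sigma-algebras.\<close>

lemma increment_indep:
  assumes "0 \<le> s" "s < t" "Y \<in> borel_measurable (F s)"
  shows "indep_var borel Y borel (\<lambda>\<omega>. W t \<omega> - W s \<omega>)"
proof -
  let ?D = "\<lambda>\<omega>. W t \<omega> - W s \<omega>"
  have m [measurable]: "?D \<in> borel_measurable M" using assms by simp
  have mY: "Y \<in> borel_measurable M" using assms measurable_F_M by blast
  have P: "prob {\<omega> \<in> space M. ?D \<omega> \<in> B} = measure (density lborel (normal_density 0 (sqrt (t - s)))) B"
    if "B \<in> sets borel" for B
    using that increment_distr[OF assms(1,2), symmetric]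
    by (simp add: measure_distr[OF m]) (auto intro!: arg_cong[where f=prob])
  show ?thesis unfolding indep_var_eq
  proof (intro conjI indep_set_sigma_sets indep_setI)
    show "random_variable borel Y" by (rule mY)
    show "random_variable borel ?D" by (rule m)
    show "Int_stable {Y -` A \<inter> space M |A. A \<in> sets borel}"
      unfolding Int_stable_def by (safe) (metis (no_types, lifting) Int_assoc Int_left_commute inf.idem sets.Int vimage_Int)
    show "Int_stable {?D -` A \<inter> space M |A. A \<in> sets borel}"
      unfolding Int_stable_def by (safe) (metis (no_types, lifting) Int_assoc Int_left_commute inf.idem sets.Int vimage_Int)
    show "{Y -` A \<inter> space M |A. A \<in> sets borel} \<subseteq> events"
      using mY by (auto intro: measurable_sets)
    show "{?D -` A \<inter> space M |A. A \<in> sets borel} \<subseteq> events"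
      using m by (auto intro: measurable_sets)
    fix a b assume "a \<in> {Y -` A \<inter> space M |A. A \<in> sets borel}" "b \<in> {?D -` A \<inter> space M |A. A \<in> sets borel}"
    then obtain A B where AB: "A \<in> sets borel" "B \<in> sets borel" "a = Y -` A \<inter> space M"
      "b = {\<omega> \<in> space M. ?D \<omega> \<in> B}" by auto
    have "a \<in> sets (F s)" using measurable_sets[OF assms(3) AB(1)] AB(3) by simp
    from increment_prob[OF assms(1,2) this AB(2)] P[OF AB(2)] AB(4)
    show "prob (a \<inter> b) = prob a * prob b" by simp
  qed
qed

lemma increment_moment:
  assumes "0 \<le> s" "s < t"
  shows "integrable M (\<lambda>\<omega>. (W t \<omega> - W s \<omega>) ^ p)"
    and "expectation (\<lambda>\<omega>. (W t \<omega> - W s \<omega>) ^ p) =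
      (\<integral>x. normal_density 0 (sqrt (t - s)) x * x ^ p \<partial>lborel)"
proof -
  have m [measurable]: "(\<lambda>\<omega>. W t \<omega> - W s \<omega>) \<in> borel_measurable M" using assms by simp
  have "integrable (density lborel (normal_density 0 (sqrt (t - s)))) (\<lambda>x. x ^ p)"
    using integrable_normal_moment[of "sqrt (t-s)" 0 p] assms by (subst integrable_density) auto
  then have "integrable (distr M borel (\<lambda>\<omega>. W t \<omega> - W s \<omega>)) (\<lambda>x. x ^ p)"
    using increment_distr[OF assms] by simp
  then show "integrable M (\<lambda>\<omega>. (W t \<omega> - W s \<omega>) ^ p)"
    by (subst (asm) integrable_distr_eq) auto
  have "expectation (\<lambda>\<omega>. (W t \<omega> - W s \<omega>) ^ p) = (\<integral>x. x ^ p \<partial>distr M borel (\<lambda>\<omega>. W t \<omega> - W s \<omega>))"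
    by (subst integral_distr) auto
  also have "\<dots> = (\<integral>x. normal_density 0 (sqrt (t - s)) x * x ^ p \<partial>lborel)"
    unfolding increment_distr[OF assms] by (subst integral_density) auto
  finally show "expectation (\<lambda>\<omega>. (W t \<omega> - W s \<omega>) ^ p) =
      (\<integral>x. normal_density 0 (sqrt (t - s)) x * x ^ p \<partial>lborel)" .
qed

lemma increment_moment_mult:
  assumes "0 \<le> s" "s < t" "Y \<in> borel_measurable (F s)" "integrable M Y"
  shows "integrable M (\<lambda>\<omega>. Y \<omega> * (W t \<omega> - W s \<omega>) ^ p)"
    and "expectation (\<lambda>\<omega>. Y \<omega> * (W t \<omega> - W s \<omega>) ^ p) =
      expectation Y * (\<integral>x. normal_density 0 (sqrt (t - s)) x * x ^ p \<partial>lborel)"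
proof -
  have "indep_var borel (id \<circ> Y) borel ((\<lambda>x. x ^ p) \<circ> (\<lambda>\<omega>. W t \<omega> - W s \<omega>))"
    by (rule indep_var_compose[OF increment_indep[OF assms(1-3)]]) auto
  then have i: "indep_var borel Y borel (\<lambda>\<omega>. (W t \<omega> - W s \<omega>) ^ p)" by (simp add: comp_def id_def)
  show "integrable M (\<lambda>\<omega>. Y \<omega> * (W t \<omega> - W s \<omega>) ^ p)"
    by (rule indep_var_integrable[OF i assms(4) increment_moment(1)[OF assms(1,2)]])
  show "expectation (\<lambda>\<omega>. Y \<omega> * (W t \<omega> - W s \<omega>) ^ p) =
      expectation Y * (\<integral>x. normal_density 0 (sqrt (t - s)) x * x ^ p \<partial>lborel)"
    using indep_var_lebesgue_integral[OF i assms(4) increment_moment(1)[OF assms(1,2)]]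
    by (simp add: increment_moment(2)[OF assms(1,2)])
qed

text \<open>Orders up to four, because the Taylor remainder of a step is controlled by the fourth
  moment of its noise.\<close>

lemma increment_moments:
  assumes "0 \<le> s" "s < t" "Y \<in> borel_measurable (F s)" "integrable M Y"
  shows "expectation (\<lambda>\<omega>. Y \<omega> * (W t \<omega> - W s \<omega>)) = 0"
    and "expectation (\<lambda>\<omega>. Y \<omega> * (W t \<omega> - W s \<omega>) ^ 2) = (t - s) * expectation Y"
    and "expectation (\<lambda>\<omega>. Y \<omega> * (W t \<omega> - W s \<omega>) ^ 3) = 0"
    and "expectation (\<lambda>\<omega>. Y \<omega> * (W t \<omega> - W s \<omega>) ^ 4) = 3 * (t - s)\<^sup>2 * expectation Y"
proof -
  have p: "0 < sqrt (t - s)" using assms by simp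
  note mm = increment_moment_mult(2)[OF assms]
  show "expectation (\<lambda>\<omega>. Y \<omega> * (W t \<omega> - W s \<omega>)) = 0"
    using mm[of 1] integral_normal_moment_odd[OF p, of 0 0] by simp
  show "expectation (\<lambda>\<omega>. Y \<omega> * (W t \<omega> - W s \<omega>) ^ 2) = (t - s) * expectation Y"
    using mm[of 2] integral_normal_moment_even[OF p, of 0 1] assms
    by (simp add: fact_numeral)
  show "expectation (\<lambda>\<omega>. Y \<omega> * (W t \<omega> - W s \<omega>) ^ 3) = 0"
    using mm[of 3] integral_normal_moment_odd[OF p, of 0 1] by (simp add: eval_nat_numeral)
  show "expectation (\<lambda>\<omega>. Y \<omega> * (W t \<omega> - W s \<omega>) ^ 4) = 3 * (t - s)\<^sup>2 * expectation Y"
    using mm[of 4] integral_normal_moment_even[OF p, of 0 2] assms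
    by (simp add: fact_numeral power_divide field_simps)
qed

end

section \<open>Dyadic Riemann sums\<close>

definition node :: "real \<Rightarrow> real \<Rightarrow> nat \<Rightarrow> nat \<Rightarrow> real" where
  "node s t n k = s + real k * (t - s) / 2 ^ n"

lemma node_top [simp]: "node s t n (2 ^ n) = t"
  by (simp add: node_def)

lemma node_Suc: "node s t n (Suc k) = node s t n k + (t - s) / 2 ^ n"
  by (simp add: node_def field_simps)

lemma node_mono: "s \<le> t \<Longrightarrow> j \<le> k \<Longrightarrow> node s t n j \<le> node s t n k"
  unfolding node_def by (intro add_left_mono divide_right_mono mult_right_mono) auto

lemma node_ge: "s \<le> t \<Longrightarrow> s \<le> node s t n k"
  unfolding node_def by simp

lemma node_le: "s \<le> t \<Longrightarrow> k \<le> 2 ^ n \<Longrightarrow> node s t n k \<le> t"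
  using node_mono[of s t k "2 ^ n" n] by simp

text \<open>Half-open cells partition \<open>[s, t)\<close>, so at each point at most one summand is
  nonzero. Riemann sums become integrals over the line, and their limits follow from dominated
  convergence.\<close>

definition step_fun :: "real \<Rightarrow> real \<Rightarrow> nat \<Rightarrow> (real \<Rightarrow> real) \<Rightarrow> real \<Rightarrow> real" where
  "step_fun s t n h u = (\<Sum>k<2 ^ n. h (node s t n k) * indicator {node s t n k ..< node s t n (Suc k)} u)"

lemma step_fun_outside:
  assumes "s \<le> t" "u \<notin> {s..<t}"
  shows "step_fun s t n h u = 0"
  unfolding step_fun_def
proof (rule sum.neutral, intro ballI)
  fix k assume "k \<in> {..<(2::nat) ^ n}"
  then have "node s t n (Suc k) \<le> t" using assms by (intro node_le) auto
  moreover have "s \<le> node s t n k" using assms by (intro node_ge) auto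
  ultimately show "h (node s t n k) * indicator {node s t n k ..< node s t n (Suc k)} u = 0"
    using assms by (auto simp: indicator_def)
qed

text \<open>One sampling point \<open>v\<close> serves every \<open>h\<close>: it is the left end of
  the cell containing \<open>u\<close>.\<close>

lemma step_fun_inside:
  assumes "s \<le> u" "u < t"
  obtains v where "\<And>h. step_fun s t n h u = h v" "s \<le> v" "v \<le> u" "u - v \<le> (t - s) / 2 ^ n"
proof -
  define d where "d = (t - s) / 2 ^ n"
  have d: "d > 0" using assms by (simp add: d_def)
  define m where "m = nat \<lfloor>(u - s) / d\<rfloor>"
  have nd: "node s t n k = s + real k * d" for k by (simp add: node_def d_def)
  have q0: "0 \<le> (u - s) / d" using assms d by simp
  have m1: "real m \<le> (u - s) / d" "(u - s) / d < real m + 1"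
    using q0 by (auto simp: m_def) 
  have iff: "u \<in> {node s t n k ..< node s t n (Suc k)} \<longleftrightarrow> k = m" for k
  proof -
    have "u \<in> {node s t n k ..< node s t n (Suc k)} \<longleftrightarrow> real k \<le> (u - s) / d \<and> (u - s) / d < real k + 1"
      using d by (auto simp: nd field_simps)
    also have "\<dots> \<longleftrightarrow> k = m" using m1 by auto
    finally show ?thesis .
  qed
  have "(u - s) / d < 2 ^ n" using assms d by (simp add: d_def field_simps)
  with m1 have "real m < 2 ^ n" by linarith
  then have m2: "m < 2 ^ n" by simp
  have "step_fun s t n h u = h (node s t n m)" for h
  proof -
    have "step_fun s t n h u = (\<Sum>k<2 ^ n. if k = m then h (node s t n m) else 0)"
      unfolding step_fun_def by (intro sum.cong refl) (simp only: indicator_def iff, simp)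
    then show ?thesis using m2 by simp
  qed
  moreover have "s \<le> node s t n m" using assms by (intro node_ge) auto
  moreover have "node s t n m \<le> u" "u < node s t n m + d" using iff[of m] by (auto simp: node_Suc d_def)
  ultimately show thesis using that by (simp add: d_def)
qed

lemma step_fun_bound:
  assumes "s \<le> t" "\<And>u. s \<le> u \<Longrightarrow> u \<le> t \<Longrightarrow> \<bar>h u\<bar> \<le> C"
  shows "\<bar>step_fun s t n h u\<bar> \<le> C * indicator {s..t} u"
proof (cases "u \<in> {s..<t}")
  case True
  then obtain v where "step_fun s t n h u = h v" "s \<le> v" "v \<le> u"
    using step_fun_inside[of s u t n] by auto
  with assms True show ?thesis by auto
next
  case False
  have "0 \<le> C" using assms(2)[of s] assms(1) by auto
  then show ?thesis using step_fun_outside[OF assms(1) False, of n h] by (simp add: indicator_def)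
qed

lemma step_fun_tendsto:
  assumes "0 \<le> s" "s \<le> u" "u < t" "continuous_on {0..} h"
  shows "(\<lambda>n. step_fun s t n h u) \<longlonglongrightarrow> h u"
proof -
  have "\<exists>v. (\<forall>h. step_fun s t n h u = h v) \<and> s \<le> v \<and> v \<le> u \<and> u - v \<le> (t - s) / 2 ^ n" for n
    using step_fun_inside[OF assms(2,3), of n] by metis
  then obtain v where v: "\<And>n h. step_fun s t n h u = h (v n)" "\<And>n. s \<le> v n" "\<And>n. v n \<le> u"
    "\<And>n. u - v n \<le> (t - s) / 2 ^ n" by metis
  have "(\<lambda>n. (t - s) / 2 ^ n) \<longlonglongrightarrow> 0"
    by (rule LIMSEQ_divide_realpow_zero) simp
  then have "(\<lambda>n. u - v n) \<longlonglongrightarrow> 0"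
    by (rule tendsto_sandwich[of "\<lambda>_. 0" _ _ "\<lambda>n. (t - s) / 2 ^ n", rotated 3]) (auto simp: v)
  from tendsto_diff[OF tendsto_const[of u] this] have "v \<longlonglongrightarrow> u" by simp
  moreover have "v n \<in> {0..}" for n using v(2)[of n] assms by simp
  ultimately have "(\<lambda>n. h (v n)) \<longlonglongrightarrow> h u"
    using assms by (intro continuous_on_tendsto_compose[OF assms(4)]) auto
  then show ?thesis by (simp add: v)
qed

lemma step_fun_measurable [measurable]: "step_fun s t n h \<in> borel_measurable borel"
  unfolding step_fun_def by measurable

lemma step_fun_integral:
  assumes "s \<le> t"
  shows "(\<integral>u. step_fun s t n h u \<partial>lborel) = (\<Sum>k<2 ^ n. h (node s t n k) * ((t - s) / 2 ^ n))"
proof -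
  have 1: "node s t n k \<le> node s t n (Suc k)" for k using assms by (intro node_mono) auto
  have "(\<integral>u. step_fun s t n h u \<partial>lborel)
    = (\<Sum>k<2 ^ n. \<integral>u. h (node s t n k) * indicator {node s t n k ..< node s t n (Suc k)} u \<partial>lborel)"
    unfolding step_fun_def using 1 by (intro Bochner_Integration.integral_sum integrable_mult_right) auto
  also have "\<dots> = (\<Sum>k<2 ^ n. h (node s t n k) * ((t - s) / 2 ^ n))"
    using 1 by (intro sum.cong refl) (simp add: node_Suc)
  finally show ?thesis .
qed

text \<open>The step functions converge pointwise and are dominated by a constant on
  \<open>[s, t]\<close>. Their limit lives on the half-open interval, which differs from the closed
  one by a null set.\<close>

lemma riemann_sum_tendsto:
  assumes "0 \<le> s" "s \<le> t" "continuous_on {0..} h" 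
    and C: "\<And>u. 0 \<le> u \<Longrightarrow> \<bar>h u\<bar> \<le> C"
  shows "(\<lambda>n. \<Sum>k<2 ^ n. h (node s t n k) * ((t - s) / 2 ^ n)) \<longlonglongrightarrow> integral {s..t} h"
proof -
  have c: "continuous_on {s..t} h" using assms by (auto intro: continuous_on_subset)
  have m: "(\<lambda>u. indicator {s..t} u *\<^sub>R h u) \<in> borel_measurable lborel"
    using borel_measurable_continuous_on_indicator[OF _ c] by (simp add: measurable_lborel1)
  have "(\<lambda>u. indicator {s..<t} u * (indicator {s..t} u *\<^sub>R h u)) \<in> borel_measurable lborel"
    using m by measurable
  moreover have "(\<lambda>u. indicator {s..<t} u * (indicator {s..t} u *\<^sub>R h u)) = (\<lambda>u. indicator {s..<t} u * h u)"
    by (auto simp: indicator_def)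
  ultimately have m': "(\<lambda>u. indicator {s..<t} u * h u) \<in> borel_measurable lborel" by simp
  have lim: "(\<lambda>n. \<integral>u. step_fun s t n h u \<partial>lborel) \<longlonglongrightarrow> (\<integral>u. indicator {s..<t} u * h u \<partial>lborel)"
  proof (rule integral_dominated_convergence[where w="\<lambda>u. C * indicator {s..t} u"])
    show "(\<lambda>u. indicator {s..<t} u * h u) \<in> borel_measurable lborel" by (rule m')
    show "AE u in lborel. (\<lambda>n. step_fun s t n h u) \<longlonglongrightarrow> indicator {s..<t} u * h u"
    proof (rule AE_I2)
      fix u show "(\<lambda>n. step_fun s t n h u) \<longlonglongrightarrow> indicator {s..<t} u * h u"
        using step_fun_tendsto[of s u t h] step_fun_outside[of s t u] assms
        by (cases "u \<in> {s..<t}") auto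
    qed
    show "AE u in lborel. norm (step_fun s t n h u) \<le> C * indicator {s..t} u" for n
      using step_fun_bound[of s t h C n] C assms by auto
  qed (use assms in auto)
  have "(\<integral>u. indicator {s..<t} u * h u \<partial>lborel) = (LINT u:{s..t}|lborel. h u)"
    unfolding set_lebesgue_integral_def
  proof (rule integral_cong_AE)
    show "(\<lambda>u. indicator {s..t} u *\<^sub>R h u) \<in> borel_measurable lborel"
      "(\<lambda>u. indicator {s..<t} u * h u) \<in> borel_measurable lborel" by (rule m m')+
    show "AE u in lborel. indicator {s..<t} u * h u = indicator {s..t} u *\<^sub>R h u"
      using AE_lborel_singleton[of t] by eventually_elim (auto simp: indicator_def)
  qed
  also have "\<dots> = integral {s..t} h"
    using c by (intro set_borel_integral_eq_integral borel_integrable_atLeastAtMost') auto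
  finally show ?thesis using lim step_fun_integral[OF assms(2)] by simp
qed

section \<open>The Ito isometry for simple integrands\<close>

lemma integrable_mult_of_squares:
  fixes X Y :: "'a \<Rightarrow> real"
  assumes [measurable]: "X \<in> borel_measurable M" "Y \<in> borel_measurable M"
    and "integrable M (\<lambda>\<omega>. X \<omega> ^ 2)" "integrable M (\<lambda>\<omega>. Y \<omega> ^ 2)"
  shows "integrable M (\<lambda>\<omega>. X \<omega> * Y \<omega>)"
proof (rule Bochner_Integration.integrable_bound)
  show "integrable M (\<lambda>\<omega>. X \<omega> ^ 2 + Y \<omega> ^ 2)" using assms by auto
  have "\<bar>x * y\<bar> \<le> x ^ 2 + y ^ 2" for x y :: real
  proof -
    have "0 \<le> (\<bar>x\<bar> - \<bar>y\<bar>)\<^sup>2" by simp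
    then have "2 * \<bar>x * y\<bar> \<le> x ^ 2 + y ^ 2" by (simp add: power2_diff abs_mult)
    then show ?thesis by linarith
  qed
  then show "AE x in M. norm (X x * Y x) \<le> norm (X x ^ 2 + Y x ^ 2)" by auto
qed simp

context filtered_brownian_motion
begin

abbreviation "incr a b \<equiv> (\<lambda>\<omega>. W b \<omega> - W a \<omega>)"

definition bdd_adapted :: "real \<Rightarrow> real \<Rightarrow> ('a \<Rightarrow> real) \<Rightarrow> bool" where
  "bdd_adapted C a H \<longleftrightarrow> H \<in> borel_measurable (F a) \<and> (\<forall>\<omega>\<in>space M. \<bar>H \<omega>\<bar> \<le> C)"

lemma bdd_adapted_measurable: "bdd_adapted C a H \<Longrightarrow> H \<in> borel_measurable M"
  by (auto simp: bdd_adapted_def intro: measurable_F_M)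

lemma bdd_adapted_integrable: "bdd_adapted C a H \<Longrightarrow> integrable M H"
  by (rule integrable_const_bound[where B=C]) (auto simp: bdd_adapted_def intro: measurable_F_M)

lemma bdd_adapted_mult:
  "bdd_adapted C a G \<Longrightarrow> bdd_adapted D b H \<Longrightarrow> a \<le> b \<Longrightarrow> bdd_adapted (C * D) b (\<lambda>\<omega>. G \<omega> * H \<omega>)"
  unfolding bdd_adapted_def abs_mult
  by (auto intro!: borel_measurable_times mult_mono intro: measurable_F_mono order_trans[OF abs_ge_zero])

lemma incr_measurable_F: "0 \<le> a \<Longrightarrow> a \<le> b \<Longrightarrow> incr a b \<in> borel_measurable (F b)"
  by (intro borel_measurable_diff W_measurable measurable_F_mono[OF W_measurable]) auto

lemma incr_zero:
  assumes "0 \<le> q" "q \<le> r" "Y \<in> borel_measurable (F q)" "integrable M Y"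
  shows "integrable M (\<lambda>\<omega>. Y \<omega> * incr q r \<omega>)" "expectation (\<lambda>\<omega>. Y \<omega> * incr q r \<omega>) = 0"
  using increment_moment_mult(1)[of q r Y 1] increment_moments(1)[of q r Y] assms
  by (cases "q = r"; simp)+

lemma incr_square_integrable:
  assumes "0 \<le> a" "a \<le> b" "bdd_adapted C a H"
  shows "integrable M (\<lambda>\<omega>. (H \<omega> * incr a b \<omega>)\<^sup>2)"
proof (cases "a = b")
  case False
  have H: "H \<in> borel_measurable M" by (rule bdd_adapted_measurable[OF assms(3)])
  have i: "integrable M (\<lambda>\<omega>. (incr a b \<omega>)\<^sup>2)"
    using increment_moment(1)[of a b 2] assms False by simp
  show ?thesis
  proof (rule Bochner_Integration.integrable_bound[where f="\<lambda>\<omega>. C\<^sup>2 * (incr a b \<omega>)\<^sup>2"])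
    show "integrable M (\<lambda>\<omega>. C\<^sup>2 * (incr a b \<omega>)\<^sup>2)" using i by simp
    show "(\<lambda>\<omega>. (H \<omega> * incr a b \<omega>)\<^sup>2) \<in> borel_measurable M" using assms H by simp
    show "AE \<omega> in M. norm ((H \<omega> * incr a b \<omega>)\<^sup>2) \<le> norm (C\<^sup>2 * (incr a b \<omega>)\<^sup>2)"
    proof (rule AE_I2)
      fix \<omega> assume "\<omega> \<in> space M"
      then have "\<bar>H \<omega>\<bar> \<le> C" using assms by (auto simp: bdd_adapted_def)
      then have "(H \<omega>)\<^sup>2 \<le> C\<^sup>2" by (rule abs_le_square_iff[THEN iffD1, OF order_trans[OF _ abs_ge_self]])
      then show "norm ((H \<omega> * incr a b \<omega>)\<^sup>2) \<le> norm (C\<^sup>2 * (incr a b \<omega>)\<^sup>2)"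
        by (simp add: power_mult_distrib mult_right_mono)
    qed
  qed
qed simp

lemma incr_bdd:
  assumes "0 \<le> a" "a \<le> b" "bdd_adapted C a H"
  shows "integrable M (\<lambda>\<omega>. H \<omega> * incr a b \<omega>)" "(\<lambda>\<omega>. H \<omega> * incr a b \<omega>) \<in> borel_measurable (F b)"
proof -
  show "integrable M (\<lambda>\<omega>. H \<omega> * incr a b \<omega>)"
    using incr_zero(1)[of a b H] assms bdd_adapted_integrable[OF assms(3)] by (simp add: bdd_adapted_def)
  have "H \<in> borel_measurable (F b)" using assms measurable_F_mono by (auto simp: bdd_adapted_def)
  then show "(\<lambda>\<omega>. H \<omega> * incr a b \<omega>) \<in> borel_measurable (F b)"
    using incr_measurable_F[OF assms(1,2)] by (rule borel_measurable_times)
qed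

text \<open>Cutting both intervals at \<open>c\<close> and at \<open>e = min b d\<close> leaves the
  square of the increment over \<open>[c, e]\<close>, which has mean \<open>e - c\<close>, and
  products whose last increment is independent of all other factors and therefore contributes zero.
  If the intervals do not overlap, only a product of the second kind is left.\<close>

lemma increment_product_expectation:
  assumes "0 \<le> a" "a \<le> b" "a \<le> c" "c \<le> d" "bdd_adapted C a G" "bdd_adapted D c H"
  shows "expectation (\<lambda>\<omega>. (G \<omega> * incr a b \<omega>) * (H \<omega> * incr c d \<omega>)) =
    expectation (\<lambda>\<omega>. G \<omega> * H \<omega>) * max 0 (min b d - c)"
proof -
  have GH: "bdd_adapted (C * D) c (\<lambda>\<omega>. G \<omega> * H \<omega>)" using assms by (intro bdd_adapted_mult)
  have z: "integrable M (\<lambda>\<omega>. (G \<omega> * H \<omega>) * incr p q \<omega> * incr r s \<omega>)"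
    "expectation (\<lambda>\<omega>. (G \<omega> * H \<omega>) * incr p q \<omega> * incr r s \<omega>) = 0"
    if "c \<le> p" "p \<le> q" "q \<le> r" "r \<le> s" for p q r s
  proof -
    have "bdd_adapted (C * D) p (\<lambda>\<omega>. G \<omega> * H \<omega>)"
      using GH that by (auto simp: bdd_adapted_def intro: measurable_F_mono)
    from incr_bdd[OF _ that(2) this] assms that
    have "integrable M (\<lambda>\<omega>. G \<omega> * H \<omega> * incr p q \<omega>)" "(\<lambda>\<omega>. G \<omega> * H \<omega> * incr p q \<omega>) \<in> borel_measurable (F q)"
      by auto
    then show "integrable M (\<lambda>\<omega>. (G \<omega> * H \<omega>) * incr p q \<omega> * incr r s \<omega>)"
    "expectation (\<lambda>\<omega>. (G \<omega> * H \<omega>) * incr p q \<omega> * incr r s \<omega>) = 0"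
      using incr_zero[of r s "\<lambda>\<omega>. G \<omega> * H \<omega> * incr p q \<omega>"] that assms
      by (auto intro: measurable_F_mono)
  qed
  have z': "integrable M (\<lambda>\<omega>. (G \<omega> * incr a p \<omega>) * H \<omega> * incr r s \<omega>)"
    "expectation (\<lambda>\<omega>. (G \<omega> * incr a p \<omega>) * H \<omega> * incr r s \<omega>) = 0"
    if "a \<le> p" "p \<le> c" "c \<le> r" "r \<le> s" for p r s
  proof -
    have m1: "(\<lambda>\<omega>. G \<omega> * incr a p \<omega>) \<in> borel_measurable (F c)"
      using incr_bdd(2)[OF assms(1) that(1) assms(5)] that by (auto intro: measurable_F_mono)
    have m2: "H \<in> borel_measurable (F c)" using assms by (simp add: bdd_adapted_def)
    have m: "(\<lambda>\<omega>. (G \<omega> * incr a p \<omega>) * H \<omega>) \<in> borel_measurable (F r)"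
      using borel_measurable_times[OF m1 m2] that(3) by (rule measurable_F_mono)
    have "integrable M (\<lambda>\<omega>. (G \<omega> * incr a p \<omega>) * H \<omega>)"
    proof (rule integrable_mult_of_squares)
      show "integrable M (\<lambda>\<omega>. (G \<omega> * incr a p \<omega>)\<^sup>2)" using assms that by (intro incr_square_integrable)
      have "bdd_adapted (D * D) c (\<lambda>\<omega>. H \<omega> * H \<omega>)" by (rule bdd_adapted_mult[OF assms(6,6)]) simp
      then show "integrable M (\<lambda>\<omega>. (H \<omega>)\<^sup>2)" unfolding power2_eq_square by (rule bdd_adapted_integrable)
    qed (use m1 m2 in \<open>auto intro: measurable_F_M\<close>)
    from incr_zero[OF _ that(4) m this] assms that
    show "integrable M (\<lambda>\<omega>. (G \<omega> * incr a p \<omega>) * H \<omega> * incr r s \<omega>)"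
      "expectation (\<lambda>\<omega>. (G \<omega> * incr a p \<omega>) * H \<omega> * incr r s \<omega>) = 0" by auto
  qed
  show ?thesis
  proof (cases "b \<le> c")
    case True
    then show ?thesis using z'(2)[of b c d] assms by (simp add: mult.assoc)
  next
    case False
    define e where "e = min b d"
    have e: "c \<le> e" "e \<le> b" "e \<le> d" "e = b \<or> e = d" using False assms by (auto simp: e_def)
    let ?s = "\<lambda>\<omega>. (G \<omega> * H \<omega>) * (incr c e \<omega>)\<^sup>2"
    have s: "integrable M ?s" "expectation ?s = expectation (\<lambda>\<omega>. G \<omega> * H \<omega>) * (e - c)"
      using increment_moment_mult(1)[of c e "\<lambda>\<omega>. G \<omega> * H \<omega>" 2]
       increment_moments(2)[of c e "\<lambda>\<omega>. G \<omega> * H \<omega>"] e assms GH bdd_adapted_integrable[OF GH]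
      by (cases "c = e"; simp add: bdd_adapted_def)+
    \<comment> \<open>Since \<open>e\<close> is \<open>b\<close> or \<open>d\<close>, one of the
      last two terms vanishes, and so does the product of the increments over \<open>[e, b]\<close>
      and \<open>[e, d]\<close>, which therefore does not appear.\<close>
    have "(\<lambda>\<omega>. (G \<omega> * incr a b \<omega>) * (H \<omega> * incr c d \<omega>)) =
      (\<lambda>\<omega>. (G \<omega> * incr a c \<omega>) * H \<omega> * incr c d \<omega> + ?s \<omega> + (G \<omega> * H \<omega>) * incr c e \<omega> * incr e b \<omega>
        + (G \<omega> * H \<omega>) * incr c e \<omega> * incr e d \<omega>)"
      using e(4) by (auto simp: fun_eq_iff algebra_simps power2_eq_square)
    then show ?thesis
      using s z'[of c c d] z[of c e e b] z[of c e e d] assms e False by (simp add: e_def)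
  qed
qed

lemma integral_indicator_interval_product:
  fixes a b c d :: real
  shows "integrable lborel (\<lambda>u. indicator {a..<b} u * indicator {c..<d} u :: real)"
    and "(\<integral>u. indicator {a..<b} u * indicator {c..<d} u \<partial>lborel) = max 0 (min b d - max a c)"
proof -
  have *: "(\<lambda>u. indicator {a..<b} u * indicator {c..<d} u :: real) = indicator {max a c ..< min b d}"
    by (auto simp: indicator_def)
  have l: "emeasure lborel {max a c ..< min b d} < \<infinity>"
    by (cases "max a c \<le> min b d") auto
  show "integrable lborel (\<lambda>u. indicator {a..<b} u * indicator {c..<d} u :: real)"
    unfolding * using l by (intro integrable_real_indicator) auto
  show "(\<integral>u. indicator {a..<b} u * indicator {c..<d} u \<partial>lborel) = max 0 (min b d - max a c)"
    unfolding * by (cases "max a c \<le> min b d") (auto simp: measure_def)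
qed

text \<open>The intervals may overlap arbitrarily, so the lemma also applies to differences of Riemann sums
  over partitions that are not nested, without passing to a common refinement.\<close>

lemma simple_integral_isometry:
  fixes a b :: "'j \<Rightarrow> real" and H :: "'j \<Rightarrow> 'a \<Rightarrow> real"
  assumes "finite J"
    and J: "\<And>j. j \<in> J \<Longrightarrow> 0 \<le> a j \<and> a j \<le> b j \<and> bdd_adapted C (a j) (H j)"
  defines "Q \<equiv> \<lambda>\<omega>. \<integral>u. (\<Sum>j\<in>J. H j \<omega> * indicator {a j..<b j} u)\<^sup>2 \<partial>lborel"
  shows "integrable M (\<lambda>\<omega>. (\<Sum>j\<in>J. H j \<omega> * incr (a j) (b j) \<omega>)\<^sup>2)"
    and "integrable M Q"
    and "expectation (\<lambda>\<omega>. (\<Sum>j\<in>J. H j \<omega> * incr (a j) (b j) \<omega>)\<^sup>2) = expectation Q"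
proof -
  \<comment> \<open>The length of the overlap of two intervals. Both sides of the isometry expand
    into the same double sum with these weights.\<close>
  define ov where "ov i j = max 0 (min (b i) (b j) - max (a i) (a j))" for i j
  have Q: "Q = (\<lambda>\<omega>. \<Sum>i\<in>J. \<Sum>j\<in>J. (H i \<omega> * H j \<omega>) * ov i j)"
  proof
    fix \<omega>
    have "Q \<omega> = (\<integral>u. (\<Sum>i\<in>J. \<Sum>j\<in>J. (H i \<omega> * H j \<omega>) * (indicator {a i..<b i} u * indicator {a j..<b j} u)) \<partial>lborel)"
      unfolding Q_def power2_eq_square sum_product by (intro Bochner_Integration.integral_cong sum.cong refl) (simp add: ac_simps)
    also have "\<dots> = (\<Sum>i\<in>J. \<Sum>j\<in>J. (H i \<omega> * H j \<omega>) * ov i j)"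
      by (simp add: integral_indicator_interval_product ov_def
          Bochner_Integration.integral_sum Bochner_Integration.integrable_sum)
    finally show "Q \<omega> = (\<Sum>i\<in>J. \<Sum>j\<in>J. (H i \<omega> * H j \<omega>) * ov i j)" .
  qed
  have bd: "bdd_adapted (C * C) (max (a i) (a j)) (\<lambda>\<omega>. H i \<omega> * H j \<omega>)" if "i \<in> J" "j \<in> J" for i j
  proof -
    have "bdd_adapted C (max (a i) (a j)) (H i)" "bdd_adapted C (max (a i) (a j)) (H j)"
      using J[OF that(1)] J[OF that(2)] by (auto simp: bdd_adapted_def intro: measurable_F_mono)
    then show ?thesis by (rule bdd_adapted_mult) simp
  qed
  have iHH: "integrable M (\<lambda>\<omega>. H i \<omega> * H j \<omega>)" if "i \<in> J" "j \<in> J" for i j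
    using bd[OF that] by (rule bdd_adapted_integrable)
  show "integrable M Q" unfolding Q using iHH by (intro Bochner_Integration.integrable_sum integrable_mult_left)
  have EQ: "expectation Q = (\<Sum>i\<in>J. \<Sum>j\<in>J. expectation (\<lambda>\<omega>. H i \<omega> * H j \<omega>) * ov i j)"
    unfolding Q using iHH by (simp add: Bochner_Integration.integral_sum Bochner_Integration.integrable_sum)
  have sq: "(\<lambda>\<omega>. (\<Sum>j\<in>J. H j \<omega> * incr (a j) (b j) \<omega>)\<^sup>2) =
    (\<lambda>\<omega>. \<Sum>i\<in>J. \<Sum>j\<in>J. (H i \<omega> * incr (a i) (b i) \<omega>) * (H j \<omega> * incr (a j) (b j) \<omega>))"
    unfolding power2_eq_square sum_product by simp
  have i2: "integrable M (\<lambda>\<omega>. (H i \<omega> * incr (a i) (b i) \<omega>) * (H j \<omega> * incr (a j) (b j) \<omega>))"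
    if "i \<in> J" "j \<in> J" for i j
  proof (rule integrable_mult_of_squares)
    show "integrable M (\<lambda>\<omega>. (H i \<omega> * incr (a i) (b i) \<omega>)\<^sup>2)" "integrable M (\<lambda>\<omega>. (H j \<omega> * incr (a j) (b j) \<omega>)\<^sup>2)"
      using J[OF that(1)] J[OF that(2)] by (auto intro: incr_square_integrable)
    show "(\<lambda>\<omega>. H i \<omega> * incr (a i) (b i) \<omega>) \<in> borel_measurable M" "(\<lambda>\<omega>. H j \<omega> * incr (a j) (b j) \<omega>) \<in> borel_measurable M"
      using J[OF that(1)] J[OF that(2)] by (auto intro!: measurable_F_M[OF incr_bdd(2)])
  qed
  show "integrable M (\<lambda>\<omega>. (\<Sum>j\<in>J. H j \<omega> * incr (a j) (b j) \<omega>)\<^sup>2)"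
    unfolding sq using i2 by (intro Bochner_Integration.integrable_sum)
  have e2: "expectation (\<lambda>\<omega>. (H i \<omega> * incr (a i) (b i) \<omega>) * (H j \<omega> * incr (a j) (b j) \<omega>)) =
    expectation (\<lambda>\<omega>. H i \<omega> * H j \<omega>) * ov i j" if "i \<in> J" "j \<in> J" for i j
  proof (cases "a i \<le> a j")
    case True
    then show ?thesis
      using increment_product_expectation[of "a i" "b i" "a j" "b j" C "H i" C "H j"] J[OF that(1)] J[OF that(2)]
      by (simp add: ov_def max_def)
  next
    case False
    then show ?thesis
      using increment_product_expectation[of "a j" "b j" "a i" "b i" C "H j" C "H i"] J[OF that(1)] J[OF that(2)]
      by (simp add: ov_def max_def min.commute mult.commute)
  qed
  show "expectation (\<lambda>\<omega>. (\<Sum>j\<in>J. H j \<omega> * incr (a j) (b j) \<omega>)\<^sup>2) = expectation Q"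
    unfolding sq EQ using i2 e2 by (simp add: Bochner_Integration.integral_sum Bochner_Integration.integrable_sum)
qed

end

lemma step_fun_tendsto_indicator:
  assumes "0 \<le> s" "s \<le> t" "continuous_on {0..} h"
  shows "(\<lambda>n. step_fun s t n h u) \<longlonglongrightarrow> indicator {s..<t} u * h u"
  using step_fun_tendsto[of s u t h] step_fun_outside[of s t u] assms
  by (cases "u \<in> {s..<t}") auto

lemma (in finite_measure) integrable_power_le4:
  fixes Z :: "'a \<Rightarrow> real"
  assumes [measurable]: "Z \<in> borel_measurable M" and "integrable M (\<lambda>\<omega>. Z \<omega> ^ 4)" "p \<le> 4"
  shows "integrable M (\<lambda>\<omega>. Z \<omega> ^ p)"
proof (rule Bochner_Integration.integrable_bound)
  show "integrable M (\<lambda>\<omega>. 1 + Z \<omega> ^ 4)" using assms by auto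
  have "\<bar>z ^ p\<bar> \<le> 1 + z ^ 4" for z :: real
  proof (cases "\<bar>z\<bar> \<le> 1")
    case True
    then have "\<bar>z\<bar> ^ p \<le> 1" by (intro power_le_one) auto
    then show ?thesis by (simp add: power_abs add_increasing2)
  next
    case False
    then have "\<bar>z\<bar> ^ p \<le> \<bar>z\<bar> ^ 4" using assms by (intro power_increasing) auto
    then show ?thesis by (simp add: power_abs)
  qed
  then show "AE x in M. norm (Z x ^ p) \<le> norm (1 + Z x ^ 4)" by (auto intro: order_trans[OF _ abs_ge_self])
qed simp

lemma (in filtered_brownian_motion) bdd_mult_integrable:
  assumes "bdd_adapted D a Y" "integrable M Z"
  shows "integrable M (\<lambda>\<omega>. Y \<omega> * Z \<omega>)"
proof (rule Bochner_Integration.integrable_bound[where f="\<lambda>\<omega>. D * Z \<omega>"])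
  show "(\<lambda>\<omega>. Y \<omega> * Z \<omega>) \<in> borel_measurable M"
    using assms bdd_adapted_measurable by auto
  show "AE \<omega> in M. norm (Y \<omega> * Z \<omega>) \<le> norm (D * Z \<omega>)"
    using assms(1) by (intro AE_I2) (auto simp: bdd_adapted_def abs_mult intro!: mult_right_mono intro: order_trans[OF _ abs_ge_self])
qed (use assms in auto)

section \<open>Riemann sums of a bounded adapted integrand\<close>

locale bounded_integrand = filtered_brownian_motion M F W
  for M :: "'a measure" and F :: "real \<Rightarrow> 'a measure" and W :: "real \<Rightarrow> 'a \<Rightarrow> real" +
  fixes H :: "real \<Rightarrow> 'a \<Rightarrow> real" and C :: real
  assumes H_adapted: "0 \<le> u \<Longrightarrow> bdd_adapted C u (H u)"
    and H_cont: "\<omega> \<in> space M \<Longrightarrow> continuous_on {0..} (\<lambda>u. H u \<omega>)"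
begin

lemma C_nonneg: "0 \<le> C"
proof -
  obtain \<omega> where "\<omega> \<in> space M" using not_empty by blast
  then have "\<bar>H 0 \<omega>\<bar> \<le> C" using H_adapted[of 0] by (simp add: bdd_adapted_def)
  then show ?thesis by (rule order_trans[OF abs_ge_zero])
qed

lemma H_bound: "0 \<le> u \<Longrightarrow> \<omega> \<in> space M \<Longrightarrow> \<bar>H u \<omega>\<bar> \<le> C"
  using H_adapted by (auto simp: bdd_adapted_def)

text \<open>The separate upper index \<open>j\<close> allows the moments to be found by induction on
  the number of summands; \<open>isum\<close> is the complete sum.\<close>

definition psum :: "real \<Rightarrow> real \<Rightarrow> nat \<Rightarrow> nat \<Rightarrow> 'a \<Rightarrow> real" where
  "psum s t n j \<omega> = (\<Sum>k<j. H (node s t n k) \<omega> * incr (node s t n k) (node s t n (Suc k)) \<omega>)"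

abbreviation "isum s t n \<equiv> psum s t n (2 ^ n)"

text \<open>The sums over \<open>[0, t]\<close> and \<open>[0, s]\<close> in the definition of a solution use incompatible dyadic grids.\<close>

lemma isum_additive:
  assumes st: "0 \<le> s" "s \<le> t"
  defines "R \<equiv> \<lambda>n \<omega>. isum 0 t n \<omega> - isum 0 s n \<omega> - isum s t n \<omega>"
  shows "integrable M (\<lambda>\<omega>. (R n \<omega>)\<^sup>2)"
    and "(\<lambda>n. expectation (\<lambda>\<omega>. (R n \<omega>)\<^sup>2)) \<longlonglongrightarrow> 0"
proof -
  \<comment> \<open>Three grids, on \<open>[0, t]\<close>, \<open>[0, s]\<close> and
    \<open>[s, t]\<close>, with signs 1, -1, -1, are merged into a single simple integral indexed by
    pairs of grid and cell.\<close>
  define lo hi sg :: "nat \<Rightarrow> real" where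
    "lo i = (if i = 2 then s else 0)" and "hi i = (if i = 1 then s else t)" and
    "sg i = (if i = 0 then 1 else -1)" for i
  have lh: "0 \<le> lo i" "lo i \<le> hi i" for i using st by (auto simp: lo_def hi_def)
  define J where "J n = {..<3::nat} \<times> {..<(2::nat) ^ n}" for n :: nat
  define a b where "a n = (\<lambda>(i, k). node (lo i) (hi i) n k)"
    and "b n = (\<lambda>(i, k). node (lo i) (hi i) n (Suc k))" for n
  define G where "G n = (\<lambda>(i, k) \<omega>. sg i * H (node (lo i) (hi i) n k) \<omega>)" for n
  have J3: "(\<Sum>i<3. f i) = f 0 + f 1 + f (2::nat)" for f :: "nat \<Rightarrow> real"
    by (simp add: numeral_3_eq_3 numeral_2_eq_2 lessThan_Suc)
  have R: "R n \<omega> = (\<Sum>j\<in>J n. G n j \<omega> * incr (a n j) (b n j) \<omega>)" for n \<omega>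
  proof -
    have "(\<Sum>j\<in>J n. G n j \<omega> * incr (a n j) (b n j) \<omega>) = (\<Sum>i<3. sg i * isum (lo i) (hi i) n \<omega>)"
      unfolding J_def G_def a_def b_def psum_def
      by (simp add: sum.cartesian_product' sum_distrib_left mult.assoc)
    then show ?thesis by (simp add: R_def J3 lo_def hi_def sg_def)
  qed
  define E where "E n \<omega> u = (\<Sum>i<3. sg i * step_fun (lo i) (hi i) n (\<lambda>u. H u \<omega>) u)" for n \<omega> u
  have E: "(\<Sum>j\<in>J n. G n j \<omega> * indicator {a n j..<b n j} u) = E n \<omega> u" for n \<omega> u
    unfolding J_def G_def a_def b_def E_def step_fun_def
    by (simp only: sum.cartesian_product' sum_distrib_left mult.assoc prod.case)
  have fam: "finite (J n)" "\<And>j. j \<in> J n \<Longrightarrow> 0 \<le> a n j \<and> a n j \<le> b n j \<and> bdd_adapted C (a n j) (G n j)" for n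
  proof -
    show "finite (J n)" by (simp add: J_def)
    fix j assume "j \<in> J n"
    obtain i k where j: "j = (i, k)" by fastforce
    have n0: "0 \<le> node (lo i) (hi i) n k" using node_ge[OF lh(2), of i n k] lh(1)[of i] by simp
    have "node (lo i) (hi i) n k \<le> node (lo i) (hi i) n (Suc k)" using lh by (intro node_mono) auto
    moreover have "bdd_adapted C (node (lo i) (hi i) n k) (\<lambda>\<omega>. sg i * H (node (lo i) (hi i) n k) \<omega>)"
    proof -
      have "sg i = 1 \<or> sg i = -1" by (simp add: sg_def)
      with H_adapted[OF n0] show ?thesis by (auto simp: bdd_adapted_def)
    qed
    moreover note n0
    ultimately show "0 \<le> a n j \<and> a n j \<le> b n j \<and> bdd_adapted C (a n j) (G n j)"
      by (simp add: j a_def b_def G_def)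
  qed
  have iso: "integrable M (\<lambda>\<omega>. (R n \<omega>)\<^sup>2)"
    "integrable M (\<lambda>\<omega>. \<integral>u. (E n \<omega> u)\<^sup>2 \<partial>lborel)"
    "expectation (\<lambda>\<omega>. (R n \<omega>)\<^sup>2) = expectation (\<lambda>\<omega>. \<integral>u. (E n \<omega> u)\<^sup>2 \<partial>lborel)" for n
    using simple_integral_isometry[of "J n" "a n" "b n" C "G n", OF fam] unfolding E R by blast+
  show "integrable M (\<lambda>\<omega>. (R n \<omega>)\<^sup>2)" by (rule iso(1))
  have Eb: "\<bar>E n \<omega> u\<bar> \<le> 3 * C * indicator {0..t} u" if "\<omega> \<in> space M" for n \<omega> u
  proof -
    have 1: "\<bar>sg i * step_fun (lo i) (hi i) n (\<lambda>u. H u \<omega>) u\<bar> \<le> C * indicator {0..t} u" for i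
    proof -
      have "\<bar>sg i * step_fun (lo i) (hi i) n (\<lambda>u. H u \<omega>) u\<bar> = \<bar>step_fun (lo i) (hi i) n (\<lambda>u. H u \<omega>) u\<bar>"
        unfolding abs_mult by (simp add: sg_def)
      also have "\<dots> \<le> C * indicator {lo i..hi i} u"
        using lh[of i] that by (intro step_fun_bound H_bound) auto
      also have "\<dots> \<le> C * indicator {0..t} u"
        using C_nonneg st by (intro mult_left_mono) (auto simp: indicator_def lo_def hi_def)
      finally show ?thesis .
    qed
    show ?thesis unfolding E_def J3 using 1[of 0] 1[of 1] 1[of 2] by linarith
  qed
  have Em: "E n \<omega> \<in> borel_measurable borel" for n \<omega> unfolding E_def[abs_def] by measurable
  \<comment> \<open>In the limit the grids no longer matter: the signed indicators of
    \<open>[0, t)\<close>, \<open>[0, s)\<close> and \<open>[s, t)\<close> cancel at every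
    point.\<close>
  have Elim: "(\<lambda>n. E n \<omega> u) \<longlonglongrightarrow> 0" if "\<omega> \<in> space M" for \<omega> u
  proof -
    have "(\<lambda>n. E n \<omega> u) \<longlonglongrightarrow> (\<Sum>i<3. sg i * (indicator {lo i..<hi i} u * H u \<omega>))"
      unfolding E_def using lh H_cont[OF that]
      by (intro tendsto_sum tendsto_mult tendsto_const step_fun_tendsto_indicator) auto
    also have "(\<Sum>i<3. sg i * (indicator {lo i..<hi i} u * H u \<omega>)) = 0"
      unfolding J3 using st by (auto simp: sg_def lo_def hi_def indicator_def)
    finally show ?thesis .
  qed
  define w where "w u = (3 * C)\<^sup>2 * indicator {0..t} u" for u :: real
  have w: "integrable lborel w" unfolding w_def[abs_def] using st by auto
  have Ew: "\<bar>(E n \<omega> u)\<^sup>2\<bar> \<le> w u" if "\<omega> \<in> space M" for n \<omega> u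
  proof -
    have "(E n \<omega> u)\<^sup>2 \<le> (3 * C * indicator {0..t} u)\<^sup>2"
      using Eb[OF that, of n u] by (subst power2_abs[symmetric], intro power_mono) auto
    then show ?thesis by (cases "u \<in> {0..t}") (auto simp: w_def power_mult_distrib)
  qed
  \<comment> \<open>By the isometry this is the second moment of \<open>R n\<close>. Dominated
    convergence is applied twice, in \<open>u\<close> for fixed \<open>\<omega>\<close> and then in
    \<open>\<omega>\<close>.\<close>
  have "(\<lambda>n. expectation (\<lambda>\<omega>. \<integral>u. (E n \<omega> u)\<^sup>2 \<partial>lborel)) \<longlonglongrightarrow> expectation (\<lambda>\<omega>. 0)"
  proof (rule integral_dominated_convergence[where w="\<lambda>_. \<integral>u. w u \<partial>lborel"])
    show "AE \<omega> in M. (\<lambda>n. \<integral>u. (E n \<omega> u)\<^sup>2 \<partial>lborel) \<longlonglongrightarrow> 0"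
    proof (rule AE_I2)
      fix \<omega> assume \<omega>: "\<omega> \<in> space M"
      have "(\<lambda>n. \<integral>u. (E n \<omega> u)\<^sup>2 \<partial>lborel) \<longlonglongrightarrow> (\<integral>u. 0 \<partial>(lborel :: real measure))"
      proof (rule integral_dominated_convergence[where w=w])
        show "AE u in lborel. (\<lambda>n. (E n \<omega> u)\<^sup>2) \<longlonglongrightarrow> 0"
          using tendsto_power[OF Elim[OF \<omega>], of _ 2] by simp
      qed (use Em w Ew[OF \<omega>] in auto)
      then show "(\<lambda>n. \<integral>u. (E n \<omega> u)\<^sup>2 \<partial>lborel) \<longlonglongrightarrow> 0" by simp
    qed
    show "(\<lambda>\<omega>. \<integral>u. (E n \<omega> u)\<^sup>2 \<partial>lborel) \<in> borel_measurable M" for n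
      using iso(2)[of n] by auto
    show "AE \<omega> in M. norm (\<integral>u. (E n \<omega> u)\<^sup>2 \<partial>lborel) \<le> (\<integral>u. w u \<partial>lborel)" for n
    proof (rule AE_I2)
      fix \<omega> assume \<omega>: "\<omega> \<in> space M"
      show "norm (\<integral>u. (E n \<omega> u)\<^sup>2 \<partial>lborel) \<le> (\<integral>u. w u \<partial>lborel)"
      proof -
        have i: "integrable lborel (\<lambda>u. (E n \<omega> u)\<^sup>2)"
          by (rule Bochner_Integration.integrable_bound[OF w])
             (use Em Ew[OF \<omega>] in \<open>auto intro!: AE_I2 intro: order_trans[OF _ abs_ge_self]\<close>)
        have "(\<integral>u. (E n \<omega> u)\<^sup>2 \<partial>lborel) \<le> (\<integral>u. w u \<partial>lborel)"
          using i w Ew[OF \<omega>] by (intro integral_mono) auto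
        then show ?thesis by simp
      qed
    qed
  qed auto
  then show "(\<lambda>n. expectation (\<lambda>\<omega>. (R n \<omega>)\<^sup>2)) \<longlonglongrightarrow> 0"
    by (simp add: iso(3))
qed

lemma psum_Suc: "psum s t n (Suc j) \<omega> =
    psum s t n j \<omega> + H (node s t n j) \<omega> * incr (node s t n j) (node s t n (Suc j)) \<omega>"
  by (simp add: psum_def)

context
  fixes s t :: real and n :: nat
  assumes s0: "0 \<le> s" and st: "s < t"
begin

lemma node_nonneg': "0 \<le> node s t n k"
  using node_ge[of s t n k] s0 st by simp

lemma node_less_Suc: "node s t n k < node s t n (Suc k)"
  using st by (simp add: node_Suc)

lemma psum_measurable: "psum s t n j \<in> borel_measurable (F (node s t n j))"
  unfolding psum_def[abs_def]
proof (rule borel_measurable_sum)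
  fix k assume "k \<in> {..<j}"
  then have "node s t n (Suc k) \<le> node s t n j" using st by (intro node_mono) auto
  moreover have "(\<lambda>\<omega>. H (node s t n k) \<omega> * incr (node s t n k) (node s t n (Suc k)) \<omega>)
      \<in> borel_measurable (F (node s t n (Suc k)))"
    using node_nonneg' node_less_Suc[of k] by (intro incr_bdd(2)[OF _ _ H_adapted]) auto
  ultimately show "(\<lambda>\<omega>. H (node s t n k) \<omega> * incr (node s t n k) (node s t n (Suc k)) \<omega>)
      \<in> borel_measurable (F (node s t n j))" by (rule measurable_F_mono[rotated])
qed

text \<open>Each new summand is a bounded factor known at its left node times an independent
  Gaussian increment, so terms with an odd power of the increment vanish and the induction closes.
  The fourth bound is the fourth moment of a Gaussian variable of variance
  \<open>C\<^sup>2 * (j * \<Delta>)\<close>. For the complete sum \<open>j * \<Delta>\<close> is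
  \<open>t - s\<close>, so the bounds do not depend on \<open>n\<close>. The weight \<open>Y\<close>
  carries the conditioning on the past of \<open>s\<close>.\<close>

lemma psum_moments:
  assumes Y: "bdd_adapted D s Y"
  defines "\<Delta> \<equiv> (t - s) / 2 ^ n"
  shows "integrable M (\<lambda>\<omega>. psum s t n j \<omega> ^ 4)
    \<and> expectation (\<lambda>\<omega>. Y \<omega> * psum s t n j \<omega>) = 0
    \<and> expectation (\<lambda>\<omega>. Y \<omega> * (psum s t n j \<omega>)\<^sup>2) =
        (\<Sum>k<j. \<Delta> * expectation (\<lambda>\<omega>. Y \<omega> * (H (node s t n k) \<omega>)\<^sup>2))
    \<and> expectation (\<lambda>\<omega>. (psum s t n j \<omega>)\<^sup>2) \<le> C\<^sup>2 * (j * \<Delta>)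
    \<and> expectation (\<lambda>\<omega>. psum s t n j \<omega> ^ 4) \<le> 3 * C ^ 4 * (j * \<Delta>)\<^sup>2"
proof (induction j)
  case 0
  then show ?case by (simp add: psum_def)
next
  case (Suc j)
  let ?u = "node s t n j" and ?v = "node s t n (Suc j)"
  define S h I where "S = psum s t n j" and "h = H ?u" and "I = incr ?u ?v"
  have S': "psum s t n (Suc j) = (\<lambda>\<omega>. S \<omega> + h \<omega> * I \<omega>)"
    by (simp add: fun_eq_iff psum_Suc S_def h_def I_def)
  have uv: "0 \<le> ?u" "?u < ?v" "?v - ?u = \<Delta>"
    using node_nonneg' node_less_Suc by (auto simp: node_Suc \<Delta>_def)
  have \<Delta>: "\<Delta> > 0" using uv by simp
  have Sm: "S \<in> borel_measurable (F ?u)" unfolding S_def by (rule psum_measurable)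
  have hb: "bdd_adapted C ?u h" unfolding h_def using H_adapted uv by simp
  have hm: "h \<in> borel_measurable (F ?u)" using hb by (simp add: bdd_adapted_def)
  have su: "s \<le> ?u" using st by (intro node_ge) simp
  have Yb: "bdd_adapted D ?u Y" using Y su by (auto simp: bdd_adapted_def intro: measurable_F_mono)
  have Ym: "Y \<in> borel_measurable (F ?u)" using Yb by (simp add: bdd_adapted_def)
  have S4: "integrable M (\<lambda>\<omega>. S \<omega> ^ 4)" using Suc by (simp add: S_def)
  have Sp: "integrable M (\<lambda>\<omega>. S \<omega> ^ p)" if "p \<le> 4" for p
    using integrable_power_le4[OF measurable_F_M[OF Sm] S4 that] .
  have S1: "integrable M S" using Sp[of 1] by simp
  have hp: "bdd_adapted (C ^ p) ?u (\<lambda>\<omega>. h \<omega> ^ p)" for p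
    using hb by (auto simp: bdd_adapted_def power_abs intro!: power_mono)
  have hpS: "integrable M (\<lambda>\<omega>. h \<omega> ^ p * S \<omega> ^ q)" if "q \<le> 4" for p q
    by (rule bdd_mult_integrable[OF hp Sp[OF that]])
  have hpSm: "(\<lambda>\<omega>. h \<omega> ^ p * S \<omega> ^ q) \<in> borel_measurable (F ?u)" for p q
    using hm Sm by (intro borel_measurable_times borel_measurable_power)
  have mi: "integrable M (\<lambda>\<omega>. Z \<omega> * I \<omega> ^ p)"
    if "Z \<in> borel_measurable (F ?u)" "integrable M Z" for Z p
    using increment_moment_mult(1)[OF uv(1,2) that] by (simp add: I_def)
  have mo: "expectation (\<lambda>\<omega>. Z \<omega> * I \<omega>) = 0" "expectation (\<lambda>\<omega>. Z \<omega> * I \<omega> ^ 2) = \<Delta> * expectation Z"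
    "expectation (\<lambda>\<omega>. Z \<omega> * I \<omega> ^ 3) = 0" "expectation (\<lambda>\<omega>. Z \<omega> * I \<omega> ^ 4) = 3 * \<Delta>\<^sup>2 * expectation Z"
    if "Z \<in> borel_measurable (F ?u)" "integrable M Z" for Z
    using increment_moments[OF uv(1,2) that] by (simp_all add: I_def uv(3))
  have hI: "integrable M (\<lambda>\<omega>. (h \<omega> ^ p * S \<omega> ^ q) * I \<omega> ^ r)" if "q \<le> 4" for p q r
    by (rule mi[OF hpSm hpS[OF that]])
  have a1: "expectation (\<lambda>\<omega>. Y \<omega> * (S \<omega> + h \<omega> * I \<omega>)) = 0"
  proof -
    have Yh: "integrable M (\<lambda>\<omega>. Y \<omega> * h \<omega>)" "(\<lambda>\<omega>. Y \<omega> * h \<omega>) \<in> borel_measurable (F ?u)"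
      using bdd_mult_integrable[OF Yb bdd_adapted_integrable[OF hb]] Ym hm by auto
    have "(\<lambda>\<omega>. Y \<omega> * (S \<omega> + h \<omega> * I \<omega>)) = (\<lambda>\<omega>. Y \<omega> * S \<omega> + (Y \<omega> * h \<omega>) * I \<omega>)"
      by (simp add: algebra_simps)
    then show ?thesis
      using Suc bdd_mult_integrable[OF Yb S1] mi[OF Yh(2,1), of 1] mo(1)[OF Yh(2,1)] by (simp add: S_def)
  qed
  \<comment> \<open>Stated for an arbitrary bounded weight known at the node, because
    \<open>b2\<close> uses it with the weight 1.\<close>
  have a2: "expectation (\<lambda>\<omega>. Y \<omega> * (S \<omega> + h \<omega> * I \<omega>)\<^sup>2) =
     expectation (\<lambda>\<omega>. Y \<omega> * (S \<omega>)\<^sup>2) + \<Delta> * expectation (\<lambda>\<omega>. Y \<omega> * (h \<omega>)\<^sup>2)"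
    if Yb: "bdd_adapted D ?u Y" for Y D
  proof -
    have Ym: "Y \<in> borel_measurable (F ?u)" using Yb by (simp add: bdd_adapted_def)
    have 1: "integrable M (\<lambda>\<omega>. Y \<omega> * (2 * (h \<omega> ^ 1 * S \<omega> ^ 1)))"
      by (intro bdd_mult_integrable[OF Yb] integrable_mult_right hpS) simp
    have 1: "integrable M (\<lambda>\<omega>. Y \<omega> * (2 * (h \<omega> * S \<omega>)))" using 1 by simp
    have 2: "integrable M (\<lambda>\<omega>. Y \<omega> * h \<omega> ^ 2)"
      using bdd_mult_integrable[OF Yb hpS[of 0 2]] by simp
    have m1: "(\<lambda>\<omega>. Y \<omega> * (2 * (h \<omega> * S \<omega>))) \<in> borel_measurable (F ?u)"
      and m2: "(\<lambda>\<omega>. Y \<omega> * h \<omega> ^ 2) \<in> borel_measurable (F ?u)"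
      using Ym hm Sm by auto
    have "(\<lambda>\<omega>. Y \<omega> * (S \<omega> + h \<omega> * I \<omega>)\<^sup>2) =
      (\<lambda>\<omega>. Y \<omega> * S \<omega> ^ 2 + (Y \<omega> * (2 * (h \<omega> * S \<omega>))) * I \<omega> + (Y \<omega> * h \<omega> ^ 2) * I \<omega> ^ 2)"
      by (simp add: algebra_simps power2_eq_square)
    then show ?thesis
      using bdd_mult_integrable[OF Yb Sp[of 2]] mi[OF m1 1, of 1] mi[OF m2 2, of 2] mo(1)[OF m1 1] mo(2)[OF m2 2]
      by simp
  qed
  have b2: "expectation (\<lambda>\<omega>. (S \<omega> + h \<omega> * I \<omega>)\<^sup>2) = expectation (\<lambda>\<omega>. (S \<omega>)\<^sup>2) + \<Delta> * expectation (\<lambda>\<omega>. (h \<omega>)\<^sup>2)"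
    using a2[of 1 "\<lambda>_. 1"] by (simp add: bdd_adapted_def)
  have hp_le: "expectation (\<lambda>\<omega>. h \<omega> ^ p * S \<omega> ^ q) \<le> C ^ p * expectation (\<lambda>\<omega>. S \<omega> ^ q)"
    if "even p" "even q" "q \<le> 4" for p q
  proof -
    have "expectation (\<lambda>\<omega>. h \<omega> ^ p * S \<omega> ^ q) \<le> expectation (\<lambda>\<omega>. C ^ p * S \<omega> ^ q)"
    proof (rule integral_mono)
      fix \<omega> assume "\<omega> \<in> space M"
      then have "\<bar>h \<omega>\<bar> ^ p \<le> C ^ p" using hb by (intro power_mono) (auto simp: bdd_adapted_def)
      then have "h \<omega> ^ p \<le> C ^ p" using that by (simp add: power_even_abs)
      then show "h \<omega> ^ p * S \<omega> ^ q \<le> C ^ p * S \<omega> ^ q" using that by (intro mult_right_mono) auto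
    qed (use hpS Sp that in auto)
    then show ?thesis by simp
  qed
  have e0: "expectation (\<lambda>\<omega>. (h \<omega>)\<^sup>2) \<le> C\<^sup>2" using hp_le[of 2 0] by (simp add: prob_space)
  have c2: "expectation (\<lambda>\<omega>. (S \<omega> + h \<omega> * I \<omega>)\<^sup>2) \<le> C\<^sup>2 * (real (Suc j) * \<Delta>)"
  proof -
    have "expectation (\<lambda>\<omega>. (S \<omega> + h \<omega> * I \<omega>)\<^sup>2) \<le> C\<^sup>2 * (real j * \<Delta>) + \<Delta> * C\<^sup>2"
      unfolding b2 using Suc e0 \<Delta> by (intro add_mono mult_left_mono) (auto simp: S_def)
    then show ?thesis by (simp add: algebra_simps)
  qed
  \<comment> \<open>The powers 0 and 1 are kept explicit so that every term has the shape covered by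
    \<open>hI\<close>.\<close>
  have x4: "(\<lambda>\<omega>. (S \<omega> + h \<omega> * I \<omega>) ^ 4) =
      (\<lambda>\<omega>. (h \<omega> ^ 0 * S \<omega> ^ 4) * I \<omega> ^ 0 + 4 * ((h \<omega> ^ 1 * S \<omega> ^ 3) * I \<omega> ^ 1) + 6 * ((h \<omega> ^ 2 * S \<omega> ^ 2) * I \<omega> ^ 2)
        + 4 * ((h \<omega> ^ 3 * S \<omega> ^ 1) * I \<omega> ^ 3) + (h \<omega> ^ 4 * S \<omega> ^ 0) * I \<omega> ^ 4)"
    by (simp add: fun_eq_iff eval_nat_numeral algebra_simps)
  have i4: "integrable M (\<lambda>\<omega>. (S \<omega> + h \<omega> * I \<omega>) ^ 4)"
    unfolding x4 by (intro Bochner_Integration.integrable_add integrable_mult_right hI) auto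
  have z1: "expectation (\<lambda>\<omega>. (h \<omega> ^ 1 * S \<omega> ^ 3) * I \<omega> ^ 1) = 0"
    using mo(1)[OF hpSm[of 1 3] hpS[of 3 1]] by simp
  have z2: "expectation (\<lambda>\<omega>. (h \<omega> ^ 2 * S \<omega> ^ 2) * I \<omega> ^ 2) = \<Delta> * expectation (\<lambda>\<omega>. h \<omega> ^ 2 * S \<omega> ^ 2)"
    using mo(2)[OF hpSm[of 2 2] hpS[of 2 2]] by simp
  have z3: "expectation (\<lambda>\<omega>. (h \<omega> ^ 3 * S \<omega> ^ 1) * I \<omega> ^ 3) = 0"
    using mo(3)[OF hpSm[of 3 1] hpS[of 1 3]] by simp
  have z4: "expectation (\<lambda>\<omega>. (h \<omega> ^ 4 * S \<omega> ^ 0) * I \<omega> ^ 4) = 3 * \<Delta>\<^sup>2 * expectation (\<lambda>\<omega>. h \<omega> ^ 4 * S \<omega> ^ 0)"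
    using mo(4)[OF hpSm[of 4 0] hpS[of 0 4]] by simp
  have "expectation (\<lambda>\<omega>. (S \<omega> + h \<omega> * I \<omega>) ^ 4) = expectation (\<lambda>\<omega>. S \<omega> ^ 4)
     + 6 * (\<Delta> * expectation (\<lambda>\<omega>. h \<omega> ^ 2 * S \<omega> ^ 2)) + 3 * \<Delta>\<^sup>2 * expectation (\<lambda>\<omega>. h \<omega> ^ 4 * S \<omega> ^ 0)"
    unfolding x4
    by (subst Bochner_Integration.integral_add;
        (intro Bochner_Integration.integrable_add integrable_mult_right hI; simp)?)+
       (simp only: integral_mult_right_zero z1 z2 z3 z4; simp)
  also have "\<dots> \<le> 3 * C ^ 4 * (j * \<Delta>)\<^sup>2 + 6 * (\<Delta> * (C\<^sup>2 * (C\<^sup>2 * (j * \<Delta>)))) + 3 * \<Delta>\<^sup>2 * C ^ 4"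
  proof (intro add_mono mult_left_mono)
    show "expectation (\<lambda>\<omega>. S \<omega> ^ 4) \<le> 3 * C ^ 4 * (j * \<Delta>)\<^sup>2" using Suc by (simp add: S_def)
    have "expectation (\<lambda>\<omega>. h \<omega> ^ 2 * S \<omega> ^ 2) \<le> C ^ 2 * expectation (\<lambda>\<omega>. S \<omega> ^ 2)" by (rule hp_le) auto
    also have "\<dots> \<le> C\<^sup>2 * (C\<^sup>2 * (j * \<Delta>))" using Suc by (intro mult_left_mono) (auto simp: S_def)
    finally show "expectation (\<lambda>\<omega>. h \<omega> ^ 2 * S \<omega> ^ 2) \<le> C\<^sup>2 * (C\<^sup>2 * (j * \<Delta>))" .
    show "expectation (\<lambda>\<omega>. h \<omega> ^ 4 * S \<omega> ^ 0) \<le> C ^ 4" using hp_le[of 4 0] by (simp add: prob_space)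
  qed (use \<Delta> in auto)
  \<comment> \<open>The three terms add up to \<open>3 * C ^ 4 * \<Delta>\<^sup>2\<close> times
    \<open>j\<^sup>2 + 2 * j + 1\<close>, a perfect square.\<close>
  also have "\<dots> = 3 * C ^ 4 * (real (Suc j) * \<Delta>)\<^sup>2"
    by (simp add: eval_nat_numeral algebra_simps)
  finally have c4: "expectation (\<lambda>\<omega>. (S \<omega> + h \<omega> * I \<omega>) ^ 4) \<le> 3 * C ^ 4 * (real (Suc j) * \<Delta>)\<^sup>2" .
  show ?case unfolding S' using i4 a1 a2[OF Yb] c2 c4 Suc by (simp add: S_def h_def)
qed

end

end

section \<open>Taylor estimates and convergence in probability\<close>

text \<open>If the intermediate point is within \<open>\<delta>\<close> of \<open>x\<close>, the
  modulus of continuity of \<open>f''\<close> gives \<open>e\<close>. Otherwise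
  \<open>1 \<le> z\<^sup>2 / \<delta>\<^sup>2\<close> turns the crude bound \<open>2 * D\<close>
  into a fourth power of \<open>z\<close>. This form suits a noise with second moment of order
  \<open>h\<close> and fourth moment of order \<open>h\<^sup>2\<close>, and it does without a third
  derivative, which merely continuous coefficients do not provide.\<close>

lemma taylor2_remainder_le:
  fixes f :: "real \<Rightarrow> real"
  assumes d1: "\<And>x. (f has_real_derivative f' x) (at x)"
    and d2: "\<And>x. (f' has_real_derivative f'' x) (at x)"
    and D: "\<And>x. \<bar>f'' x\<bar> \<le> D"
    and uc: "\<And>u v. \<bar>u - v\<bar> < \<delta> \<Longrightarrow> \<bar>f'' u - f'' v\<bar> \<le> e" and "0 < \<delta>" "0 \<le> e"
  shows "\<bar>f (x + z) - f x - f' x * z - f'' x * z\<^sup>2 / 2\<bar> \<le> e / 2 * z\<^sup>2 + D / \<delta>\<^sup>2 * z ^ 4"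
proof (cases "z = 0")
  case True
  then show ?thesis by simp
next
  case False
  define df where "df = (\<lambda>m::nat. if m = 0 then f else if m = 1 then f' else f'')"
  have D0: "0 \<le> D" using D[of 0] by linarith
  have "\<exists>t. (if x + z < x then x + z < t \<and> t < x else x < t \<and> t < x + z) \<and>
        f (x + z) = (\<Sum>m<2. df m x / fact m * (x + z - x) ^ m) + df 2 t / fact 2 * (x + z - x) ^ 2"
    by (rule Taylor[where a="x - \<bar>z\<bar>" and b="x + \<bar>z\<bar>"]) (use False d1 d2 in \<open>auto simp: df_def less_2_cases_iff\<close>)
  then obtain t where t': "if x + z < x then x + z < t \<and> t < x else x < t \<and> t < x + z"
    and eq': "f (x + z) = (\<Sum>m<2. df m x / fact m * (x + z - x) ^ m) + df 2 t / fact 2 * (x + z - x) ^ 2"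
    by blast
  have t: "\<bar>t - x\<bar> \<le> \<bar>z\<bar>" using t' by (auto split: if_splits)
  have eq: "f (x + z) = f x + f' x * z + f'' t / 2 * z\<^sup>2"
    unfolding eq' by (simp add: df_def numeral_2_eq_2 lessThan_Suc)
  have "f (x + z) - f x - f' x * z - f'' x * z\<^sup>2 / 2 = (f'' t - f'' x) * z\<^sup>2 / 2"
    unfolding eq by (simp add: field_simps)
  then have eq2: "\<bar>f (x + z) - f x - f' x * z - f'' x * z\<^sup>2 / 2\<bar> = \<bar>f'' t - f'' x\<bar> * z\<^sup>2 / 2"
    by (simp only: abs_mult abs_divide) simp
  have "\<bar>f'' t - f'' x\<bar> \<le> e + 2 * D / \<delta>\<^sup>2 * z\<^sup>2"
  proof (cases "\<bar>t - x\<bar> < \<delta>")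
    case True
    have "0 \<le> 2 * D / \<delta>\<^sup>2 * z\<^sup>2" using D0 by simp
    with uc[OF True] show ?thesis by linarith
  next
    case False
    then have "\<delta> \<le> \<bar>z\<bar>" using t by linarith
    then have "\<delta>\<^sup>2 \<le> z\<^sup>2" using \<open>0 < \<delta>\<close> by (metis abs_le_square_iff abs_of_pos)
    then have "1 \<le> z\<^sup>2 / \<delta>\<^sup>2" using \<open>0 < \<delta>\<close> by (simp add: field_simps)
    then have "2 * D * 1 \<le> 2 * D * (z\<^sup>2 / \<delta>\<^sup>2)" using D0 by (intro mult_left_mono) auto
    moreover have "\<bar>f'' t - f'' x\<bar> \<le> 2 * D" using D[of t] D[of x] by linarith
    ultimately show ?thesis using \<open>0 \<le> e\<close> by simp
  qed
  then have "\<bar>f'' t - f'' x\<bar> * (z\<^sup>2 / 2) \<le> (e + 2 * D / \<delta>\<^sup>2 * z\<^sup>2) * (z\<^sup>2 / 2)"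
    by (rule mult_right_mono) simp
  also have "\<dots> = e / 2 * z\<^sup>2 + D / \<delta>\<^sup>2 * z ^ 4"
    by (simp add: field_simps eval_nat_numeral)
  finally show ?thesis unfolding eq2 by simp
qed

lemma bounded_derivative_lipschitz:
  fixes g :: "real \<Rightarrow> real"
  assumes "\<And>x. (g has_real_derivative g' x) (at x)" "\<And>x. \<bar>g' x\<bar> \<le> D"
  shows "\<bar>g x - g y\<bar> \<le> D * \<bar>x - y\<bar>"
proof -
  have "norm (g x - g y) \<le> D * norm (x - y)"
    by (rule field_differentiable_bound[of UNIV g g']) (use assms in auto)
  then show ?thesis by simp
qed

text \<open>Splits the drift displacement \<open>B\<close> from the noise displacement
  \<open>z\<close>. First order in \<open>B\<close> is enough, as \<open>B\<close> will be of order
  \<open>h\<close>; the derivative is evaluated by the mean value theorem at a point within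
  \<open>\<bar>B\<bar> + \<bar>z\<bar>\<close> of \<open>x\<close>.\<close>

lemma first_order_remainder_le:
  fixes f :: "real \<Rightarrow> real"
  assumes d1: "\<And>x. (f has_real_derivative f' x) (at x)"
    and d2: "\<And>x. (f' has_real_derivative f'' x) (at x)"
    and D: "\<And>x. \<bar>f'' x\<bar> \<le> D"
  shows "\<bar>f (x + B + z) - f (x + z) - f' x * B\<bar> \<le> D * \<bar>B\<bar> * (\<bar>B\<bar> + \<bar>z\<bar>)"
proof (cases "B = 0")
  case False
  have D0: "0 \<le> D" using D[of 0] by linarith
  obtain \<xi> where \<xi>: "\<bar>\<xi> - (x + z)\<bar> \<le> \<bar>B\<bar>" "f (x + z + B) - f (x + z) = B * f' \<xi>"
  proof (cases "B > 0")
    case True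
    then obtain w where "x + z < w" "w < x + z + B" "f (x + z + B) - f (x + z) = (x + z + B - (x + z)) * f' w"
      using MVT2[of "x + z" "x + z + B" f f'] d1 by auto
    then show ?thesis using that[of w] by auto
  next
    case nF: False
    then obtain w where "x + z + B < w" "w < x + z" "f (x + z) - f (x + z + B) = (x + z - (x + z + B)) * f' w"
      using MVT2[of "x + z + B" "x + z" f f'] d1 False by auto
    then show ?thesis using that[of w] by (auto simp: algebra_simps)
  qed
  have "f (x + B + z) - f (x + z) - f' x * B = B * (f' \<xi> - f' x)"
    using \<xi>(2) by (simp add: algebra_simps)
  then have "\<bar>f (x + B + z) - f (x + z) - f' x * B\<bar> = \<bar>B\<bar> * \<bar>f' \<xi> - f' x\<bar>" by (simp add: abs_mult)
  also have "\<dots> \<le> \<bar>B\<bar> * (D * \<bar>\<xi> - x\<bar>)"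
    by (intro mult_left_mono bounded_derivative_lipschitz[OF d2 D]) auto
  also have "\<dots> \<le> \<bar>B\<bar> * (D * (\<bar>B\<bar> + \<bar>z\<bar>))"
    using \<xi>(1) D0 by (intro mult_left_mono) auto
  finally show ?thesis by (simp add: mult_ac)
qed simp

section \<open>Convergence in probability\<close>

context prob_space
begin

text \<open>Measurability is part of the notion because \<open>prob\<close> assigns 0 to sets that
  are not events, and monotonicity, on which the addition rule rests, would fail for them.\<close>

definition null_in_prob :: "(nat \<Rightarrow> 'a \<Rightarrow> real) \<Rightarrow> bool" where
  "null_in_prob S \<longleftrightarrow> (\<forall>n. S n \<in> borel_measurable M) \<and>
     (\<forall>e>0. (\<lambda>n. prob {\<omega> \<in> space M. \<bar>S n \<omega>\<bar> > e}) \<longlonglongrightarrow> 0)"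

lemma null_in_prob_add:
  assumes S: "null_in_prob S" and T: "null_in_prob T"
  shows "null_in_prob (\<lambda>n \<omega>. S n \<omega> + T n \<omega>)"
  unfolding null_in_prob_def
proof (intro conjI allI impI)
  have [measurable]: "S n \<in> borel_measurable M" "T n \<in> borel_measurable M" for n
    using assms by (auto simp: null_in_prob_def)
  show "(\<lambda>\<omega>. S n \<omega> + T n \<omega>) \<in> borel_measurable M" for n by measurable
  fix e :: real assume e: "e > 0"
  show "(\<lambda>n. prob {\<omega> \<in> space M. \<bar>S n \<omega> + T n \<omega>\<bar> > e}) \<longlonglongrightarrow> 0"
  proof (rule tendsto_sandwich[of "\<lambda>_. 0"])
    show "(\<lambda>n. prob {\<omega> \<in> space M. \<bar>S n \<omega>\<bar> > e / 2} + prob {\<omega> \<in> space M. \<bar>T n \<omega>\<bar> > e / 2}) \<longlonglongrightarrow> 0"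
      using S[unfolded null_in_prob_def, THEN conjunct2, rule_format, of "e / 2"]
        T[unfolded null_in_prob_def, THEN conjunct2, rule_format, of "e / 2"] e
      by (intro tendsto_add_zero) (simp_all del: less_divide_eq_numeral1)
    have "prob {\<omega> \<in> space M. \<bar>S n \<omega> + T n \<omega>\<bar> > e}
        \<le> prob {\<omega> \<in> space M. \<bar>S n \<omega>\<bar> > e / 2} + prob {\<omega> \<in> space M. \<bar>T n \<omega>\<bar> > e / 2}" for n
    proof -
      have "prob {\<omega> \<in> space M. \<bar>S n \<omega> + T n \<omega>\<bar> > e}
          \<le> prob ({\<omega> \<in> space M. \<bar>S n \<omega>\<bar> > e / 2} \<union> {\<omega> \<in> space M. \<bar>T n \<omega>\<bar> > e / 2})"
        by (rule finite_measure_mono) auto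
      also have "\<dots> \<le> prob {\<omega> \<in> space M. \<bar>S n \<omega>\<bar> > e / 2} + prob {\<omega> \<in> space M. \<bar>T n \<omega>\<bar> > e / 2}"
        by (rule measure_Un_le) auto
      finally show ?thesis .
    qed
    then show "\<forall>\<^sub>F n in sequentially. prob {\<omega> \<in> space M. \<bar>S n \<omega> + T n \<omega>\<bar> > e}
       \<le> prob {\<omega> \<in> space M. \<bar>S n \<omega>\<bar> > e / 2} + prob {\<omega> \<in> space M. \<bar>T n \<omega>\<bar> > e / 2}"
      by (intro always_eventually allI)
  qed auto
qed

lemma null_in_prob_uminus: "null_in_prob S \<Longrightarrow> null_in_prob (\<lambda>n \<omega>. - S n \<omega>)"
  by (auto simp: null_in_prob_def)

lemma null_in_prob_L2:
  assumes [measurable]: "\<And>n. S n \<in> borel_measurable M"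
    and i: "\<And>n. integrable M (\<lambda>\<omega>. (S n \<omega>)\<^sup>2)"
    and l: "(\<lambda>n. expectation (\<lambda>\<omega>. (S n \<omega>)\<^sup>2)) \<longlonglongrightarrow> 0"
  shows "null_in_prob S"
  unfolding null_in_prob_def
proof (intro conjI allI impI)
  fix e :: real assume e: "e > 0"
  show "(\<lambda>n. prob {\<omega> \<in> space M. \<bar>S n \<omega>\<bar> > e}) \<longlonglongrightarrow> 0"
  proof (rule tendsto_sandwich[of "\<lambda>_. 0"])
    show "(\<lambda>n. expectation (\<lambda>\<omega>. (S n \<omega>)\<^sup>2) / e\<^sup>2) \<longlonglongrightarrow> 0"
      using tendsto_divide[OF l tendsto_const[of "e\<^sup>2"]] e by simp
    have "prob {\<omega> \<in> space M. \<bar>S n \<omega>\<bar> > e} \<le> expectation (\<lambda>\<omega>. (S n \<omega>)\<^sup>2) / e\<^sup>2" for n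
    proof -
      have "e\<^sup>2 \<le> (S n \<omega>)\<^sup>2" if "e < \<bar>S n \<omega>\<bar>" for \<omega>
        using that e power_mono[of e "\<bar>S n \<omega>\<bar>" 2] by simp
      then have "prob {\<omega> \<in> space M. \<bar>S n \<omega>\<bar> > e} \<le> prob {\<omega> \<in> space M. (S n \<omega>)\<^sup>2 \<ge> e\<^sup>2}"
        by (intro finite_measure_mono) auto
      also have "\<dots> \<le> expectation (\<lambda>\<omega>. (S n \<omega>)\<^sup>2) / e\<^sup>2"
        by (rule integral_Markov_inequality_measure[OF i sets.empty_sets]) (use e in auto)
      finally show ?thesis .
    qed
    then show "\<forall>\<^sub>F n in sequentially. prob {\<omega> \<in> space M. \<bar>S n \<omega>\<bar> > e} \<le> expectation (\<lambda>\<omega>. (S n \<omega>)\<^sup>2) / e\<^sup>2"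
      by (intro always_eventually allI)
  qed auto
qed simp

lemma null_in_prob_pointwise:
  assumes [measurable]: "\<And>n. S n \<in> borel_measurable M"
    and l: "\<And>\<omega>. \<omega> \<in> space M \<Longrightarrow> (\<lambda>n. S n \<omega>) \<longlonglongrightarrow> 0"
  shows "null_in_prob S"
  unfolding null_in_prob_def
proof (intro conjI allI impI)
  fix e :: real assume e: "e > 0"
  let ?A = "\<lambda>n. {\<omega> \<in> space M. \<bar>S n \<omega>\<bar> > e}"
  have "(\<lambda>n. expectation (indicator (?A n) :: 'a \<Rightarrow> real)) \<longlonglongrightarrow> expectation (\<lambda>_. 0)"
  proof (rule integral_dominated_convergence[where w="\<lambda>_. 1"])
    show "AE \<omega> in M. (\<lambda>n. indicator (?A n) \<omega> :: real) \<longlonglongrightarrow> 0"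
    proof (rule AE_I2)
      fix \<omega> assume "\<omega> \<in> space M"
      from tendstoD[OF l[OF this] e] have "\<forall>\<^sub>F n in sequentially. indicator (?A n) \<omega> = (0::real)"
        by eventually_elim (auto simp: indicator_def)
      then show "(\<lambda>n. indicator (?A n) \<omega> :: real) \<longlonglongrightarrow> 0" by (rule tendsto_eventually)
    qed
  qed (auto simp: indicator_def)
  then show "(\<lambda>n. prob (?A n)) \<longlonglongrightarrow> 0" by simp
qed simp

lemma bounded_integrable:
  fixes Z :: "'a \<Rightarrow> real"
  assumes "Z \<in> borel_measurable M" "\<And>\<omega>. \<omega> \<in> space M \<Longrightarrow> \<bar>Z \<omega>\<bar> \<le> D"
  shows "integrable M Z"
  by (rule integrable_const_bound[where B=D]) (use assms in auto)

text \<open>Where \<open>S n\<close> and \<open>Z\<close> are within \<open>e\<close> of each other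
  the Lipschitz bound costs \<open>L * e\<close>; on the remaining event, of small probability,
  boundedness costs \<open>2 * D\<close>.\<close>

lemma expectation_lipschitz_tendsto:
  assumes c: "null_in_prob (\<lambda>n \<omega>. S n \<omega> - Z \<omega>)"
    and [measurable]: "\<And>n. S n \<in> borel_measurable M" "Z \<in> borel_measurable M" "f \<in> borel_measurable borel" "A \<in> sets M"
    and D: "\<And>x::real. \<bar>f x\<bar> \<le> D" and L: "\<And>x y. \<bar>f x - f y\<bar> \<le> L * \<bar>x - y\<bar>"
  shows "(\<lambda>n. expectation (\<lambda>\<omega>. indicator A \<omega> * f (S n \<omega>))) \<longlonglongrightarrow> expectation (\<lambda>\<omega>. indicator A \<omega> * f (Z \<omega>))"
proof -
  have D0: "0 \<le> D" using D[of 0] by linarith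
  have L0: "0 \<le> L" using L[of 1 0] by simp
  have i: "integrable M (\<lambda>\<omega>. indicator A \<omega> * f (Y \<omega>))" if [measurable]: "Y \<in> borel_measurable M" for Y
    by (rule bounded_integrable[of _ D]) (use D D0 in \<open>auto simp: indicator_def\<close>)
  have bnd: "\<bar>expectation (\<lambda>\<omega>. indicator A \<omega> * f (S n \<omega>)) - expectation (\<lambda>\<omega>. indicator A \<omega> * f (Z \<omega>))\<bar>
    \<le> L * e + 2 * D * prob {\<omega> \<in> space M. \<bar>S n \<omega> - Z \<omega>\<bar> > e}" if "e > 0" for e n
  proof -
    let ?B = "{\<omega> \<in> space M. \<bar>S n \<omega> - Z \<omega>\<bar> > e}"
    have "\<bar>expectation (\<lambda>\<omega>. indicator A \<omega> * f (S n \<omega>)) - expectation (\<lambda>\<omega>. indicator A \<omega> * f (Z \<omega>))\<bar>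
      = \<bar>expectation (\<lambda>\<omega>. indicator A \<omega> * f (S n \<omega>) - indicator A \<omega> * f (Z \<omega>))\<bar>"
      by (subst Bochner_Integration.integral_diff) (auto intro: i)
    also have "\<dots> \<le> expectation (\<lambda>\<omega>. \<bar>indicator A \<omega> * f (S n \<omega>) - indicator A \<omega> * f (Z \<omega>)\<bar>)"
      by (rule integral_abs_bound)
    also have "\<dots> \<le> expectation (\<lambda>\<omega>. L * e + 2 * D * indicator ?B \<omega>)"
    proof (rule integral_mono)
      fix \<omega> assume \<omega>: "\<omega> \<in> space M"
      have "\<bar>f (S n \<omega>) - f (Z \<omega>)\<bar> \<le> L * e + 2 * D * indicator ?B \<omega>"
      proof (cases "\<omega> \<in> ?B")
        case True
        have "\<bar>f (S n \<omega>) - f (Z \<omega>)\<bar> \<le> 2 * D" using D[of "S n \<omega>"] D[of "Z \<omega>"] by linarith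
        moreover have "0 \<le> L * e" using L0 that by simp
        ultimately show ?thesis using True by simp
      next
        case False
        then have "L * \<bar>S n \<omega> - Z \<omega>\<bar> \<le> L * e" using \<omega> L0 by (intro mult_left_mono) auto
        then show ?thesis using L[of "S n \<omega>" "Z \<omega>"] False by simp
      qed
      then show "\<bar>indicator A \<omega> * f (S n \<omega>) - indicator A \<omega> * f (Z \<omega>)\<bar> \<le> L * e + 2 * D * indicator ?B \<omega>"
        using L0 D0 that by (auto simp: indicator_def)
    qed (intro integrable_abs Bochner_Integration.integrable_diff Bochner_Integration.integrable_add
      integrable_mult_right integrable_real_indicator i; simp add: emeasure_eq_measure)+
    also have "\<dots> = L * e + 2 * D * prob ?B"
      by (subst Bochner_Integration.integral_add)
         (auto simp: prob_space emeasure_eq_measure intro!: integrable_mult_right integrable_real_indicator)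
    finally show ?thesis .
  qed
  show ?thesis
  proof (rule LIMSEQ_I)
    fix r :: real assume r: "r > 0"
    \<comment> \<open>The denominator contains \<open>L + 1\<close>, so that it is positive also for
      \<open>L = 0\<close> and \<open>L * e < r / 2\<close> holds strictly.\<close>
    define e where "e = r / (2 * (L + 1))"
    have e: "e > 0" using r L0 by (simp add: e_def)
    have Le: "L * e < r / 2" using r L0 by (simp add: e_def field_simps)
    have "(\<lambda>n. 2 * D * prob {\<omega> \<in> space M. \<bar>S n \<omega> - Z \<omega>\<bar> > e}) \<longlonglongrightarrow> 0"
      using c e by (intro tendsto_mult_right_zero) (auto simp: null_in_prob_def)
    from order_tendstoD(2)[OF this, of "r / 2"] r
    obtain N where "\<And>n. n \<ge> N \<Longrightarrow> 2 * D * prob {\<omega> \<in> space M. \<bar>S n \<omega> - Z \<omega>\<bar> > e} < r / 2"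
      by (auto simp: eventually_sequentially)
    then show "\<exists>N. \<forall>n\<ge>N. norm (expectation (\<lambda>\<omega>. indicator A \<omega> * f (S n \<omega>)) - expectation (\<lambda>\<omega>. indicator A \<omega> * f (Z \<omega>))) < r"
      using bnd[OF e] Le by (intro exI[of _ N]) (fastforce intro: le_less_trans)
  qed
qed

end

section \<open>One step of the diffusion\<close>

text \<open>A step starts from an arbitrary state, so its estimates rest on bounds and moduli of
  continuity of the coefficients that hold on the whole line; continuous periodic coefficients
  supply them.\<close>

locale bounded_sde = filtered_brownian_motion M F W
  for M :: "'a measure" and F :: "real \<Rightarrow> 'a measure" and W :: "real \<Rightarrow> 'a \<Rightarrow> real" +
  fixes b \<sigma> :: "real \<Rightarrow> real" and y :: real and X :: "real \<Rightarrow> 'a \<Rightarrow> real" and K :: real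
  assumes solution: "sde_solution M F W b \<sigma> y X"
    and b_bound: "\<bar>b x\<bar> \<le> K" and \<sigma>_bound: "\<bar>\<sigma> x\<bar> \<le> K"
    and b_uc: "uniformly_continuous_on UNIV b" and \<sigma>_uc: "uniformly_continuous_on UNIV \<sigma>"
begin

lemma b_cont: "continuous_on UNIV b" and \<sigma>_cont: "continuous_on UNIV \<sigma>"
  using b_uc \<sigma>_uc uniformly_continuous_imp_continuous by blast+

lemma b_measurable [measurable]: "b \<in> borel_measurable borel"
  and \<sigma>_measurable [measurable]: "\<sigma> \<in> borel_measurable borel"
  using b_cont \<sigma>_cont by (auto intro: borel_measurable_continuous_onI)

lemma K_nonneg: "0 \<le> K"
  using b_bound[of 0] by linarith

lemma X_0: "\<omega> \<in> space M \<Longrightarrow> X 0 \<omega> = y"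
  and X_cont: "\<omega> \<in> space M \<Longrightarrow> continuous_on {0..} (\<lambda>t. X t \<omega>)"
  and X_measurable_F: "0 \<le> t \<Longrightarrow> X t \<in> borel_measurable (F t)"
  and X_ito: "0 \<le> t \<Longrightarrow> conv_in_prob M (ito_sum (\<lambda>u \<omega>. \<sigma> (X u \<omega>)) W t)
                (\<lambda>\<omega>. X t \<omega> - y - integral {0..t} (\<lambda>u. b (X u \<omega>)))"
  using solution by (auto simp: sde_solution_def)

lemma X_measurable [measurable]: "0 \<le> t \<Longrightarrow> X t \<in> borel_measurable M"
  using X_measurable_F measurable_F_M by blast

lemma cont_compose_X: "continuous_on UNIV g \<Longrightarrow> \<omega> \<in> space M \<Longrightarrow> continuous_on {0..} (\<lambda>t. g (X t \<omega>))"
  for g :: "real \<Rightarrow> real"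
  by (rule continuous_on_compose2[OF _ X_cont]) auto

lemma g_X_bdd_adapted:
  fixes g :: "real \<Rightarrow> real"
  assumes "g \<in> borel_measurable borel" "\<And>x. \<bar>g x\<bar> \<le> D" "0 \<le> u"
  shows "bdd_adapted D u (\<lambda>\<omega>. g (X u \<omega>))"
  unfolding bdd_adapted_def
  using assms measurable_compose[OF X_measurable_F assms(1)] by auto

sublocale diffusion: bounded_integrand M F W "\<lambda>u \<omega>. \<sigma> (X u \<omega>)" K
  by unfold_locales (auto intro: g_X_bdd_adapted cont_compose_X \<sigma>_cont \<sigma>_bound)

definition drift_sum :: "real \<Rightarrow> real \<Rightarrow> nat \<Rightarrow> 'a \<Rightarrow> real" where
  "drift_sum s t n \<omega> = (\<Sum>k<2 ^ n. b (X (node s t n k) \<omega>) * ((t - s) / 2 ^ n))"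

abbreviation "noise_sum \<equiv> diffusion.isum"

lemma drift_sum_tendsto:
  assumes "0 \<le> s" "s \<le> t" "\<omega> \<in> space M"
  shows "(\<lambda>n. drift_sum s t n \<omega>) \<longlonglongrightarrow> integral {s..t} (\<lambda>u. b (X u \<omega>))"
  unfolding drift_sum_def
  by (rule riemann_sum_tendsto[OF assms(1,2) cont_compose_X[OF b_cont assms(3)], of K]) (rule b_bound)

lemma node_X_measurable [measurable]: "0 \<le> s \<Longrightarrow> s \<le> t \<Longrightarrow> X (node s t n k) \<in> borel_measurable M"
  using node_ge[of s t n k] by (intro X_measurable) auto

lemma drift_sum_measurable [measurable]: "0 \<le> s \<Longrightarrow> s \<le> t \<Longrightarrow> drift_sum s t n \<in> borel_measurable M"
  unfolding drift_sum_def[abs_def] by measurable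

lemma noise_sum_measurable [measurable]:
  assumes "0 \<le> s" "s \<le> t" shows "noise_sum s t n \<in> borel_measurable M"
proof -
  have "0 \<le> node s t n k" for k using node_ge[of s t n k] assms by linarith
  then show ?thesis unfolding diffusion.psum_def[abs_def] using assms by (measurable)
qed

lemma integral_b_measurable [measurable]:
  assumes "0 \<le> s" "s \<le> t" shows "(\<lambda>\<omega>. integral {s..t} (\<lambda>u. b (X u \<omega>))) \<in> borel_measurable M"
  by (rule borel_measurable_LIMSEQ_real[OF drift_sum_tendsto]) (use assms in auto)

lemma drift_sum_bound:
  assumes "0 \<le> s" "s \<le> t" shows "\<bar>drift_sum s t n \<omega>\<bar> \<le> K * (t - s)"
proof -
  have "\<bar>drift_sum s t n \<omega>\<bar> \<le> (\<Sum>k<(2::nat) ^ n. K * ((t - s) / 2 ^ n))"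
    unfolding drift_sum_def using assms
    by (intro order_trans[OF sum_abs] sum_mono) (auto simp: abs_mult intro!: divide_right_mono mult_right_mono b_bound)
  then show ?thesis by simp
qed

lemma ito_sum_eq: "ito_sum (\<lambda>u \<omega>. \<sigma> (X u \<omega>)) W t n = noise_sum 0 t n"
  by (simp add: fun_eq_iff ito_sum_def diffusion.psum_def node_def)

text \<open>A Taylor expansion around the left end of \<open>[s, t]\<close> is possible for this approximation of \<open>X t\<close>, because its
  increments over \<open>[s, t]\<close> are orthogonal with known moments.\<close>

definition euler_sum :: "real \<Rightarrow> real \<Rightarrow> nat \<Rightarrow> 'a \<Rightarrow> real" where
  "euler_sum s t n \<omega> = X s \<omega> + drift_sum s t n \<omega> + noise_sum s t n \<omega>"

lemma euler_sum_measurable [measurable]: "0 \<le> s \<Longrightarrow> s \<le> t \<Longrightarrow> euler_sum s t n \<in> borel_measurable M"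
  unfolding euler_sum_def[abs_def] by measurable

text \<open>Subtracting the defining limit at \<open>s\<close> from that at \<open>t\<close> leaves
  the noise over \<open>[s, t]\<close> up to the mismatch of grids, which
  \<open>isum_additive\<close> makes negligible. Together with the drift sum, four null sequences
  add up to the difference.\<close>

lemma euler_sum_converges:
  assumes st: "0 \<le> s" "s \<le> t"
  shows "null_in_prob (\<lambda>n \<omega>. euler_sum s t n \<omega> - X t \<omega>)"
proof -
  have I: "null_in_prob (\<lambda>n \<omega>. noise_sum 0 t n \<omega> - (X t \<omega> - y - integral {0..t} (\<lambda>u. b (X u \<omega>))))"
    if "0 \<le> t" for t
    using X_ito[OF that] that unfolding null_in_prob_def conv_in_prob_def ito_sum_eq by auto
  have R: "null_in_prob (\<lambda>n \<omega>. noise_sum 0 t n \<omega> - noise_sum 0 s n \<omega> - noise_sum s t n \<omega>)"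
    by (rule null_in_prob_L2[OF _ diffusion.isum_additive[OF st]]) (use st in auto)
  have B: "null_in_prob (\<lambda>n \<omega>. drift_sum s t n \<omega> - integral {s..t} (\<lambda>u. b (X u \<omega>)))"
    by (rule null_in_prob_pointwise)
       (use st in \<open>auto intro!: LIM_zero drift_sum_tendsto\<close>)
  have C: "integral {0..t} (\<lambda>u. b (X u \<omega>)) = integral {0..s} (\<lambda>u. b (X u \<omega>)) + integral {s..t} (\<lambda>u. b (X u \<omega>))"
    if "\<omega> \<in> space M" for \<omega>
    using st by (intro Henstock_Kurzweil_Integration.integral_combine[symmetric] integrable_continuous_real
        continuous_on_subset[OF cont_compose_X[OF b_cont that]]) auto
  have "0 \<le> t" using st by linarith
  note N = null_in_prob_add[OF null_in_prob_add[OF null_in_prob_add[OF I[OF \<open>0 \<le> t\<close>] null_in_prob_uminus[OF I[OF st(1)]]]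
    null_in_prob_uminus[OF R]] B]
  show ?thesis
    unfolding null_in_prob_def
  proof (intro conjI allI impI)
    show "(\<lambda>\<omega>. euler_sum s t n \<omega> - X t \<omega>) \<in> borel_measurable M" for n
      using euler_sum_measurable[OF st] X_measurable[OF \<open>0 \<le> t\<close>] by (rule borel_measurable_diff)
    fix e :: real assume e: "e > 0"
    have "{\<omega> \<in> space M. \<bar>euler_sum s t n \<omega> - X t \<omega>\<bar> > e} = {\<omega> \<in> space M. \<bar>noise_sum 0 t n \<omega> -
                 (X t \<omega> - y - integral {0..t} (\<lambda>u. b (X u \<omega>))) +
                 - (noise_sum 0 s n \<omega> - (X s \<omega> - y - integral {0..s} (\<lambda>u. b (X u \<omega>)))) +
                 - (noise_sum 0 t n \<omega> - noise_sum 0 s n \<omega> - noise_sum s t n \<omega>) +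
                 (drift_sum s t n \<omega> - integral {s..t} (\<lambda>u. b (X u \<omega>)))\<bar> > e}" for n
    proof -
      have "euler_sum s t n \<omega> - X t \<omega> = noise_sum 0 t n \<omega> -
                 (X t \<omega> - y - integral {0..t} (\<lambda>u. b (X u \<omega>))) +
                 - (noise_sum 0 s n \<omega> - (X s \<omega> - y - integral {0..s} (\<lambda>u. b (X u \<omega>)))) +
                 - (noise_sum 0 t n \<omega> - noise_sum 0 s n \<omega> - noise_sum s t n \<omega>) +
                 (drift_sum s t n \<omega> - integral {s..t} (\<lambda>u. b (X u \<omega>)))" if "\<omega> \<in> space M" for \<omega>
        unfolding euler_sum_def using C[OF that] by linarith
      then show ?thesis by (intro Collect_cong) auto
    qed
    with N e show "(\<lambda>n. prob {\<omega> \<in> space M. \<bar>euler_sum s t n \<omega> - X t \<omega>\<bar> > e}) \<longlonglongrightarrow> 0"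
      unfolding null_in_prob_def by simp
  qed
qed

lemma noise_moments:
  assumes st: "0 \<le> s" "s < t" and Y: "bdd_adapted D s Y"
  shows "integrable M (\<lambda>\<omega>. noise_sum s t n \<omega> ^ 4)"
    and "expectation (\<lambda>\<omega>. Y \<omega> * noise_sum s t n \<omega>) = 0"
    and "expectation (\<lambda>\<omega>. Y \<omega> * (noise_sum s t n \<omega>)\<^sup>2) =
        (\<Sum>k<2 ^ n. (t - s) / 2 ^ n * expectation (\<lambda>\<omega>. Y \<omega> * (\<sigma> (X (node s t n k) \<omega>))\<^sup>2))"
    and "expectation (\<lambda>\<omega>. (noise_sum s t n \<omega>)\<^sup>2) \<le> K\<^sup>2 * (t - s)"
    and "expectation (\<lambda>\<omega>. noise_sum s t n \<omega> ^ 4) \<le> 3 * K ^ 4 * (t - s)\<^sup>2"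
    and "integrable M (\<lambda>\<omega>. (noise_sum s t n \<omega>)\<^sup>2)" and "integrable M (noise_sum s t n)"
proof -
  note m = diffusion.psum_moments[OF st Y, of n "2 ^ n"]
  show i4: "integrable M (\<lambda>\<omega>. noise_sum s t n \<omega> ^ 4)"
    and "expectation (\<lambda>\<omega>. Y \<omega> * noise_sum s t n \<omega>) = 0"
    and "expectation (\<lambda>\<omega>. Y \<omega> * (noise_sum s t n \<omega>)\<^sup>2) =
        (\<Sum>k<2 ^ n. (t - s) / 2 ^ n * expectation (\<lambda>\<omega>. Y \<omega> * (\<sigma> (X (node s t n k) \<omega>))\<^sup>2))"
    using m by blast+
  show "expectation (\<lambda>\<omega>. (noise_sum s t n \<omega>)\<^sup>2) \<le> K\<^sup>2 * (t - s)"
    and "expectation (\<lambda>\<omega>. noise_sum s t n \<omega> ^ 4) \<le> 3 * K ^ 4 * (t - s)\<^sup>2"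
    using m by simp_all
  have mm: "noise_sum s t n \<in> borel_measurable M" using st by simp
  show "integrable M (\<lambda>\<omega>. (noise_sum s t n \<omega>)\<^sup>2)" "integrable M (noise_sum s t n)"
    using integrable_power_le4[OF mm i4, of 2] integrable_power_le4[OF mm i4, of 1] by simp_all
qed

text \<open>Chebyshev's inequality for the Euler sums, followed by the limit in probability. The
  factor 8 is 2 from the square of drift plus noise, times 4 from the level
  \<open>d / 2\<close>.\<close>

lemma displacement_tail:
  assumes st: "0 \<le> s" "s < t" and d: "d > 0"
  shows "prob {\<omega> \<in> space M. \<bar>X t \<omega> - X s \<omega>\<bar> \<ge> d} \<le> 8 * (K\<^sup>2 * (t - s)\<^sup>2 + K\<^sup>2 * (t - s)) / d\<^sup>2"
proof -
  let ?h = "t - s"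
  have [measurable]: "X t \<in> borel_measurable M" "X s \<in> borel_measurable M" using st by auto
  have [measurable]: "euler_sum s t n \<in> borel_measurable M" for n using st by auto
  have 1: "prob {\<omega> \<in> space M. \<bar>euler_sum s t n \<omega> - X s \<omega>\<bar> \<ge> d / 2} \<le> 8 * (K\<^sup>2 * ?h\<^sup>2 + K\<^sup>2 * ?h) / d\<^sup>2" for n
  proof -
    note mo = noise_moments[OF st, of 1 "\<lambda>_. 1" n, unfolded bdd_adapted_def, simplified]
    let ?u = "\<lambda>\<omega>. 2 * (K * ?h)\<^sup>2 + 2 * (noise_sum s t n \<omega>)\<^sup>2"
    have i: "integrable M ?u" using mo by simp
    have "(d / 2)\<^sup>2 \<le> ?u \<omega>" if "\<bar>euler_sum s t n \<omega> - X s \<omega>\<bar> \<ge> d / 2" for \<omega>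
    proof -
      have "(d / 2)\<^sup>2 \<le> (drift_sum s t n \<omega> + noise_sum s t n \<omega>)\<^sup>2"
        using that d power_mono[of "d / 2" "\<bar>drift_sum s t n \<omega> + noise_sum s t n \<omega>\<bar>" 2] by (simp add: euler_sum_def)
      also have "\<dots> \<le> 2 * (drift_sum s t n \<omega>)\<^sup>2 + 2 * (noise_sum s t n \<omega>)\<^sup>2"
        using zero_le_power2[of "drift_sum s t n \<omega> - noise_sum s t n \<omega>"] by (simp add: power2_diff power2_sum)
      also have "(drift_sum s t n \<omega>)\<^sup>2 \<le> (K * ?h)\<^sup>2"
        using drift_sum_bound[of s t n \<omega>] st by (subst power2_abs[symmetric], intro power_mono) auto
      finally show ?thesis by simp
    qed
    then have "prob {\<omega> \<in> space M. \<bar>euler_sum s t n \<omega> - X s \<omega>\<bar> \<ge> d / 2} \<le> prob {\<omega> \<in> space M. ?u \<omega> \<ge> (d / 2)\<^sup>2}"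
      using i by (intro finite_measure_mono) auto
    also have "\<dots> \<le> expectation ?u / (d / 2)\<^sup>2"
      by (rule integral_Markov_inequality_measure[OF i sets.empty_sets]) (use d in auto)
    also have "expectation ?u = 2 * (K * ?h)\<^sup>2 + 2 * expectation (\<lambda>\<omega>. (noise_sum s t n \<omega>)\<^sup>2)"
      using mo by (simp add: prob_space)
    also have "\<dots> / (d / 2)\<^sup>2 \<le> (2 * (K * ?h)\<^sup>2 + 2 * (K\<^sup>2 * ?h)) / (d / 2)\<^sup>2"
      using mo by (intro divide_right_mono) auto
    also have "(2 * (K * h)\<^sup>2 + 2 * (K\<^sup>2 * h)) / (d / 2)\<^sup>2 = 8 * (K\<^sup>2 * h\<^sup>2 + K\<^sup>2 * h) / d\<^sup>2" for h
      by (simp add: power_mult_distrib power_divide algebra_simps)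
    finally show ?thesis .
  qed
  \<comment> \<open>As \<open>d / 4 + d / 2 < d\<close>, a displacement of at least \<open>d\<close>
    forces the Euler sum to be off \<open>X t\<close> by more than \<open>d / 4\<close> or to be
    displaced itself by at least \<open>d / 2\<close>.\<close>
  have "(\<lambda>n. prob {\<omega> \<in> space M. \<bar>euler_sum s t n \<omega> - X t \<omega>\<bar> > d / 4}) \<longlonglongrightarrow> 0"
  proof -
    have "\<forall>e>0. (\<lambda>n. prob {\<omega> \<in> space M. \<bar>euler_sum s t n \<omega> - X t \<omega>\<bar> > e}) \<longlonglongrightarrow> 0"
      using euler_sum_converges[of s t] st by (simp add: null_in_prob_def)
    moreover have "d / 4 > 0" using d by simp
    ultimately show ?thesis by blast
  qed
  from tendsto_add[OF this tendsto_const[of "8 * (K\<^sup>2 * ?h\<^sup>2 + K\<^sup>2 * ?h) / d\<^sup>2"]]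
  have "(\<lambda>n. prob {\<omega> \<in> space M. \<bar>euler_sum s t n \<omega> - X t \<omega>\<bar> > d / 4} + 8 * (K\<^sup>2 * ?h\<^sup>2 + K\<^sup>2 * ?h) / d\<^sup>2)
     \<longlonglongrightarrow> 8 * (K\<^sup>2 * ?h\<^sup>2 + K\<^sup>2 * ?h) / d\<^sup>2" by simp
  then show ?thesis
  proof (rule LIMSEQ_le_const, intro exI allI impI)
    fix n
    have "prob {\<omega> \<in> space M. \<bar>X t \<omega> - X s \<omega>\<bar> \<ge> d} \<le> prob ({\<omega> \<in> space M. \<bar>euler_sum s t n \<omega> - X t \<omega>\<bar> > d / 4} \<union>
       {\<omega> \<in> space M. \<bar>euler_sum s t n \<omega> - X s \<omega>\<bar> \<ge> d / 2})"
      proof (rule finite_measure_mono)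
      show "{\<omega> \<in> space M. \<bar>X t \<omega> - X s \<omega>\<bar> \<ge> d} \<subseteq> {\<omega> \<in> space M. \<bar>euler_sum s t n \<omega> - X t \<omega>\<bar> > d / 4} \<union>
       {\<omega> \<in> space M. \<bar>euler_sum s t n \<omega> - X s \<omega>\<bar> \<ge> d / 2}"
      proof
        fix \<omega> assume *: "\<omega> \<in> {\<omega> \<in> space M. \<bar>X t \<omega> - X s \<omega>\<bar> \<ge> d}"
        then have "\<bar>euler_sum s t n \<omega> - X t \<omega>\<bar> > d / 4 \<or> \<bar>euler_sum s t n \<omega> - X s \<omega>\<bar> \<ge> d / 2"
          using d by (simp only: mem_Collect_eq) linarith
        with * show "\<omega> \<in> {\<omega> \<in> space M. \<bar>euler_sum s t n \<omega> - X t \<omega>\<bar> > d / 4} \<union>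
          {\<omega> \<in> space M. \<bar>euler_sum s t n \<omega> - X s \<omega>\<bar> \<ge> d / 2}" by blast
      qed
    qed measurable
    also have "\<dots> \<le> prob {\<omega> \<in> space M. \<bar>euler_sum s t n \<omega> - X t \<omega>\<bar> > d / 4} +
        prob {\<omega> \<in> space M. \<bar>euler_sum s t n \<omega> - X s \<omega>\<bar> \<ge> d / 2}"
      by (rule measure_Un_le) auto
    finally show "prob {\<omega> \<in> space M. \<bar>X t \<omega> - X s \<omega>\<bar> \<ge> d} \<le>
      prob {\<omega> \<in> space M. \<bar>euler_sum s t n \<omega> - X t \<omega>\<bar> > d / 4} + 8 * (K\<^sup>2 * ?h\<^sup>2 + K\<^sup>2 * ?h) / d\<^sup>2"
      using 1[of n] by linarith
  qed
qed

text \<open>The two values differ by less than \<open>e / 2\<close> unless the path has moved by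
  \<open>d\<close>, which has a probability of order \<open>h\<close>. The threshold for
  \<open>h\<close> serves all \<open>s\<close>, because \<open>displacement_tail\<close> depends
  only on the length of the time interval.\<close>

lemma modulus_in_mean:
  fixes g :: "real \<Rightarrow> real"
  assumes g: "uniformly_continuous_on UNIV g" "\<And>x. \<bar>g x\<bar> \<le> D" and e: "e > 0"
  shows "\<forall>\<^sub>F h in at_right 0. \<forall>s u. 0 \<le> s \<longrightarrow> s \<le> u \<longrightarrow> u \<le> s + h \<longrightarrow>
     expectation (\<lambda>\<omega>. \<bar>g (X u \<omega>) - g (X s \<omega>)\<bar>) \<le> e"
proof -
  have D0: "0 \<le> D" using g(2)[of 0] by linarith
  have gm [measurable]: "g \<in> borel_measurable borel"
    using uniformly_continuous_imp_continuous[OF g(1)] by (rule borel_measurable_continuous_onI)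
  obtain d where d: "d > 0" "\<And>x x'. \<bar>x' - x\<bar> < d \<Longrightarrow> \<bar>g x' - g x\<bar> < e / 2"
    using g(1) e unfolding uniformly_continuous_on_def dist_real_def by (metis UNIV_I half_gt_zero)
  have "((\<lambda>h. 2 * D * (8 * (K\<^sup>2 * h\<^sup>2 + K\<^sup>2 * h) / d\<^sup>2)) \<longlongrightarrow> 2 * D * (8 * (K\<^sup>2 * 0\<^sup>2 + K\<^sup>2 * 0) / d\<^sup>2)) (at_right 0)"
    using d by (intro tendsto_intros) auto
  then have "\<forall>\<^sub>F h in at_right 0. 2 * D * (8 * (K\<^sup>2 * h\<^sup>2 + K\<^sup>2 * h) / d\<^sup>2) < e / 2"
    by (rule order_tendstoD) (use e in auto)
  then show ?thesis
  proof eventually_elim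
    case (elim h)
    show ?case
    proof (intro allI impI)
      fix s u assume su: "0 \<le> s" "s \<le> u" "u \<le> s + h"
      have [measurable]: "X s \<in> borel_measurable M" "X u \<in> borel_measurable M" using su by auto
      show "expectation (\<lambda>\<omega>. \<bar>g (X u \<omega>) - g (X s \<omega>)\<bar>) \<le> e"
      proof (cases "s = u")
        case False
        let ?B = "{\<omega> \<in> space M. \<bar>X u \<omega> - X s \<omega>\<bar> \<ge> d}"
        have "expectation (\<lambda>\<omega>. \<bar>g (X u \<omega>) - g (X s \<omega>)\<bar>) \<le> expectation (\<lambda>\<omega>. e / 2 + 2 * D * indicator ?B \<omega>)"
        proof (rule integral_mono)
          show "integrable M (\<lambda>\<omega>. \<bar>g (X u \<omega>) - g (X s \<omega>)\<bar>)"
            by (intro integrable_abs Bochner_Integration.integrable_diff bounded_integrable[of _ D]) (auto simp: g)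
          show "integrable M (\<lambda>\<omega>. e / 2 + 2 * D * indicator ?B \<omega>)"
            by (intro bounded_integrable[of _ "e / 2 + 2 * D"]) (use D0 e in \<open>auto simp: indicator_def\<close>)
          fix \<omega> assume "\<omega> \<in> space M"
          then show "\<bar>g (X u \<omega>) - g (X s \<omega>)\<bar> \<le> e / 2 + 2 * D * indicator ?B \<omega>"
            using d(2)[of "X u \<omega>" "X s \<omega>"] g(2)[of "X u \<omega>"] g(2)[of "X s \<omega>"] e
            by (cases "\<omega> \<in> ?B") auto
        qed
        also have "\<dots> = e / 2 + 2 * D * prob ?B"
          by (subst Bochner_Integration.integral_add)
             (auto simp: prob_space emeasure_eq_measure intro!: integrable_mult_right integrable_real_indicator)
        also have "prob ?B \<le> 8 * (K\<^sup>2 * (u - s)\<^sup>2 + K\<^sup>2 * (u - s)) / d\<^sup>2"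
          using displacement_tail[of s u d] su False d by auto
        also have "\<dots> \<le> 8 * (K\<^sup>2 * h\<^sup>2 + K\<^sup>2 * h) / d\<^sup>2"
          using su by (intro divide_right_mono mult_left_mono add_mono power_mono) auto
        finally show ?thesis using elim D0 by (simp add: mult_left_mono) 
      qed (use e in simp)
    qed
  qed
qed

text \<open>The generator estimate. The term linear in the noise has mean zero on any event
  \<open>A\<close> of the past; the quadratic term has mean close to
  \<open>h * (\<sigma> (X s \<omega>))\<^sup>2\<close> and the drift sum is close to
  \<open>h * b (X s \<omega>)\<close>, because the path moves little in time \<open>h\<close>. The
  threshold for \<open>h\<close> is chosen before \<open>s\<close> and \<open>A\<close>, so the
  bounds can be summed over a number of steps of order \<open>1 / h\<close>.\<close>

lemma one_step:
  fixes f f' f'' :: "real \<Rightarrow> real"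
  assumes d1: "\<And>x. (f has_real_derivative f' x) (at x)"
    and d2: "\<And>x. (f' has_real_derivative f'' x) (at x)"
    and D: "\<And>x. \<bar>f x\<bar> \<le> D" "\<And>x. \<bar>f' x\<bar> \<le> D" "\<And>x. \<bar>f'' x\<bar> \<le> D"
    and uc: "uniformly_continuous_on UNIV f''" and e: "e > 0"
  shows "\<forall>\<^sub>F h in at_right 0. \<forall>s A. 0 \<le> s \<longrightarrow> A \<in> sets (F s) \<longrightarrow>
    \<bar>expectation (\<lambda>\<omega>. indicator A \<omega> * (f (X (s + h) \<omega>) - f (X s \<omega>) -
       h * (b (X s \<omega>) * f' (X s \<omega>) + (\<sigma> (X s \<omega>))\<^sup>2 / 2 * f'' (X s \<omega>))))\<bar> \<le> e * h"
proof -
  have D0: "0 \<le> D" using D(1)[of 0] by linarith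
  have K0: "0 \<le> K" by (rule K_nonneg)
  have fm [measurable]: "f \<in> borel_measurable borel"
    using d1 by (intro borel_measurable_continuous_onI) (auto simp: continuous_on_eq_continuous_at intro: DERIV_isCont)
  have f'm [measurable]: "f' \<in> borel_measurable borel"
    using d2 by (intro borel_measurable_continuous_onI) (auto simp: continuous_on_eq_continuous_at intro: DERIV_isCont)
  have f''m [measurable]: "f'' \<in> borel_measurable borel"
    using uniformly_continuous_imp_continuous[OF uc] by (rule borel_measurable_continuous_onI)
  \<comment> \<open>Shares of the error budget: \<open>e1\<close> is the modulus of
    \<open>f''\<close>, \<open>\<eta>\<close> the level at which
    \<open>\<bar>Z \<omega>\<bar>\<close> is compared with its square, \<open>e2\<close> and
    \<open>e3\<close> the mean moduli of \<open>b\<close> and of \<open>\<sigma>\<^sup>2\<close>. In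
    units of \<open>e * h\<close> they allow 1/5 in \<open>E1\<close>, 2/5 in \<open>E2\<close>, 1/5
    in \<open>E4\<close> and 2/5 in \<open>E5\<close>, and the last enters with the factor 1/2. Each
    added 1 keeps a denominator positive.\<close>
  define e1 \<eta> e2 e3 where "e1 = 2 * e / (5 * (K\<^sup>2 + 1))" and "\<eta> = e / (10 * (D * K + 1))"
    and "e2 = e / (5 * (D + 1))" and "e3 = 2 * e / (5 * (D + 1))"
  have DK: "0 \<le> D * K" using D0 K0 by simp
  have K2: "K\<^sup>2 + 1 > 0" by (simp add: add_nonneg_pos)
  have pos: "e1 > 0" "\<eta> > 0" "e2 > 0" "e3 > 0"
    using e D0 DK K2 by (auto simp: e1_def \<eta>_def e2_def e3_def)
  have small: "e1 / 2 * K\<^sup>2 \<le> e / 5" "D * K * \<eta> \<le> e / 10" "D * e2 \<le> e / 5" "D * e3 / 2 \<le> e / 5"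
    using e D0 DK K2 by (auto simp: e1_def \<eta>_def e2_def e3_def field_simps)
  obtain \<delta> where \<delta>: "\<delta> > 0" "\<And>u v. \<bar>u - v\<bar> < \<delta> \<Longrightarrow> \<bar>f'' u - f'' v\<bar> < e1"
    using uc pos(1) unfolding uniformly_continuous_on_def dist_real_def by (metis UNIV_I)
  have s2uc: "uniformly_continuous_on UNIV (\<lambda>x. (\<sigma> x)\<^sup>2)"
    unfolding uniformly_continuous_on_def dist_real_def
  proof (intro allI impI)
    fix r :: real assume "r > 0"
    then have "r / (2 * K + 1) > 0" using K0 by simp
    then obtain d where d: "d > 0" "\<And>x x'. \<bar>x' - x\<bar> < d \<Longrightarrow> \<bar>\<sigma> x' - \<sigma> x\<bar> < r / (2 * K + 1)"
      using \<sigma>_uc unfolding uniformly_continuous_on_def dist_real_def by (metis UNIV_I)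
    have "\<bar>(\<sigma> x')\<^sup>2 - (\<sigma> x)\<^sup>2\<bar> < r" if "\<bar>x' - x\<bar> < d" for x x'
    proof -
      have "\<bar>(\<sigma> x')\<^sup>2 - (\<sigma> x)\<^sup>2\<bar> = \<bar>\<sigma> x' + \<sigma> x\<bar> * \<bar>\<sigma> x' - \<sigma> x\<bar>"
        by (simp add: abs_mult[symmetric] power2_eq_square algebra_simps)
      also have "\<dots> \<le> (2 * K) * (r / (2 * K + 1))"
        using d(2)[OF that] \<sigma>_bound[of x] \<sigma>_bound[of x'] by (intro mult_mono) auto
      also have "\<dots> < r" using \<open>r > 0\<close> K0 by (simp add: field_simps)
      finally show ?thesis .
    qed
    with d(1) show "\<exists>d>0. \<forall>x\<in>UNIV. \<forall>x'\<in>UNIV. \<bar>x' - x\<bar> < d \<longrightarrow> \<bar>(\<sigma> x')\<^sup>2 - (\<sigma> x)\<^sup>2\<bar> < r" by auto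
  qed
  have s2b: "\<bar>(\<sigma> x)\<^sup>2\<bar> \<le> K\<^sup>2" for x
    using power_mono[OF \<sigma>_bound[of x], of 2] by simp
  have ev1: "\<forall>\<^sub>F h in at_right 0. D * K * (K * h + K\<^sup>2 * h / \<eta>) < e / 10"
  proof (rule order_tendstoD)
    show "((\<lambda>h. D * K * (K * h + K\<^sup>2 * h / \<eta>)) \<longlongrightarrow> D * K * (K * 0 + K\<^sup>2 * 0 / \<eta>)) (at_right 0)"
      using pos by (intro tendsto_intros) auto
  qed (use e in simp)
  have ev2: "\<forall>\<^sub>F h in at_right 0. D / \<delta>\<^sup>2 * (3 * K ^ 4 * h) < e / 5"
  proof (rule order_tendstoD)
    show "((\<lambda>h. D / \<delta>\<^sup>2 * (3 * K ^ 4 * h)) \<longlongrightarrow> D / \<delta>\<^sup>2 * (3 * K ^ 4 * 0)) (at_right 0)"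
      by (intro tendsto_intros)
  qed (use e in simp)
  show ?thesis
    using ev1 ev2 modulus_in_mean[OF b_uc b_bound pos(3)] modulus_in_mean[OF s2uc s2b pos(4)]
      eventually_at_right_less[of "0::real"]
  proof eventually_elim
    case (elim h)
    show ?case
    proof (intro allI impI)
      fix s A assume s: "0 \<le> s" and A: "A \<in> sets (F s)"
      define t where "t = s + h"
      have st: "0 \<le> s" "s < t" "s \<le> t" "t - s = h" using s elim by (auto simp: t_def)
      have AM [measurable]: "A \<in> sets M" using A by (rule sets_F_M)
      have [measurable]: "X s \<in> borel_measurable M" "X t \<in> borel_measurable M" using st by auto
      define L where "L x = b x * f' x + (\<sigma> x)\<^sup>2 / 2 * f'' x" for x
      have Lm [measurable]: "L \<in> borel_measurable borel" unfolding L_def[abs_def] by measurable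
      have LB: "\<bar>L x\<bar> \<le> K * D + K\<^sup>2 / 2 * D" for x
        unfolding L_def using b_bound[of x] s2b[of x] D(2,3)[of x] K0
        by (intro order_trans[OF abs_triangle_ineq] add_mono) (auto simp: abs_mult intro!: mult_mono)
      define Y1 Y2 where "Y1 \<omega> = indicator A \<omega> * f' (X s \<omega>)" and "Y2 \<omega> = indicator A \<omega> * f'' (X s \<omega>)" for \<omega>
      have IA: "bdd_adapted 1 s (indicator A)" using A by (auto simp: bdd_adapted_def indicator_def)
      have Y: "bdd_adapted D s Y1" "bdd_adapted D s Y2"
        unfolding Y1_def[abs_def] Y2_def[abs_def]
        using bdd_adapted_mult[OF IA g_X_bdd_adapted[OF f'm D(2) s]] bdd_adapted_mult[OF IA g_X_bdd_adapted[OF f''m D(3) s]] by simp_all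
      have [measurable]: "Y1 \<in> borel_measurable M" "Y2 \<in> borel_measurable M"
        using Y bdd_adapted_measurable by auto
      have Yb: "\<bar>Y1 \<omega>\<bar> \<le> D" "\<bar>Y2 \<omega>\<bar> \<le> D" if "\<omega> \<in> space M" for \<omega>
        using Y that by (auto simp: bdd_adapted_def)
      let ?A = "indicator A :: 'a \<Rightarrow> real"
      have step_n: "\<bar>expectation (\<lambda>\<omega>. ?A \<omega> * f (euler_sum s t n \<omega>)) - expectation (\<lambda>\<omega>. ?A \<omega> * (f (X s \<omega>) + h * L (X s \<omega>)))\<bar> \<le> e * h" for n
      proof -
        define Z B where "Z = noise_sum s t n" and "B = drift_sum s t n"
        have [measurable]: "Z \<in> borel_measurable M" "B \<in> borel_measurable M"
          using st by (auto simp: Z_def B_def)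
        have Bb: "\<bar>B \<omega>\<bar> \<le> K * h" for \<omega> unfolding B_def using drift_sum_bound[of s t n \<omega>] st by simp
        note mZ = noise_moments[OF st(1,2) Y(1), of n, folded Z_def, unfolded st(4)]
        note mZ2 = noise_moments[OF st(1,2) Y(2), of n, folded Z_def, unfolded st(4)]
        \<comment> \<open>\<open>P1\<close> is the effect of the drift beyond its first order,
          \<open>P2\<close> the second-order Taylor remainder in the noise alone.\<close>
        define P1 where "P1 \<omega> = f (X s \<omega> + B \<omega> + Z \<omega>) - f (X s \<omega> + Z \<omega>) - f' (X s \<omega>) * B \<omega>" for \<omega>
        define P2 where "P2 \<omega> = f (X s \<omega> + Z \<omega>) - f (X s \<omega>) - f' (X s \<omega>) * Z \<omega> - f'' (X s \<omega>) * (Z \<omega>)\<^sup>2 / 2" for \<omega>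
        have [measurable]: "P1 \<in> borel_measurable M" "P2 \<in> borel_measurable M"
          unfolding P1_def[abs_def] P2_def[abs_def] by measurable
        have P1b: "\<bar>?A \<omega> * P1 \<omega>\<bar> \<le> D * (K * h) * (K * h + \<eta> + (Z \<omega>)\<^sup>2 / \<eta>)" for \<omega>
        proof -
          \<comment> \<open>Trades the absolute value for a square, so that the second moment of the
            noise suffices. The summand \<open>\<eta>\<close> is harmless because \<open>P1\<close>
            already carries a factor \<open>h\<close> from the drift.\<close>
          have z: "\<bar>Z \<omega>\<bar> \<le> \<eta> + (Z \<omega>)\<^sup>2 / \<eta>"
          proof (cases "\<bar>Z \<omega>\<bar> \<le> \<eta>")
            case False
            then have "\<eta> * \<bar>Z \<omega>\<bar> \<le> \<bar>Z \<omega>\<bar> * \<bar>Z \<omega>\<bar>" by (intro mult_right_mono) auto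
            then have "\<bar>Z \<omega>\<bar> \<le> (Z \<omega>)\<^sup>2 / \<eta>" using pos(2) by (simp add: field_simps power2_eq_square)
            then show ?thesis using pos(2) by linarith
          qed (use pos in \<open>simp add: add_increasing2\<close>)
          have "\<bar>?A \<omega> * P1 \<omega>\<bar> \<le> \<bar>P1 \<omega>\<bar>" by (simp add: indicator_def)
          also have "\<dots> \<le> D * \<bar>B \<omega>\<bar> * (\<bar>B \<omega>\<bar> + \<bar>Z \<omega>\<bar>)"
            unfolding P1_def by (rule first_order_remainder_le[OF d1 d2 D(3)])
          also have "\<dots> \<le> D * (K * h) * (K * h + (\<eta> + (Z \<omega>)\<^sup>2 / \<eta>))"
            using Bb[of \<omega>] z D0 K0 elim by (intro mult_mono add_mono mult_left_mono) auto
          finally show ?thesis by (simp add: add.assoc)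
        qed
        have P2b: "\<bar>?A \<omega> * P2 \<omega>\<bar> \<le> e1 / 2 * (Z \<omega>)\<^sup>2 + D / \<delta>\<^sup>2 * Z \<omega> ^ 4" for \<omega>
        proof -
          have "\<bar>?A \<omega> * P2 \<omega>\<bar> \<le> \<bar>P2 \<omega>\<bar>" by (simp add: indicator_def)
          also have "\<dots> \<le> e1 / 2 * (Z \<omega>)\<^sup>2 + D / \<delta>\<^sup>2 * Z \<omega> ^ 4"
            unfolding P2_def by (rule taylor2_remainder_le[OF d1 d2 D(3)]) (use \<delta> pos in \<open>auto intro: less_imp_le\<close>)
          finally show ?thesis .
        qed
        have i1: "integrable M (\<lambda>\<omega>. D * (K * h) * (K * h + \<eta> + (Z \<omega>)\<^sup>2 / \<eta>))"
          using mZ by simp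
        have i2: "integrable M (\<lambda>\<omega>. e1 / 2 * (Z \<omega>)\<^sup>2 + D / \<delta>\<^sup>2 * Z \<omega> ^ 4)"
          using mZ by simp
        have iP1: "integrable M (\<lambda>\<omega>. ?A \<omega> * P1 \<omega>)"
          by (rule Bochner_Integration.integrable_bound[OF i1])
             (measurable, rule AE_I2, unfold real_norm_def, rule order_trans[OF P1b abs_ge_self])
        have iP2: "integrable M (\<lambda>\<omega>. ?A \<omega> * P2 \<omega>)"
          by (rule Bochner_Integration.integrable_bound[OF i2])
             (measurable, rule AE_I2, unfold real_norm_def, rule order_trans[OF P2b abs_ge_self])
        have E1: "\<bar>expectation (\<lambda>\<omega>. ?A \<omega> * P1 \<omega>)\<bar> \<le> (e / 5) * h"
        proof -
          have "\<bar>expectation (\<lambda>\<omega>. ?A \<omega> * P1 \<omega>)\<bar> \<le> expectation (\<lambda>\<omega>. D * (K * h) * (K * h + \<eta> + (Z \<omega>)\<^sup>2 / \<eta>))"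
            by (rule order_trans[OF integral_abs_bound integral_mono[OF integrable_abs[OF iP1] i1 P1b]])
          also have "\<dots> = D * (K * h) * (K * h + \<eta> + expectation (\<lambda>\<omega>. (Z \<omega>)\<^sup>2) / \<eta>)"
            using mZ(6) by (simp add: prob_space)
          also have "\<dots> \<le> D * (K * h) * (K * h + \<eta> + K\<^sup>2 * h / \<eta>)"
            using mZ(4) D0 K0 pos elim by (intro mult_left_mono add_left_mono divide_right_mono) auto
          also have "\<dots> = (D * K * (K * h + K\<^sup>2 * h / \<eta>) + D * K * \<eta>) * h" by (simp add: algebra_simps)
          also have "\<dots> \<le> (e / 10 + e / 10) * h"
            using elim small by (intro mult_right_mono add_mono) auto
          finally show ?thesis by simp
        qed
        have E2: "\<bar>expectation (\<lambda>\<omega>. ?A \<omega> * P2 \<omega>)\<bar> \<le> (2 * e / 5) * h"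
        proof -
          have "\<bar>expectation (\<lambda>\<omega>. ?A \<omega> * P2 \<omega>)\<bar> \<le> expectation (\<lambda>\<omega>. e1 / 2 * (Z \<omega>)\<^sup>2 + D / \<delta>\<^sup>2 * Z \<omega> ^ 4)"
            by (rule order_trans[OF integral_abs_bound integral_mono[OF integrable_abs[OF iP2] i2 P2b]])
          also have "\<dots> = e1 / 2 * expectation (\<lambda>\<omega>. (Z \<omega>)\<^sup>2) + D / \<delta>\<^sup>2 * expectation (\<lambda>\<omega>. Z \<omega> ^ 4)"
            using mZ(1,6) by simp
          also have "\<dots> \<le> e1 / 2 * (K\<^sup>2 * h) + D / \<delta>\<^sup>2 * (3 * K ^ 4 * h\<^sup>2)"
            using mZ(4,5) D0 pos by (intro add_mono mult_left_mono) auto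
          also have "\<dots> = (e1 / 2 * K\<^sup>2 + D / \<delta>\<^sup>2 * (3 * K ^ 4 * h)) * h"
            by (simp add: algebra_simps power2_eq_square)
          also have "\<dots> \<le> (e / 5 + e / 5) * h"
            using elim small by (intro mult_right_mono add_mono) auto
          finally show ?thesis by simp
        qed
        \<comment> \<open>Freezes \<open>g\<close> at the left end \<open>s\<close> instead of
          sampling it at the nodes, at the price of its mean modulus \<open>r\<close>. It is applied
          to \<open>b\<close> in \<open>E4\<close> and to \<open>\<sigma>\<^sup>2\<close> in
          \<open>E5\<close>.\<close>
        have riemann: "\<bar>\<Sum>k<2 ^ n. h / 2 ^ n * expectation (\<lambda>\<omega>. Y \<omega> * (g (X (node s t n k) \<omega>) - g (X s \<omega>)))\<bar> \<le> D * r * h"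
          if Y: "bdd_adapted D s Y" and g [measurable]: "g \<in> borel_measurable borel" and gb: "\<And>x. \<bar>g x\<bar> \<le> G"
            and r: "\<And>u. s \<le> u \<Longrightarrow> u \<le> s + h \<Longrightarrow> expectation (\<lambda>\<omega>. \<bar>g (X u \<omega>) - g (X s \<omega>)\<bar>) \<le> r" for Y g G r
        proof -
          have [measurable]: "Y \<in> borel_measurable M" using Y by (rule bdd_adapted_measurable)
          have "\<bar>expectation (\<lambda>\<omega>. Y \<omega> * (g (X (node s t n k) \<omega>) - g (X s \<omega>)))\<bar> \<le> D * r" if "k < 2 ^ n" for k
          proof -
            have nd: "s \<le> node s t n k" "node s t n k \<le> s + h"
              using node_ge[of s t n k] node_le[of s t k n] st that by (auto simp: t_def)
            then have [measurable]: "X (node s t n k) \<in> borel_measurable M" using s by auto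
            have i: "integrable M (\<lambda>\<omega>. \<bar>g (X (node s t n k) \<omega>) - g (X s \<omega>)\<bar>)"
              by (intro integrable_abs Bochner_Integration.integrable_diff bounded_integrable[of _ G]) (auto simp: gb)
            have "\<bar>expectation (\<lambda>\<omega>. Y \<omega> * (g (X (node s t n k) \<omega>) - g (X s \<omega>)))\<bar>
              \<le> expectation (\<lambda>\<omega>. \<bar>Y \<omega> * (g (X (node s t n k) \<omega>) - g (X s \<omega>))\<bar>)" by (rule integral_abs_bound)
            also have "\<dots> \<le> expectation (\<lambda>\<omega>. D * \<bar>g (X (node s t n k) \<omega>) - g (X s \<omega>)\<bar>)"
            proof (rule integral_mono)
              show "integrable M (\<lambda>\<omega>. \<bar>Y \<omega> * (g (X (node s t n k) \<omega>) - g (X s \<omega>))\<bar>)"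
                using i by (intro integrable_abs bdd_mult_integrable[OF Y] Bochner_Integration.integrable_diff bounded_integrable[of _ G])
                   (auto simp: gb)
              show "integrable M (\<lambda>\<omega>. D * \<bar>g (X (node s t n k) \<omega>) - g (X s \<omega>)\<bar>)" using i by simp
              show "\<bar>Y \<omega> * (g (X (node s t n k) \<omega>) - g (X s \<omega>))\<bar> \<le> D * \<bar>g (X (node s t n k) \<omega>) - g (X s \<omega>)\<bar>"
                if "\<omega> \<in> space M" for \<omega>
                using Y that unfolding abs_mult by (intro mult_right_mono) (auto simp: bdd_adapted_def)
            qed
            also have "\<dots> = D * expectation (\<lambda>\<omega>. \<bar>g (X (node s t n k) \<omega>) - g (X s \<omega>)\<bar>)" by simp
            also have "\<dots> \<le> D * r" using r[OF nd] D0 by (rule mult_left_mono)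
            finally show ?thesis .
          qed
          then have "\<bar>\<Sum>k<2 ^ n. h / 2 ^ n * expectation (\<lambda>\<omega>. Y \<omega> * (g (X (node s t n k) \<omega>) - g (X s \<omega>)))\<bar>
              \<le> (\<Sum>k<(2::nat) ^ n. h / 2 ^ n * (D * r))"
            using elim by (intro order_trans[OF sum_abs] sum_mono) (simp add: abs_mult mult_left_mono divide_right_mono)
          then show ?thesis by (simp add: mult_ac)
        qed
        have nodeX: "X (node s t n k) \<in> borel_measurable M" for k using st by simp
        have iY: "integrable M (\<lambda>\<omega>. Y \<omega> * g (X (node s t n k) \<omega>))" "integrable M (\<lambda>\<omega>. Y \<omega> * g (X s \<omega>))"
          if "bdd_adapted D s Y" "g \<in> borel_measurable borel" "\<And>x. \<bar>g x\<bar> \<le> G" for Y g G k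
          using that nodeX[of k] by (auto intro!: bdd_mult_integrable[OF that(1)] bounded_integrable[of _ G])
        have E4: "\<bar>expectation (\<lambda>\<omega>. Y1 \<omega> * (B \<omega> - h * b (X s \<omega>)))\<bar> \<le> (e / 5) * h"
        proof -
          have "(\<lambda>\<omega>. Y1 \<omega> * (B \<omega> - h * b (X s \<omega>))) =
            (\<lambda>\<omega>. \<Sum>k<2 ^ n. h / 2 ^ n * (Y1 \<omega> * (b (X (node s t n k) \<omega>) - b (X s \<omega>))))"
            unfolding B_def drift_sum_def st(4)
            by (simp add: fun_eq_iff algebra_simps sum_subtractf sum_distrib_left sum_divide_distrib)
          moreover have "integrable M (\<lambda>\<omega>. Y1 \<omega> * (b (X (node s t n k) \<omega>) - b (X s \<omega>)))" for k
            using iY[OF Y(1) b_measurable b_bound] by (simp add: right_diff_distrib)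
          ultimately have "expectation (\<lambda>\<omega>. Y1 \<omega> * (B \<omega> - h * b (X s \<omega>))) =
            (\<Sum>k<2 ^ n. h / 2 ^ n * expectation (\<lambda>\<omega>. Y1 \<omega> * (b (X (node s t n k) \<omega>) - b (X s \<omega>))))"
            by (simp add: Bochner_Integration.integral_sum)
          also have "\<bar>\<dots>\<bar> \<le> D * e2 * h"
            by (rule riemann[OF Y(1) b_measurable b_bound]) (use elim s in auto)
          also have "\<dots> \<le> e / 5 * h" using small elim by (intro mult_right_mono) auto
          finally show ?thesis .
        qed
        have E5: "\<bar>expectation (\<lambda>\<omega>. Y2 \<omega> * (Z \<omega>)\<^sup>2) - h * expectation (\<lambda>\<omega>. Y2 \<omega> * (\<sigma> (X s \<omega>))\<^sup>2)\<bar> \<le> (2 * e / 5) * h"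
        proof -
          have s2m: "(\<lambda>x. (\<sigma> x)\<^sup>2) \<in> borel_measurable borel" by measurable
          note iy = iY[OF Y(2) s2m s2b]
          have "expectation (\<lambda>\<omega>. Y2 \<omega> * (Z \<omega>)\<^sup>2) - h * expectation (\<lambda>\<omega>. Y2 \<omega> * (\<sigma> (X s \<omega>))\<^sup>2)
            = (\<Sum>k<2 ^ n. h / 2 ^ n * expectation (\<lambda>\<omega>. Y2 \<omega> * (\<sigma> (X (node s t n k) \<omega>))\<^sup>2))
              - (\<Sum>k<(2::nat) ^ n. h / 2 ^ n * expectation (\<lambda>\<omega>. Y2 \<omega> * (\<sigma> (X s \<omega>))\<^sup>2))"
            unfolding mZ2(3) by simp
          also have "\<dots> = (\<Sum>k<2 ^ n. h / 2 ^ n * expectation (\<lambda>\<omega>. Y2 \<omega> * ((\<sigma> (X (node s t n k) \<omega>))\<^sup>2 - (\<sigma> (X s \<omega>))\<^sup>2)))"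
            unfolding sum_subtractf[symmetric] right_diff_distrib[symmetric]
            using iy by (simp add: right_diff_distrib)
          also have "\<bar>\<dots>\<bar> \<le> D * e3 * h"
            by (rule riemann[OF Y(2) s2m s2b]) (use elim s in auto)
          also have "\<dots> \<le> (2 * e / 5) * h" using small elim by (intro mult_right_mono) auto
          finally show ?thesis .
        qed
        have i3: "integrable M (\<lambda>\<omega>. Y1 \<omega> * Z \<omega>)" by (rule bdd_mult_integrable[OF Y(1) mZ(7)])
        have i4: "integrable M (\<lambda>\<omega>. Y1 \<omega> * (B \<omega> - h * b (X s \<omega>)))"
          by (intro bdd_mult_integrable[OF Y(1)] Bochner_Integration.integrable_diff integrable_mult_right
               bounded_integrable[of B "K * h"] bounded_integrable[of "\<lambda>\<omega>. b (X s \<omega>)" K]) (auto simp: Bb b_bound)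
        have i5: "integrable M (\<lambda>\<omega>. Y2 \<omega> * (Z \<omega>)\<^sup>2)" by (rule bdd_mult_integrable[OF Y(2) mZ(6)])
        have i6: "integrable M (\<lambda>\<omega>. Y2 \<omega> * (\<sigma> (X s \<omega>))\<^sup>2)"
          using iY(2)[OF Y(2), of "\<lambda>x. (\<sigma> x)\<^sup>2" "K\<^sup>2"] s2b by simp
        have i7: "integrable M (\<lambda>\<omega>. ?A \<omega> * f (euler_sum s t n \<omega>))" "integrable M (\<lambda>\<omega>. ?A \<omega> * f (X s \<omega>))"
          "integrable M (\<lambda>\<omega>. ?A \<omega> * L (X s \<omega>))"
          using st LB by (auto intro!: bdd_mult_integrable[OF IA] bounded_integrable[of _ D] bounded_integrable[of "\<lambda>\<omega>. L (X s \<omega>)" "K * D + K\<^sup>2 / 2 * D"] simp: D)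
        \<comment> \<open>An exact decomposition: \<open>Y1 \<omega> * Z \<omega>\<close> has mean
          zero by \<open>mZ(2)\<close>, and the other terms are those bounded in \<open>E1\<close>,
          \<open>E2\<close>, \<open>E4\<close> and \<open>E5\<close>.\<close>
        have "(\<lambda>\<omega>. ?A \<omega> * f (euler_sum s t n \<omega>) - ?A \<omega> * (f (X s \<omega>) + h * L (X s \<omega>))) =
          (\<lambda>\<omega>. ?A \<omega> * P1 \<omega> + ?A \<omega> * P2 \<omega> + Y1 \<omega> * Z \<omega> + Y1 \<omega> * (B \<omega> - h * b (X s \<omega>))
             + (Y2 \<omega> * (Z \<omega>)\<^sup>2 - h * (Y2 \<omega> * (\<sigma> (X s \<omega>))\<^sup>2)) / 2)"
          unfolding P1_def P2_def Y1_def Y2_def L_def euler_sum_def B_def[symmetric] Z_def[symmetric]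
          by (auto simp: fun_eq_iff field_simps indicator_def)
        then have "expectation (\<lambda>\<omega>. ?A \<omega> * f (euler_sum s t n \<omega>) - ?A \<omega> * (f (X s \<omega>) + h * L (X s \<omega>))) =
          expectation (\<lambda>\<omega>. ?A \<omega> * P1 \<omega>) + expectation (\<lambda>\<omega>. ?A \<omega> * P2 \<omega>) + expectation (\<lambda>\<omega>. Y1 \<omega> * Z \<omega>)
            + expectation (\<lambda>\<omega>. Y1 \<omega> * (B \<omega> - h * b (X s \<omega>)))
            + (expectation (\<lambda>\<omega>. Y2 \<omega> * (Z \<omega>)\<^sup>2) - h * expectation (\<lambda>\<omega>. Y2 \<omega> * (\<sigma> (X s \<omega>))\<^sup>2)) / 2"
          using iP1 iP2 i3 i4 i5 i6 by simp
        moreover have "expectation (\<lambda>\<omega>. ?A \<omega> * f (euler_sum s t n \<omega>) - ?A \<omega> * (f (X s \<omega>) + h * L (X s \<omega>))) =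
          expectation (\<lambda>\<omega>. ?A \<omega> * f (euler_sum s t n \<omega>)) - expectation (\<lambda>\<omega>. ?A \<omega> * (f (X s \<omega>) + h * L (X s \<omega>)))"
          using i7 by (intro Bochner_Integration.integral_diff) (auto simp: distrib_left mult.left_commute[of _ h])
        moreover have "\<bar>a1 + a2 + a3 + a4 + a5 / 2\<bar> \<le> c1 + c2 + c4 + c5 / 2"
          if "\<bar>a1\<bar> \<le> c1" "\<bar>a2\<bar> \<le> c2" "a3 = 0" "\<bar>a4\<bar> \<le> c4" "\<bar>a5\<bar> \<le> c5" for a1 a2 a3 a4 a5 c1 c2 c4 c5 :: real
          using that by linarith
        note this[OF E1 E2 mZ(2) E4 E5]
        moreover have "e / 5 * h + 2 * e / 5 * h + e / 5 * h + (2 * e / 5 * h) / 2 = e * h" by simp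
        ultimately show ?thesis by (simp only:)
      qed
      \<comment> \<open>The bound in \<open>step_n\<close> does not depend on \<open>n\<close>, so
        it survives the passage from the Euler sums to \<open>X t\<close>.\<close>
      have "(\<lambda>n. expectation (\<lambda>\<omega>. ?A \<omega> * f (euler_sum s t n \<omega>))) \<longlonglongrightarrow> expectation (\<lambda>\<omega>. ?A \<omega> * f (X t \<omega>))"
        by (rule expectation_lipschitz_tendsto[OF euler_sum_converges[OF st(1,3)], where D=D and L=D])
           (use st D bounded_derivative_lipschitz[OF d1 D(2)] in auto)
      from tendsto_rabs[OF tendsto_diff[OF this tendsto_const]]
      have "\<bar>expectation (\<lambda>\<omega>. ?A \<omega> * f (X t \<omega>)) - expectation (\<lambda>\<omega>. ?A \<omega> * (f (X s \<omega>) + h * L (X s \<omega>)))\<bar> \<le> e * h"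
        by (rule LIMSEQ_le_const2) (use step_n in auto)
      moreover have "expectation (\<lambda>\<omega>. ?A \<omega> * (f (X t \<omega>) - f (X s \<omega>) - h * L (X s \<omega>))) =
        expectation (\<lambda>\<omega>. ?A \<omega> * f (X t \<omega>)) - expectation (\<lambda>\<omega>. ?A \<omega> * (f (X s \<omega>) + h * L (X s \<omega>)))"
      proof -
        have "(\<lambda>\<omega>. ?A \<omega> * (f (X t \<omega>) - f (X s \<omega>) - h * L (X s \<omega>))) =
          (\<lambda>\<omega>. ?A \<omega> * f (X t \<omega>) - ?A \<omega> * (f (X s \<omega>) + h * L (X s \<omega>)))" by (auto simp: algebra_simps)
        moreover have "integrable M (\<lambda>\<omega>. ?A \<omega> * f (X t \<omega>))" "integrable M (\<lambda>\<omega>. ?A \<omega> * (f (X s \<omega>) + h * L (X s \<omega>)))"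
          by (intro bdd_mult_integrable[OF IA] Bochner_Integration.integrable_add integrable_mult_right
             bounded_integrable[of "\<lambda>\<omega>. f (X s \<omega>)" D] bounded_integrable[of "\<lambda>\<omega>. f (X t \<omega>)" D]
             bounded_integrable[of "\<lambda>\<omega>. L (X s \<omega>)" "K * D + K\<^sup>2 / 2 * D"]; use D LB in simp)+
        ultimately show ?thesis by simp
      qed
      ultimately show "\<bar>expectation (\<lambda>\<omega>. ?A \<omega> * (f (X (s + h) \<omega>) - f (X s \<omega>) -
       h * (b (X s \<omega>) * f' (X s \<omega>) + (\<sigma> (X s \<omega>))\<^sup>2 / 2 * f'' (X s \<omega>))))\<bar> \<le> e * h"
        by (simp add: t_def L_def)
    qed
  qed
qed

end

section \<open>Exit from an interval of length two\<close>

context bounded_sde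
begin

definition exit_time :: "'a \<Rightarrow> ereal" where
  "exit_time \<omega> = cyc_time (\<lambda>t. X t \<omega>) 1"

definition alive :: "real \<Rightarrow> 'a set" where
  "alive t = {\<omega> \<in> space M. ereal t < exit_time \<omega>}"

text \<open>A bounded real-valued substitute for \<open>exit_time\<close>, at which the path can be
  evaluated even if it never exits. The horizon is removed in \<open>exit_laplace\<close>.\<close>

definition trunc_exit :: "real \<Rightarrow> 'a \<Rightarrow> real" where
  "trunc_exit R \<omega> = real_of_ereal (min (exit_time \<omega>) (ereal R))"

lemma alive_iff:
  assumes "\<omega> \<in> space M" "0 \<le> t"
  shows "\<omega> \<in> alive t \<longleftrightarrow> (\<forall>s\<in>{0..t}. \<bar>X s \<omega> - y\<bar> < 1)"
  using first_cycle_gt_iff[OF X_cont[OF assms(1)] assms(2)] X_0[OF assms(1)] assms(1)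
  by (simp add: alive_def exit_time_def)

text \<open>Measurability calls for countably many conditions. A strict bound on the compact
  interval is a bound away from 1, since the maximum is attained, and by continuity a weak bound can
  be tested at rational times.\<close>

lemma alive_rational_iff:
  assumes \<omega>: "\<omega> \<in> space M" and t: "0 \<le> t"
  shows "\<omega> \<in> alive t \<longleftrightarrow> (\<exists>m. \<forall>q\<in>\<rat> \<inter> {0..t}. \<bar>X q \<omega> - y\<bar> \<le> 1 - 1 / real (Suc m))"
proof
  have c: "continuous_on {0..t} (\<lambda>s. \<bar>X s \<omega> - y\<bar>)"
    by (intro continuous_intros continuous_on_subset[OF X_cont[OF \<omega>]]) auto
  {
    assume "\<omega> \<in> alive t"
    then have l: "\<forall>s\<in>{0..t}. \<bar>X s \<omega> - y\<bar> < 1" using alive_iff[OF \<omega> t] by simp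
    obtain s where s: "s \<in> {0..t}" "\<forall>u\<in>{0..t}. \<bar>X u \<omega> - y\<bar> \<le> \<bar>X s \<omega> - y\<bar>"
      using continuous_attains_sup[OF compact_Icc _ c] t by auto
    have "0 < 1 - \<bar>X s \<omega> - y\<bar>" using l s by auto
    then obtain m where "inverse (real (Suc m)) < 1 - \<bar>X s \<omega> - y\<bar>"
      using reals_Archimedean by blast
    with s(2) show "\<exists>m. \<forall>q\<in>\<rat> \<inter> {0..t}. \<bar>X q \<omega> - y\<bar> \<le> 1 - 1 / real (Suc m)"
      by (intro exI[of _ m]) (force simp: inverse_eq_divide)
  }
  assume "\<exists>m. \<forall>q\<in>\<rat> \<inter> {0..t}. \<bar>X q \<omega> - y\<bar> \<le> 1 - 1 / real (Suc m)"
  then obtain m where m0: "\<forall>q\<in>\<rat> \<inter> {0..t}. \<bar>X q \<omega> - y\<bar> \<le> 1 - 1 / real (Suc m)" by blast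
  then have m: "\<bar>X q \<omega> - y\<bar> \<le> 1 - 1 / real (Suc m)" if "q \<in> \<rat>" "0 \<le> q" "q \<le> t" for q
    using that by simp
  have "\<bar>X s \<omega> - y\<bar> \<le> 1 - 1 / real (Suc m)" if s: "s \<in> {0..t}" for s
  proof (rule ccontr)
    assume neg: "\<not> ?thesis"
    define r where "r = \<bar>X s \<omega> - y\<bar> - (1 - 1 / real (Suc m))"
    have "r > 0" using neg by (simp add: r_def)
    then obtain d where d: "d > 0" "\<And>u. u \<in> {0..t} \<Longrightarrow> \<bar>u - s\<bar> < d \<Longrightarrow> \<bar>\<bar>X u \<omega> - y\<bar> - \<bar>X s \<omega> - y\<bar>\<bar> < r"
      using c s unfolding continuous_on_iff dist_real_def by metis
    have "\<exists>q. q \<in> \<rat> \<and> 0 \<le> q \<and> q \<le> t \<and> \<bar>q - s\<bar> < d"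
    proof (cases "t = 0")
      case True
      then show ?thesis using s d by (intro exI[of _ 0]) auto
    next
      case False
      then have "max 0 (s - d) < min t (s + d)" using s t d by auto
      from Rats_dense_in_real[OF this] show ?thesis by auto
    qed
    then obtain q where q: "q \<in> \<rat>" "0 \<le> q" "q \<le> t" "\<bar>q - s\<bar> < d" by blast
    have "\<bar>\<bar>X q \<omega> - y\<bar> - \<bar>X s \<omega> - y\<bar>\<bar> < r" using d(2)[of q] q by auto
    with m[OF q(1-3)] show False by (simp add: r_def)
  qed
  moreover have "1 - 1 / real (Suc m) < 1" by simp
  ultimately show "\<omega> \<in> alive t" using alive_iff[OF \<omega> t] le_less_trans by blast
qed

text \<open>The stopping time property of the exit time: survival at the left end of a step is an
  admissible event \<open>A\<close> in \<open>one_step\<close>.\<close>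

lemma alive_sets:
  assumes t: "0 \<le> t"
  shows "alive t \<in> sets (F t)"
proof -
  have m: "X q \<in> borel_measurable (F t)" if "q \<in> \<rat> \<inter> {0..t}" for q
    using that measurable_F_mono[OF X_measurable_F[of q]] by auto
  have "{\<omega> \<in> space (F t). \<forall>q\<in>\<rat> \<inter> {0..t}. \<bar>X q \<omega> - y\<bar> \<le> 1 - 1 / real (Suc m)} \<in> sets (F t)" for m
  proof -
    have "(\<Inter>q\<in>\<rat> \<inter> {0..t}. {\<omega> \<in> space (F t). \<bar>X q \<omega> - y\<bar> \<le> 1 - 1 / real (Suc m)}) \<in> sets (F t)"
    proof (rule sets.countable_INT')
      show "countable (\<rat> \<inter> {0..t})" using countable_rat by auto
      show "\<rat> \<inter> {0..t} \<noteq> {}" using t by auto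
      show "(\<lambda>q. {\<omega> \<in> space (F t). \<bar>X q \<omega> - y\<bar> \<le> 1 - 1 / real (Suc m)}) ` (\<rat> \<inter> {0..t}) \<subseteq> sets (F t)"
      proof (rule image_subsetI)
        fix q assume "q \<in> \<rat> \<inter> {0..t}"
        note [measurable] = m[OF this]
        show "{\<omega> \<in> space (F t). \<bar>X q \<omega> - y\<bar> \<le> 1 - 1 / real (Suc m)} \<in> sets (F t)" by measurable
      qed
    qed
    also have "(\<Inter>q\<in>\<rat> \<inter> {0..t}. {\<omega> \<in> space (F t). \<bar>X q \<omega> - y\<bar> \<le> 1 - 1 / real (Suc m)}) =
      {\<omega> \<in> space (F t). \<forall>q\<in>\<rat> \<inter> {0..t}. \<bar>X q \<omega> - y\<bar> \<le> 1 - 1 / real (Suc m)}"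
      using t by (force intro: bexI[of _ 0])
    finally show ?thesis .
  qed
  then have "{\<omega> \<in> space (F t). \<exists>m. \<forall>q\<in>\<rat> \<inter> {0..t}. \<bar>X q \<omega> - y\<bar> \<le> 1 - 1 / real (Suc m)} \<in> sets (F t)"
    by (rule sets.sets_Collect_countable_Ex)
  moreover have "alive t = {\<omega> \<in> space (F t). \<exists>m. \<forall>q\<in>\<rat> \<inter> {0..t}. \<bar>X q \<omega> - y\<bar> \<le> 1 - 1 / real (Suc m)}"
    using alive_rational_iff[OF _ t] by (auto simp: alive_def)
  ultimately show ?thesis by simp
qed

lemma alive_events [measurable]: "0 \<le> t \<Longrightarrow> alive t \<in> sets M"
  using alive_sets sets_F_M by blast

lemma exit_time_pos: "\<omega> \<in> space M \<Longrightarrow> 0 < exit_time \<omega>"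
  using alive_iff[of \<omega> 0] X_0[of \<omega>] by (simp add: alive_def zero_ereal_def)

lemma trunc_exit_bounds:
  assumes "\<omega> \<in> space M" "0 < R"
  shows "0 < trunc_exit R \<omega>" "trunc_exit R \<omega> \<le> R"
  using exit_time_pos[OF assms(1)] assms(2)
  by (cases "exit_time \<omega>"; simp add: trunc_exit_def min_def)+

lemma trunc_exit_eq: "exit_time \<omega> = ereal r \<Longrightarrow> r \<le> R \<Longrightarrow> trunc_exit R \<omega> = r"
  by (simp add: trunc_exit_def min_def)

lemma trunc_exit_eq_R: "exit_time \<omega> = \<infinity> \<Longrightarrow> trunc_exit R \<omega> = R"
  by (simp add: trunc_exit_def min_def)

lemma less_trunc_exit_iff:
  assumes "\<omega> \<in> space M" "0 < R" "t < R"
  shows "t < trunc_exit R \<omega> \<longleftrightarrow> \<omega> \<in> alive t"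
  using assms exit_time_pos[OF assms(1)]
  by (cases "exit_time \<omega>") (auto simp: trunc_exit_def min_def alive_def)

text \<open>Exactly the steps whose left end precedes the exit are kept, so the sum telescopes up to
  the first grid point not before the truncated exit time, whence the ceiling. The
  \<open>R * m\<close> steps of length \<open>1 / m\<close> cover the horizon.\<close>

lemma stopped_telescope:
  fixes g :: "nat \<Rightarrow> real"
  assumes \<omega>: "\<omega> \<in> space M" and R: "0 < R" and m: "0 < m"
  shows "(\<Sum>k<R * m. indicator (alive (k / m)) \<omega> * (g (Suc k) - g k)) = g (nat \<lceil>trunc_exit R \<omega> * m\<rceil>) - g 0"
proof -
  define N where "N = nat \<lceil>trunc_exit R \<omega> * m\<rceil>"
  note tb = trunc_exit_bounds[OF \<omega>, of R]
  have "trunc_exit R \<omega> * m \<le> real (R * m)" using tb R m by simp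
  then have NR: "N \<le> R * m" unfolding N_def by (simp add: nat_le_iff ceiling_le_iff)
  have *: "\<omega> \<in> alive (k / m) \<longleftrightarrow> k < N" if "k < R * m" for k :: nat
  proof -
    have "real k < real (R * m)" using that by linarith
    then have "real k / m < R" using m by (simp add: field_simps)
    then have "\<omega> \<in> alive (k / m) \<longleftrightarrow> k / m < trunc_exit R \<omega>"
      using less_trunc_exit_iff[OF \<omega>, of R "k / m"] R by simp
    also have "\<dots> \<longleftrightarrow> real k < trunc_exit R \<omega> * m" using m by (simp add: field_simps)
    also have "\<dots> \<longleftrightarrow> k < N" unfolding N_def by (simp add: zless_nat_eq_int_zless less_ceiling_iff)
    finally show ?thesis .
  qed
  have "(\<Sum>k<R * m. indicator (alive (k / m)) \<omega> * (g (Suc k) - g k)) = (\<Sum>k<R * m. if k < N then g (Suc k) - g k else 0)"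
    using * by (intro sum.cong) (auto simp: indicator_def)
  also have "\<dots> = (\<Sum>k\<in>{..<R * m} \<inter> {k. k < N}. g (Suc k) - g k)"
    by (subst sum.inter_restrict) auto
  also have "{..<R * m} \<inter> {k. k < N} = {..<N}" using NR by auto
  also have "(\<Sum>k<N. g (Suc k) - g k) = g N - g 0" by (rule sum_lessThan_telescope)
  finally show ?thesis by (simp add: N_def)
qed

lemma ceiling_grid_tendsto:
  assumes "0 \<le> (x::real)"
  shows "(\<lambda>m. real (nat \<lceil>x * real (Suc m)\<rceil>) / real (Suc m)) \<longlonglongrightarrow> x"
proof (rule tendsto_sandwich[of "\<lambda>_. x" _ _ "\<lambda>m. x + 1 / real (Suc m)"])
  have n: "real (nat \<lceil>x * real (Suc m)\<rceil>) = of_int \<lceil>x * real (Suc m)\<rceil>" for m using assms by simp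
  have "x \<le> real (nat \<lceil>x * real (Suc m)\<rceil>) / real (Suc m)" for m
    unfolding n using le_of_int_ceiling[of "x * real (Suc m)"] by (simp add: field_simps del: of_nat_Suc)
  then show "\<forall>\<^sub>F m in sequentially. x \<le> real (nat \<lceil>x * real (Suc m)\<rceil>) / real (Suc m)" by simp
  have "real (nat \<lceil>x * real (Suc m)\<rceil>) / real (Suc m) \<le> x + 1 / real (Suc m)" for m
    unfolding n using of_int_ceiling_le_add_one[of "x * real (Suc m)"] by (simp add: field_simps del: of_nat_Suc)
  then show "\<forall>\<^sub>F m in sequentially. real (nat \<lceil>x * real (Suc m)\<rceil>) / real (Suc m) \<le> x + 1 / real (Suc m)" by simp
  show "(\<lambda>m. x + 1 / real (Suc m)) \<longlonglongrightarrow> x"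
    using tendsto_add[OF tendsto_const[of x] LIMSEQ_Suc[OF lim_const_over_n[of 1]]] by simp
qed simp

abbreviation "grid_exit R m \<omega> \<equiv> real (nat \<lceil>trunc_exit (real R) \<omega> * real (Suc m)\<rceil>) / real (Suc m)"

lemma grid_exit_tendsto: "\<omega> \<in> space M \<Longrightarrow> 0 < R \<Longrightarrow> (\<lambda>m. grid_exit R m \<omega>) \<longlonglongrightarrow> trunc_exit R \<omega>"
  using trunc_exit_bounds[of \<omega> R] by (intro ceiling_grid_tendsto) auto

lemma X_grid_exit_tendsto:
  assumes "\<omega> \<in> space M" "0 < R"
  shows "(\<lambda>m. X (grid_exit R m \<omega>) \<omega>) \<longlonglongrightarrow> X (trunc_exit R \<omega>) \<omega>"
proof (rule continuous_on_tendsto_compose[OF X_cont[OF assms(1)] grid_exit_tendsto[OF assms]])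
  show "trunc_exit R \<omega> \<in> {0..}" using trunc_exit_bounds[OF assms(1), of R] assms by simp
  show "\<forall>\<^sub>F m in sequentially. grid_exit R m \<omega> \<in> {0..}"
    by (intro always_eventually allI, unfold atLeast_iff) (rule divide_nonneg_nonneg; rule of_nat_0_le_iff)
qed

text \<open>Telescoping the grid points themselves exhibits the grid approximation as a finite sum
  over the events \<open>alive\<close>; the limit inherits measurability. The same device, with the
  path along the grid, handles the position at the truncated exit time.\<close>

lemma trunc_exit_measurable [measurable]:
  assumes R: "0 < R"
  shows "trunc_exit (real R) \<in> borel_measurable M"
proof (rule borel_measurable_LIMSEQ_real[OF grid_exit_tendsto[OF _ R]])
  fix m
  have "(\<lambda>\<omega>. \<Sum>k<R * Suc m. indicator (alive (k / real (Suc m))) \<omega> * (real (Suc k) / real (Suc m) - real k / real (Suc m))) \<in> borel_measurable M"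
    by (intro borel_measurable_sum borel_measurable_times borel_measurable_indicator borel_measurable_const alive_events) simp
  also have "?this \<longleftrightarrow> (\<lambda>\<omega>. grid_exit R m \<omega>) \<in> borel_measurable M"
    by (rule measurable_cong) (use stopped_telescope[OF _ R, of _ "Suc m" "\<lambda>k. real k / real (Suc m)"] in simp)
  finally show "(\<lambda>\<omega>. grid_exit R m \<omega>) \<in> borel_measurable M" .
qed

lemma X_trunc_exit_measurable [measurable]:
  assumes R: "0 < R"
  shows "(\<lambda>\<omega>. X (trunc_exit (real R) \<omega>) \<omega>) \<in> borel_measurable M"
proof (rule borel_measurable_LIMSEQ_real[OF X_grid_exit_tendsto[OF _ R]])
  fix m
  have "(\<lambda>\<omega>. y + (\<Sum>k<R * Suc m. indicator (alive (k / real (Suc m))) \<omega> *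
      (X (real (Suc k) / real (Suc m)) \<omega> - X (real k / real (Suc m)) \<omega>))) \<in> borel_measurable M"
    by (intro borel_measurable_add borel_measurable_sum borel_measurable_times borel_measurable_indicator
        borel_measurable_const alive_events borel_measurable_diff X_measurable) simp_all
  also have "?this \<longleftrightarrow> (\<lambda>\<omega>. X (grid_exit R m \<omega>) \<omega>) \<in> borel_measurable M"
    by (rule measurable_cong) (use stopped_telescope[OF _ R, of _ "Suc m" "\<lambda>k. X (real k / real (Suc m)) _"] X_0 in simp)
  finally show "(\<lambda>\<omega>. X (grid_exit R m \<omega>) \<omega>) \<in> borel_measurable M" .
qed

section \<open>Dynkin's formula at the truncated exit time\<close>

context
  fixes f f' f'' :: "real \<Rightarrow> real" and D \<alpha> :: real
  assumes d1: "\<And>x. (f has_real_derivative f' x) (at x)"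
    and d2: "\<And>x. (f' has_real_derivative f'' x) (at x)"
    and D: "\<And>x. \<bar>f x\<bar> \<le> D" "\<And>x. \<bar>f' x\<bar> \<le> D" "\<And>x. \<bar>f'' x\<bar> \<le> D"
    and uc: "uniformly_continuous_on UNIV f''"
    and \<alpha>: "0 < \<alpha>"
    and eigen: "\<And>x. \<bar>x - y\<bar> < 1 \<Longrightarrow> b x * f' x + (\<sigma> x)\<^sup>2 / 2 * f'' x = \<alpha> * f x"
begin

lemma f_cont: "continuous_on UNIV f"
  using d1 by (auto simp: continuous_on_eq_continuous_at intro: DERIV_isCont)

lemma f_measurable: "f \<in> borel_measurable borel"
  using f_cont by (rule borel_measurable_continuous_onI)

text \<open>On \<open>alive s\<close> the generator multiplies \<open>f (X s \<omega>)\<close> by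
  \<open>\<alpha>\<close>, so a step multiplies the mean by \<open>1 + \<alpha> * h\<close> up to
  \<open>o(h)\<close>. The discount undoes this, as
  \<open>exp (- \<alpha> * h) * (1 + \<alpha> * h)\<close> differs from 1 by a quantity of order
  \<open>h\<^sup>2\<close>.\<close>

lemma discounted_step:
  assumes e: "e > 0"
  shows "\<forall>\<^sub>F h in at_right 0. \<forall>s\<ge>0. \<bar>expectation (\<lambda>\<omega>. indicator (alive s) \<omega> *
    (exp (- \<alpha> * (s + h)) * f (X (s + h) \<omega>) - exp (- \<alpha> * s) * f (X s \<omega>)))\<bar> \<le> e * h"
proof -
  have D0: "0 \<le> D" using D(1)[of 0] by linarith
  note [measurable] = f_measurable
  have ev1: "\<forall>\<^sub>F h in at_right 0. \<alpha>\<^sup>2 * h * D < e / 2"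
  proof (rule order_tendstoD)
    show "((\<lambda>h. \<alpha>\<^sup>2 * h * D) \<longlongrightarrow> \<alpha>\<^sup>2 * 0 * D) (at_right 0)" by (intro tendsto_intros)
  qed (use e in simp)
  have ev2: "\<forall>\<^sub>F h in at_right 0. \<alpha> * h < 1"
  proof (rule order_tendstoD)
    show "((\<lambda>h. \<alpha> * h) \<longlongrightarrow> \<alpha> * 0) (at_right 0)" by (intro tendsto_intros)
  qed simp
  have e2: "e / 2 > 0" using e by simp
  show ?thesis
    using ev1 ev2 one_step[OF d1 d2 D uc e2] eventually_at_right_less[of "0::real"]
  proof eventually_elim
    case (elim h)
    show ?case
    proof (intro allI impI)
      fix s :: real assume s: "0 \<le> s"
      let ?A = "indicator (alive s) :: 'a \<Rightarrow> real"
      have [measurable]: "X s \<in> borel_measurable M" "X (s + h) \<in> borel_measurable M" "alive s \<in> sets M"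
        using s elim by auto
      have i: "integrable M (\<lambda>\<omega>. ?A \<omega> * f (X s \<omega>))" "integrable M (\<lambda>\<omega>. ?A \<omega> * f (X (s + h) \<omega>))"
        by (rule bounded_integrable[of _ D]; use D D0 in \<open>simp add: indicator_def\<close>)+
      define J where "J = expectation (\<lambda>\<omega>. ?A \<omega> * (f (X (s + h) \<omega>) - f (X s \<omega>) - h * (\<alpha> * f (X s \<omega>))))"
      have "J = expectation (\<lambda>\<omega>. ?A \<omega> * (f (X (s + h) \<omega>) - f (X s \<omega>) -
          h * (b (X s \<omega>) * f' (X s \<omega>) + (\<sigma> (X s \<omega>))\<^sup>2 / 2 * f'' (X s \<omega>))))"
        unfolding J_def
      proof (rule Bochner_Integration.integral_cong[OF refl])
        fix \<omega> assume \<omega>: "\<omega> \<in> space M"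
        show "?A \<omega> * (f (X (s + h) \<omega>) - f (X s \<omega>) - h * (\<alpha> * f (X s \<omega>))) =
          ?A \<omega> * (f (X (s + h) \<omega>) - f (X s \<omega>) -
          h * (b (X s \<omega>) * f' (X s \<omega>) + (\<sigma> (X s \<omega>))\<^sup>2 / 2 * f'' (X s \<omega>)))"
          using alive_iff[OF \<omega> s] s eigen[of "X s \<omega>"] by (cases "\<omega> \<in> alive s") auto
      qed
      then have J: "\<bar>J\<bar> \<le> e / 2 * h" using elim s alive_sets[OF s] by simp
      have eq: "expectation (\<lambda>\<omega>. ?A \<omega> * (exp (- \<alpha> * (s + h)) * f (X (s + h) \<omega>) - exp (- \<alpha> * s) * f (X s \<omega>)))
        = exp (- \<alpha> * (s + h)) * J + (exp (- \<alpha> * (s + h)) * (1 + \<alpha> * h) - exp (- \<alpha> * s)) * expectation (\<lambda>\<omega>. ?A \<omega> * f (X s \<omega>))"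
      proof -
        have "J = expectation (\<lambda>\<omega>. ?A \<omega> * f (X (s + h) \<omega>)) - (1 + \<alpha> * h) * expectation (\<lambda>\<omega>. ?A \<omega> * f (X s \<omega>))"
        proof -
          have "(\<lambda>\<omega>. ?A \<omega> * (f (X (s + h) \<omega>) - f (X s \<omega>) - h * (\<alpha> * f (X s \<omega>)))) =
            (\<lambda>\<omega>. ?A \<omega> * f (X (s + h) \<omega>) - (1 + \<alpha> * h) * (?A \<omega> * f (X s \<omega>)))" by (auto simp: algebra_simps)
          then show ?thesis unfolding J_def using i by simp
        qed
        moreover have "(\<lambda>\<omega>. ?A \<omega> * (exp (- \<alpha> * (s + h)) * f (X (s + h) \<omega>) - exp (- \<alpha> * s) * f (X s \<omega>))) =
          (\<lambda>\<omega>. exp (- \<alpha> * (s + h)) * (?A \<omega> * f (X (s + h) \<omega>)) - exp (- \<alpha> * s) * (?A \<omega> * f (X s \<omega>)))"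
          by (auto simp: algebra_simps)
        ultimately have J: "J = expectation (\<lambda>\<omega>. ?A \<omega> * f (X (s + h) \<omega>)) - (1 + \<alpha> * h) * expectation (\<lambda>\<omega>. ?A \<omega> * f (X s \<omega>))"
          and "expectation (\<lambda>\<omega>. ?A \<omega> * (exp (- \<alpha> * (s + h)) * f (X (s + h) \<omega>) - exp (- \<alpha> * s) * f (X s \<omega>))) =
            exp (- \<alpha> * (s + h)) * expectation (\<lambda>\<omega>. ?A \<omega> * f (X (s + h) \<omega>)) - exp (- \<alpha> * s) * expectation (\<lambda>\<omega>. ?A \<omega> * f (X s \<omega>))"
          using i by simp_all
        then show ?thesis by (simp only: right_diff_distrib left_diff_distrib mult.assoc)
      qed
      have Ef: "\<bar>expectation (\<lambda>\<omega>. ?A \<omega> * f (X s \<omega>))\<bar> \<le> D"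
      proof -
        have "\<bar>expectation (\<lambda>\<omega>. ?A \<omega> * f (X s \<omega>))\<bar> \<le> expectation (\<lambda>\<omega>. D)"
          by (rule order_trans[OF integral_abs_bound integral_mono[OF integrable_abs[OF i(1)]]])
             (use D D0 in \<open>simp_all add: indicator_def\<close>)
        then show ?thesis by (simp add: prob_space)
      qed
      \<comment> \<open>Uses \<open>exp x \<le> 1 + x + x\<^sup>2\<close> for
        \<open>0 \<le> x \<le> 1\<close>; the eventuality \<open>ev2\<close> provides the upper
        limit.\<close>
      have ex: "\<bar>exp (- \<alpha> * (s + h)) * (1 + \<alpha> * h) - exp (- \<alpha> * s)\<bar> \<le> \<alpha>\<^sup>2 * h\<^sup>2"
      proof -
        have ah: "0 \<le> \<alpha> * h" "\<alpha> * h \<le> 1" using \<alpha> elim by auto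
        have "exp (- \<alpha> * s) = exp (- \<alpha> * (s + h)) * exp (\<alpha> * h)"
          by (simp add: exp_add[symmetric] algebra_simps)
        then have "\<bar>exp (- \<alpha> * (s + h)) * (1 + \<alpha> * h) - exp (- \<alpha> * s)\<bar> =
            exp (- \<alpha> * (s + h)) * \<bar>1 + \<alpha> * h - exp (\<alpha> * h)\<bar>"
          by (simp add: right_diff_distrib[symmetric] abs_mult)
        also have "\<dots> \<le> 1 * (\<alpha> * h)\<^sup>2"
          using exp_bound[OF ah] exp_ge_add_one_self[of "\<alpha> * h"] \<alpha> s elim by (intro mult_mono) auto
        finally show ?thesis by (simp add: power_mult_distrib)
      qed
      have t1: "\<bar>exp (- \<alpha> * (s + h)) * J\<bar> \<le> 1 * (e / 2 * h)"
        unfolding abs_mult using J \<alpha> s elim by (intro mult_mono) auto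
      have t2: "\<bar>(exp (- \<alpha> * (s + h)) * (1 + \<alpha> * h) - exp (- \<alpha> * s)) * expectation (\<lambda>\<omega>. ?A \<omega> * f (X s \<omega>))\<bar>
        \<le> \<alpha>\<^sup>2 * h\<^sup>2 * D"
        unfolding abs_mult using ex Ef by (intro mult_mono) auto
      have t3: "\<alpha>\<^sup>2 * h\<^sup>2 * D \<le> e / 2 * h"
      proof -
        have "\<alpha>\<^sup>2 * h\<^sup>2 * D = (\<alpha>\<^sup>2 * h * D) * h" by (simp add: power2_eq_square)
        also have "\<dots> \<le> e / 2 * h" using elim by (intro mult_right_mono) auto
        finally show ?thesis .
      qed
      have t4: "e * h = 1 * (e / 2 * h) + e / 2 * h" by simp
      have tri: "\<bar>a + a'\<bar> \<le> z" if "\<bar>a\<bar> \<le> c" "\<bar>a'\<bar> \<le> c'" "c' \<le> w" "z = c + w" for a a' c c' w z :: real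
        using that by linarith
      show "\<bar>expectation (\<lambda>\<omega>. ?A \<omega> * (exp (- \<alpha> * (s + h)) * f (X (s + h) \<omega>) - exp (- \<alpha> * s) * f (X s \<omega>)))\<bar> \<le> e * h"
        unfolding eq by (rule tri[OF t1 t2 t3 t4])
    qed
  qed
qed

text \<open>The telescoped sum \<open>S m\<close> is evaluated twice: its mean tends to zero by
  adding up the step errors, while path by path it tends to the discounted value at the truncated
  exit time minus \<open>f y\<close>.\<close>

lemma dynkin_truncated:
  assumes R: "0 < (R::nat)"
  shows "expectation (\<lambda>\<omega>. exp (- \<alpha> * trunc_exit R \<omega>) * f (X (trunc_exit R \<omega>) \<omega>)) = f y"
proof -
  note [measurable] = f_measurable
  define G where "G t \<omega> = exp (- \<alpha> * t) * f (X t \<omega>)" for t \<omega>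
  have Gm [measurable]: "G t \<in> borel_measurable M" if "0 \<le> t" for t
    unfolding G_def[abs_def] using that by measurable
  have Gb: "\<bar>G t \<omega>\<bar> \<le> D" if "0 \<le> t" for t \<omega>
    unfolding G_def abs_mult using D(1)[of "X t \<omega>"] \<alpha> that mult_mono[of "\<bar>exp (- \<alpha> * t)\<bar>" 1 "\<bar>f (X t \<omega>)\<bar>" D] by simp
  have D0: "0 \<le> D" using D(1)[of 0] by linarith
  have GG: "\<bar>G t \<omega> - G t' \<omega>\<bar> \<le> D + D" "\<bar>G t \<omega> - f y\<bar> \<le> D + D" if "0 \<le> t" "0 \<le> t'" for t t' \<omega>
    using Gb[OF that(1), of \<omega>] Gb[OF that(2), of \<omega>] D(1)[of y] by linarith+
  define S where "S m \<omega> = (\<Sum>k<R * Suc m. indicator (alive (k / real (Suc m))) \<omega> *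
      (G (real (Suc k) / real (Suc m)) \<omega> - G (real k / real (Suc m)) \<omega>))" for m \<omega>
  have S: "S m \<omega> = G (grid_exit R m \<omega>) \<omega> - f y" if "\<omega> \<in> space M" for m \<omega>
    unfolding S_def
    using stopped_telescope[OF that R, of "Suc m" "\<lambda>k. G (real k / real (Suc m)) \<omega>"] X_0[OF that]
    by (simp add: G_def)
  have iG: "integrable M (\<lambda>\<omega>. indicator (alive (k / real (Suc m))) \<omega> *
      (G (real (Suc k) / real (Suc m)) \<omega> - G (real k / real (Suc m)) \<omega>))" for k m :: nat
    by (rule bounded_integrable[of _ "D + D"])
       (use GG D0 in \<open>auto simp: indicator_def simp del: of_nat_Suc\<close>)
  have "(\<lambda>m. expectation (S m)) \<longlonglongrightarrow> 0"
  proof (rule LIMSEQ_I)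
    fix r :: real assume r: "r > 0"
    \<comment> \<open>There are \<open>R * Suc m\<close> steps with error at most
      \<open>e / Suc m\<close> each, so the total is at most \<open>R * e = r / 2\<close>.\<close>
    define e where "e = r / (2 * R)"
    have e: "e > 0" using r R by (simp add: e_def)
    have "filterlim (\<lambda>m. 1 / real (Suc m)) (at_right 0) sequentially"
      using LIMSEQ_Suc[OF lim_const_over_n[of "1::real"]]
      by (intro filterlim_at_withinI) (auto simp del: of_nat_Suc)
    from eventually_compose_filterlim[OF discounted_step[OF e] this]
    obtain N where N: "\<And>m s. m \<ge> N \<Longrightarrow> s \<ge> 0 \<Longrightarrow> \<bar>expectation (\<lambda>\<omega>. indicator (alive s) \<omega> *
    (G (s + 1 / real (Suc m)) \<omega> - G s \<omega>))\<bar> \<le> e * (1 / real (Suc m))"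
      unfolding G_def eventually_sequentially by auto
    have "\<bar>expectation (S m)\<bar> < r" if "m \<ge> N" for m
    proof -
      have "expectation (S m) = (\<Sum>k<R * Suc m. expectation (\<lambda>\<omega>. indicator (alive (k / real (Suc m))) \<omega> *
      (G (real (Suc k) / real (Suc m)) \<omega> - G (real k / real (Suc m)) \<omega>)))"
        unfolding S_def[abs_def] using iG by (intro Bochner_Integration.integral_sum)
      also have "\<bar>\<dots>\<bar> \<le> (\<Sum>k<R * Suc m. e * (1 / real (Suc m)))"
      proof (rule order_trans[OF sum_abs sum_mono])
        fix k :: nat
        have "real (Suc k) / real (Suc m) = k / real (Suc m) + 1 / real (Suc m)" by (simp add: add_divide_distrib)
        then show "\<bar>expectation (\<lambda>\<omega>. indicator (alive (k / real (Suc m))) \<omega> *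
            (G (real (Suc k) / real (Suc m)) \<omega> - G (real k / real (Suc m)) \<omega>))\<bar> \<le> e * (1 / real (Suc m))"
          using N[OF that, of "k / real (Suc m)"] by simp
      qed
      also have "\<dots> = real R * e" by (simp del: of_nat_Suc mult_Suc_right)
      also have "\<dots> < r" using r R by (simp add: e_def)
      finally show ?thesis .
    qed
    then show "\<exists>N. \<forall>m\<ge>N. norm (expectation (S m) - 0) < r" by auto
  qed
  moreover have "(\<lambda>m. expectation (S m)) \<longlonglongrightarrow> expectation (\<lambda>\<omega>. G (trunc_exit R \<omega>) \<omega> - f y)"
  proof (rule integral_dominated_convergence[where w="\<lambda>_. D + D"])
    show "S m \<in> borel_measurable M" for m unfolding S_def[abs_def]
      using iG by (intro borel_measurable_sum) (rule borel_measurable_integrable)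
    show "(\<lambda>\<omega>. G (trunc_exit R \<omega>) \<omega> - f y) \<in> borel_measurable M"
      unfolding G_def using R by measurable
    show "AE \<omega> in M. (\<lambda>m. S m \<omega>) \<longlonglongrightarrow> G (trunc_exit R \<omega>) \<omega> - f y"
    proof (rule AE_I2)
      fix \<omega> assume \<omega>: "\<omega> \<in> space M"
      have "(\<lambda>m. f (X (grid_exit R m \<omega>) \<omega>)) \<longlonglongrightarrow> f (X (trunc_exit R \<omega>) \<omega>)"
        by (rule continuous_on_tendsto_compose[OF f_cont X_grid_exit_tendsto[OF \<omega> R]]) auto
      then show "(\<lambda>m. S m \<omega>) \<longlonglongrightarrow> G (trunc_exit R \<omega>) \<omega> - f y"
        unfolding S[OF \<omega>] G_def by (intro tendsto_intros grid_exit_tendsto[OF \<omega> R])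
    qed
    show "AE \<omega> in M. norm (S m \<omega>) \<le> D + D" for m
      by (rule AE_I2) (simp only: S real_norm_def, rule GG(2); rule divide_nonneg_nonneg of_nat_0_le_iff; rule of_nat_0_le_iff)
  qed auto
  ultimately have "expectation (\<lambda>\<omega>. G (trunc_exit R \<omega>) \<omega> - f y) = 0" by (rule LIMSEQ_unique[rotated])
  moreover have "integrable M (\<lambda>\<omega>. G (trunc_exit R \<omega>) \<omega>)"
  proof (rule bounded_integrable)
    show "(\<lambda>\<omega>. G (trunc_exit R \<omega>) \<omega>) \<in> borel_measurable M" unfolding G_def using R by measurable
    show "\<bar>G (trunc_exit R \<omega>) \<omega>\<bar> \<le> D" if "\<omega> \<in> space M" for \<omega>
      using trunc_exit_bounds[OF that, of R] R by (intro Gb) auto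
  qed
  ultimately have "expectation (\<lambda>\<omega>. G (trunc_exit R \<omega>) \<omega>) = f y" by (simp add: prob_space)
  then show ?thesis by (simp add: G_def)
qed

end

text \<open>The variable \<open>exp (- T)\<close> with \<open>exp (- \<infinity>)\<close> read as 0.
  Its powers are the discount factors at integer rates, and with this convention
  \<open>T \<le> u\<close> is the condition \<open>exp (- u) \<le> exit_discount \<omega>\<close>
  for infinite \<open>T\<close> as well.\<close>

definition exit_discount :: "'a \<Rightarrow> real" where
  "exit_discount \<omega> = (if exit_time \<omega> = \<infinity> then 0 else exp (- real_of_ereal (exit_time \<omega>)))"

definition exit_at :: "real \<Rightarrow> 'a set" where
  "exit_at d = {\<omega> \<in> space M. \<exists>r. exit_time \<omega> = ereal r \<and> X r \<omega> = y + d}"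

text \<open>A countable union over horizons: if the path is no longer alive at \<open>Suc R\<close>,
  the truncated exit time is the true one and the position there is measurable. The successor keeps
  the horizon positive.\<close>

lemma exit_at_event [measurable]: "exit_at d \<in> sets M"
proof -
  have "exit_at d = (\<Union>R::nat. (space M - alive (Suc R)) \<inter> {\<omega> \<in> space M. X (trunc_exit (real (Suc R)) \<omega>) \<omega> = y + d})"
  proof (intro set_eqI iffI)
    fix \<omega> assume "\<omega> \<in> exit_at d"
    then obtain r where r: "\<omega> \<in> space M" "exit_time \<omega> = ereal r" "X r \<omega> = y + d" by (auto simp: exit_at_def)
    obtain R :: nat where "r \<le> R" using real_arch_simple by blast
    then have "r \<le> real (Suc R)" by simp
    with r trunc_exit_eq[OF r(2) this]
    show "\<omega> \<in> (\<Union>R::nat. (space M - alive (Suc R)) \<inter> {\<omega> \<in> space M. X (trunc_exit (real (Suc R)) \<omega>) \<omega> = y + d})"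
      by (intro UN_I[of R]) (auto simp: alive_def)
  next
    fix \<omega> assume "\<omega> \<in> (\<Union>R::nat. (space M - alive (Suc R)) \<inter> {\<omega> \<in> space M. X (trunc_exit (real (Suc R)) \<omega>) \<omega> = y + d})"
    then obtain R :: nat where R: "\<omega> \<in> space M" "\<not> ereal (Suc R) < exit_time \<omega>" "X (trunc_exit (real (Suc R)) \<omega>) \<omega> = y + d"
      by (auto simp: alive_def)
    then obtain r where r: "exit_time \<omega> = ereal r" "r \<le> Suc R"
      using exit_time_pos[OF R(1)] by (cases "exit_time \<omega>") auto
    with R trunc_exit_eq[OF r] show "\<omega> \<in> exit_at d" by (auto simp: exit_at_def)
  qed
  moreover have "(space M - alive (Suc R)) \<inter> {\<omega> \<in> space M. X (trunc_exit (real (Suc R)) \<omega>) \<omega> = y + d} \<in> sets M" for R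
  proof -
    have [measurable]: "(\<lambda>\<omega>. X (trunc_exit (real (Suc R)) \<omega>) \<omega>) \<in> borel_measurable M"
      by (rule X_trunc_exit_measurable) simp
    have [measurable]: "alive (real (Suc R)) \<in> sets M" by (rule alive_events) simp
    show ?thesis by measurable
  qed
  ultimately show ?thesis by (simp only: sets.countable_UN subset_iff image_iff) (rule sets.countable_UN, blast)
qed

lemma exit_finite_cases:
  assumes "\<omega> \<in> space M" "exit_time \<omega> = ereal r"
  shows "X r \<omega> = y + 1 \<or> X r \<omega> = y - 1"
  using cyc_time_Suc_attained(2)[OF X_cont[OF assms(1)], of 0 0 r] assms X_0[OF assms(1)]
  by (auto simp: exit_time_def zero_ereal_def abs_if split: if_splits)

lemma exit_discount_tendsto:
  assumes "\<omega> \<in> space M"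
  shows "(\<lambda>R. exp (- trunc_exit (real (Suc R)) \<omega>)) \<longlonglongrightarrow> exit_discount \<omega>"
proof (cases "exit_time \<omega> = \<infinity>")
  case True
  have "filterlim (\<lambda>R. real (Suc R)) at_top sequentially"
    using filterlim_compose[OF filterlim_real_sequentially filterlim_Suc] .
  then have "(\<lambda>R. exp (- real (Suc R))) \<longlonglongrightarrow> 0"
    by (intro filterlim_compose[OF exp_at_bot] filterlim_compose[OF filterlim_uminus_at_bot_at_top])
  then show ?thesis using True by (simp add: exit_discount_def trunc_exit_eq_R)
next
  case False
  then obtain r where r: "exit_time \<omega> = ereal r" using exit_time_pos[OF assms] by (cases "exit_time \<omega>") auto
  obtain N :: nat where "r \<le> N" using real_arch_simple by blast
  then have "\<forall>\<^sub>F R in sequentially. exp (- trunc_exit (real (Suc R)) \<omega>) = exit_discount \<omega>"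
    unfolding eventually_sequentially
    using trunc_exit_eq[OF r] r by (intro exI[of _ N]) (auto simp: exit_discount_def)
  then show ?thesis by (rule tendsto_eventually)
qed

lemma exit_discount_measurable [measurable]: "exit_discount \<in> borel_measurable M"
proof (rule borel_measurable_LIMSEQ_real[OF exit_discount_tendsto])
  fix R
  have [measurable]: "trunc_exit (real (Suc R)) \<in> borel_measurable M" by (rule trunc_exit_measurable) simp
  show "(\<lambda>\<omega>. exp (- trunc_exit (real (Suc R)) \<omega>)) \<in> borel_measurable M" by measurable
qed

lemma exit_discount_bounds: "0 \<le> exit_discount \<omega>" "\<omega> \<in> space M \<Longrightarrow> exit_discount \<omega> \<le> 1"
  using exit_time_pos[of \<omega>] by (cases "exit_time \<omega>"; auto simp: exit_discount_def)+

text \<open>Dynkin's formula as the horizon tends to infinity. On a path that exits, the integrand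
  is eventually constant in \<open>R\<close>; on one that does not, \<open>X\<close> need not
  converge, but \<open>f\<close> is bounded and the discount tends to zero.\<close>

lemma exit_laplace:
  fixes f f' f'' :: "real \<Rightarrow> real" and n :: nat
  assumes d1: "\<And>x. (f has_real_derivative f' x) (at x)"
    and d2: "\<And>x. (f' has_real_derivative f'' x) (at x)"
    and D: "\<And>x. \<bar>f x\<bar> \<le> D" "\<And>x. \<bar>f' x\<bar> \<le> D" "\<And>x. \<bar>f'' x\<bar> \<le> D"
    and uc: "uniformly_continuous_on UNIV f''"
    and n: "0 < n"
    and eigen: "\<And>x. \<bar>x - y\<bar> < 1 \<Longrightarrow> b x * f' x + (\<sigma> x)\<^sup>2 / 2 * f'' x = real n * f x"
  shows "f y = f (y + 1) * expectation (\<lambda>\<omega>. exit_discount \<omega> ^ n * indicator (exit_at 1) \<omega>)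
    + f (y - 1) * expectation (\<lambda>\<omega>. exit_discount \<omega> ^ n * indicator (exit_at (-1)) \<omega>)"
proof -
  have rn: "0 < real n" using n by simp
  note dyn = dynkin_truncated[OF d1 d2 D uc rn eigen]
  note [measurable] = f_measurable[OF d1 d2 D uc rn eigen]
  have D0: "0 \<le> D" using D(1)[of 0] by linarith
  let ?L = "\<lambda>\<omega>. exit_discount \<omega> ^ n * (indicator (exit_at 1) \<omega> * f (y + 1) + indicator (exit_at (-1)) \<omega> * f (y - 1))"
  have "(\<lambda>R. expectation (\<lambda>\<omega>. exp (- real n * trunc_exit (Suc R) \<omega>) * f (X (trunc_exit (Suc R) \<omega>) \<omega>))) \<longlonglongrightarrow> expectation ?L"
  proof (rule integral_dominated_convergence[where w="\<lambda>_. D"])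
    show "AE \<omega> in M. (\<lambda>R. exp (- real n * trunc_exit (Suc R) \<omega>) * f (X (trunc_exit (Suc R) \<omega>) \<omega>)) \<longlonglongrightarrow> ?L \<omega>"
    proof (rule AE_I2)
      fix \<omega> assume \<omega>: "\<omega> \<in> space M"
      have pw: "exp (- real n * x) = exp (- x) ^ n" for x :: real
        using exp_of_nat_mult[of n "- x"] by simp
      show "(\<lambda>R. exp (- real n * trunc_exit (Suc R) \<omega>) * f (X (trunc_exit (Suc R) \<omega>) \<omega>)) \<longlonglongrightarrow> ?L \<omega>"
      proof (cases "exit_time \<omega> = \<infinity>")
        case True
        then have e0: "exit_discount \<omega> = 0" by (simp add: exit_discount_def)
        have lim: "(\<lambda>R. exp (- trunc_exit (Suc R) \<omega>) ^ n) \<longlonglongrightarrow> 0"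
          using tendsto_power[OF exit_discount_tendsto[OF \<omega>], of n] unfolding e0 zero_power[OF n] .
        have "(\<lambda>R. exp (- real n * trunc_exit (Suc R) \<omega>) * f (X (trunc_exit (Suc R) \<omega>) \<omega>)) \<longlonglongrightarrow> 0"
        proof (rule Lim_null_comparison)
          show "(\<lambda>R. exp (- trunc_exit (Suc R) \<omega>) ^ n * D) \<longlonglongrightarrow> 0" by (rule tendsto_mult_left_zero[OF lim])
          show "\<forall>\<^sub>F R in sequentially. norm (exp (- real n * trunc_exit (Suc R) \<omega>) * f (X (trunc_exit (Suc R) \<omega>) \<omega>))
              \<le> exp (- trunc_exit (Suc R) \<omega>) ^ n * D"
            unfolding real_norm_def abs_mult pw
            by (intro always_eventually allI mult_mono) (auto simp: power_abs D)
        qed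
        then show ?thesis unfolding e0 zero_power[OF n] by simp
      next
        case False
        then obtain r where r: "exit_time \<omega> = ereal r" using exit_time_pos[OF \<omega>] by (cases "exit_time \<omega>") auto
        obtain N :: nat where N: "r \<le> N" using real_arch_simple by blast
        have "exp (- real n * trunc_exit (Suc R) \<omega>) * f (X (trunc_exit (Suc R) \<omega>) \<omega>) = ?L \<omega>" if "R \<ge> N" for R
        proof -
          have t: "trunc_exit (Suc R) \<omega> = r" using trunc_exit_eq[OF r, of "Suc R"] N that by simp
          have ed: "exit_discount \<omega> = exp (- r)" using r by (simp add: exit_discount_def)
          have "indicator (exit_at 1) \<omega> * f (y + 1) + indicator (exit_at (-1)) \<omega> * f (y - 1) = f (X r \<omega>)"
            using exit_finite_cases[OF \<omega> r] \<omega> r by (auto simp: indicator_def exit_at_def)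
          then show ?thesis unfolding t ed pw by simp
        qed
        then have "\<forall>\<^sub>F R in sequentially. exp (- real n * trunc_exit (Suc R) \<omega>) * f (X (trunc_exit (Suc R) \<omega>) \<omega>) = ?L \<omega>"
          unfolding eventually_sequentially by blast
        then show ?thesis by (rule tendsto_eventually)
      qed
    qed
    show "AE \<omega> in M. norm (exp (- real n * trunc_exit (Suc R) \<omega>) * f (X (trunc_exit (Suc R) \<omega>) \<omega>)) \<le> D" for R
    proof (rule AE_I2)
      fix \<omega> assume "\<omega> \<in> space M"
      then have "0 \<le> trunc_exit (Suc R) \<omega>" using trunc_exit_bounds[of \<omega> "Suc R"] by simp
      then show "norm (exp (- real n * trunc_exit (Suc R) \<omega>) * f (X (trunc_exit (Suc R) \<omega>) \<omega>)) \<le> D"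
        using D(1)[of "X (trunc_exit (Suc R) \<omega>) \<omega>"] mult_mono[of "exp (- real n * trunc_exit (Suc R) \<omega>)" 1 "\<bar>f (X (trunc_exit (Suc R) \<omega>) \<omega>)\<bar>" D]
        by (simp add: abs_mult)
    qed
    show "(\<lambda>\<omega>. exp (- real n * trunc_exit (Suc R) \<omega>) * f (X (trunc_exit (Suc R) \<omega>) \<omega>)) \<in> borel_measurable M" for R
      by measurable
  qed auto
  moreover have "expectation (\<lambda>\<omega>. exp (- real n * trunc_exit (Suc R) \<omega>) * f (X (trunc_exit (Suc R) \<omega>) \<omega>)) = f y" for R
    by (rule dyn) auto
  ultimately have "expectation ?L = f y" by (simp add: LIMSEQ_const_iff)
  moreover have "expectation ?L = f (y + 1) * expectation (\<lambda>\<omega>. exit_discount \<omega> ^ n * indicator (exit_at 1) \<omega>)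
    + f (y - 1) * expectation (\<lambda>\<omega>. exit_discount \<omega> ^ n * indicator (exit_at (-1)) \<omega>)"
  proof -
    have i: "integrable M (\<lambda>\<omega>. exit_discount \<omega> ^ n * indicator (exit_at d) \<omega>)" for d
      by (rule bounded_integrable[of _ 1])
         (auto simp: abs_mult exit_discount_bounds indicator_def power_le_one)
    have "?L = (\<lambda>\<omega>. f (y + 1) * (exit_discount \<omega> ^ n * indicator (exit_at 1) \<omega>) +
        f (y - 1) * (exit_discount \<omega> ^ n * indicator (exit_at (-1)) \<omega>))" by (auto simp: algebra_simps)
    then show ?thesis using i by simp
  qed
  ultimately show ?thesis by simp
qed

end

section \<open>Linear equations and smooth truncation\<close>

lemma antiderivative_exists:
  fixes f :: "real \<Rightarrow> real"
  assumes f: "continuous_on UNIV f"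
  shows "\<exists>g. (\<forall>x. (g has_real_derivative f x) (at x)) \<and> g y = 0"
proof -
  define g where "g x = (LBINT z=y..x. f z)" for x
  have "(g has_real_derivative f x) (at x)" for x
  proof -
    define a b where "a = min x y - 1" and "b = max x y + 1"
    have "((\<lambda>u. LBINT z=y..u. f z) has_vector_derivative f x) (at x within {a..b})"
      by (rule interval_integral_FTC2) (auto simp: a_def b_def intro: continuous_on_subset[OF f])
    then have "(g has_vector_derivative f x) (at x within {a..b})" by (simp add: g_def[abs_def])
    moreover have "at x within {a..b} = at x" by (rule at_within_interior) (auto simp: a_def b_def)
    ultimately show ?thesis by (simp add: has_real_derivative_iff_has_vector_derivative)
  qed
  moreover have "g y = 0" by (simp add: g_def)
  ultimately show ?thesis by blast
qed

text \<open>An integral estimate without integrals, for both sides of \<open>y\<close> at once: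
  along the segment from \<open>y\<close> to \<open>x\<close> the functions \<open>H + g\<close> and
  \<open>H - g\<close> are nondecreasing and start at zero.\<close>

lemma derivative_comparison:
  fixes g f H h :: "real \<Rightarrow> real"
  assumes g: "\<And>x. (g has_real_derivative f x) (at x)" "g y = 0"
    and H: "\<And>t. (H has_real_derivative h t) (at t)" "H 0 = 0"
    and le: "\<And>x. \<bar>x - y\<bar> \<le> r \<Longrightarrow> \<bar>f x\<bar> \<le> h \<bar>x - y\<bar>"
    and x: "\<bar>x - y\<bar> \<le> r"
  shows "\<bar>g x\<bar> \<le> H \<bar>x - y\<bar>"
proof -
  define e where "e = (if x \<ge> y then 1 else -1 :: real)"
  have e: "\<bar>e\<bar> = 1" "x = y + e * \<bar>x - y\<bar>" by (auto simp: e_def)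
  have d: "((\<lambda>t. g (y + e * t)) has_real_derivative f (y + e * t) * e) (at t)" for t
    by (rule DERIV_chain2[OF g(1)]) (auto intro!: derivative_eq_intros)
  have l: "\<bar>f (y + e * t) * e\<bar> \<le> h t" if "0 \<le> t" "t \<le> \<bar>x - y\<bar>" for t
    using le[of "y + e * t"] that x e(1) by (simp add: abs_mult)
  have *: "0 \<le> H \<bar>x - y\<bar> + q * g x" if q: "\<bar>q\<bar> = 1" for q
  proof -
    define \<phi> where "\<phi> t = H t + q * g (y + e * t)" for t
    have "\<phi> 0 \<le> \<phi> \<bar>x - y\<bar>"
    proof (rule DERIV_nonneg_imp_nondecreasing[of 0 "\<bar>x - y\<bar>" \<phi>])
      fix t assume t: "0 \<le> t" "t \<le> \<bar>x - y\<bar>"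
      have "(\<phi> has_real_derivative h t + q * (f (y + e * t) * e)) (at t)"
        unfolding \<phi>_def[abs_def] by (rule DERIV_add[OF H(1) DERIV_cmult[OF d]])
      moreover have "\<bar>q * (f (y + e * t) * e)\<bar> \<le> h t" using l[OF t] q by (simp add: abs_mult)
      ultimately show "\<exists>l. (\<phi> has_real_derivative l) (at t) \<and> 0 \<le> l" by force
    qed simp
    then show ?thesis using g(2) H(2) e(2) by (simp add: \<phi>_def)
  qed
  show ?thesis using *[of 1] *[of "-1"] by simp
qed

text \<open>Picard iteration as a series of corrections \<open>us k\<close>, \<open>ps k\<close>.
  They are bounded by \<open>C * (L * r) ^ k / fact k\<close> on \<open>[y - r, y + r]\<close>, so
  the differentiated series converges uniformly there by the Weierstrass test. By linearity the
  bound works for every \<open>r\<close>, which gives solutions on the whole line.\<close>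

lemma linear_system_exists:
  fixes s m :: "real \<Rightarrow> real"
  assumes s: "continuous_on UNIV s" and m: "continuous_on UNIV m"
  obtains u p where "\<And>x. (u has_real_derivative s x * p x) (at x)"
    "\<And>x. (p has_real_derivative m x * u x) (at x)" "u y = a" "p y = c"
proof -
  \<comment> \<open>The antiderivative that vanishes at \<open>y\<close>: all corrections vanish
    there, and the term of index 0 carries the initial values.\<close>
  define I where "I f = (SOME g. (\<forall>x. (g has_real_derivative f x) (at x)) \<and> g y = 0)" for f :: "real \<Rightarrow> real"
  have I: "(I f has_real_derivative f x) (at x)" "I f y = 0" if "continuous_on UNIV f" for f x
    using someI_ex[OF antiderivative_exists[OF that, of y]] unfolding I_def by blast+
  define it where "it = rec_nat (\<lambda>_::real. a, \<lambda>_::real. c) (\<lambda>k v. (I (\<lambda>z. s z * snd v z), I (\<lambda>z. m z * fst v z)))"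
  define us ps where "us k = fst (it k)" and "ps k = snd (it k)" for k
  have it0: "us 0 = (\<lambda>_. a)" "ps 0 = (\<lambda>_. c)" by (simp_all add: us_def ps_def it_def)
  have itS: "us (Suc k) = I (\<lambda>z. s z * ps k z)" "ps (Suc k) = I (\<lambda>z. m z * us k z)" for k
    by (simp_all add: us_def ps_def it_def)
  have cont: "continuous_on UNIV (us k) \<and> continuous_on UNIV (ps k)" for k
  proof (induction k)
    case 0 then show ?case by (simp add: it0)
  next
    case (Suc k)
    then have "continuous_on UNIV (\<lambda>z. s z * ps k z)" "continuous_on UNIV (\<lambda>z. m z * us k z)"
      using s m by (auto intro: continuous_on_mult)
    from I(1)[OF this(1)] I(1)[OF this(2)] show ?case
      by (auto simp: itS continuous_on_eq_continuous_at intro: DERIV_isCont)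
  qed
  then have csp: "continuous_on UNIV (\<lambda>z. s z * ps k z)" "continuous_on UNIV (\<lambda>z. m z * us k z)" for k
    using s m by (auto intro: continuous_on_mult)
  \<comment> \<open>Derivatives of the corrections. Differentiation lowers the index by one, and the
    constant term of index 0 contributes 0.\<close>
  define us' ps' where "us' k x = (case k of 0 \<Rightarrow> 0 | Suc j \<Rightarrow> s x * ps j x)"
    and "ps' k x = (case k of 0 \<Rightarrow> 0 | Suc j \<Rightarrow> m x * us j x)" for k x
  have du: "(us k has_real_derivative us' k x) (at x)" and dp: "(ps k has_real_derivative ps' k x) (at x)" for k x
    using I(1)[OF csp(1)] I(1)[OF csp(2)] by (cases k; simp add: it0 itS us'_def ps'_def)+
  have y0: "us (Suc k) y = 0" "ps (Suc k) y = 0" for k using I(2) csp by (simp_all add: itS)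
  have main: "summable (\<lambda>k. us k x) \<and> summable (\<lambda>k. ps k x) \<and>
    ((\<lambda>x. \<Sum>k. us k x) has_real_derivative (\<Sum>k. us' k x)) (at x) \<and>
    ((\<lambda>x. \<Sum>k. ps k x) has_real_derivative (\<Sum>k. ps' k x)) (at x)" for x
  proof -
    \<comment> \<open>The added 1 places \<open>x\<close> in the interior of the interval on which
      the series is differentiated.\<close>
    define r where "r = \<bar>x - y\<bar> + 1"
    have r: "r > 0" by (simp add: r_def)
    let ?S = "{y - r..y + r}"
    have "compact (s ` ?S)" "compact (m ` ?S)"
      using s m by (auto intro!: compact_continuous_image intro: continuous_on_subset)
    then have "bounded (s ` ?S)" "bounded (m ` ?S)" by (auto intro: compact_imp_bounded)
    then obtain L1 L2 where L12: "\<And>z. z \<in> ?S \<Longrightarrow> \<bar>s z\<bar> \<le> L1" "\<And>z. z \<in> ?S \<Longrightarrow> \<bar>m z\<bar> \<le> L2"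
      unfolding bounded_iff by fastforce
    define L where "L = max L1 L2"
    have L: "\<bar>s z\<bar> \<le> L" "\<bar>m z\<bar> \<le> L" if "\<bar>z - y\<bar> \<le> r" for z
    proof -
      have "z \<in> ?S" using that by auto
      from L12(1)[OF this] L12(2)[OF this] show "\<bar>s z\<bar> \<le> L" "\<bar>m z\<bar> \<le> L" by (auto simp: L_def)
    qed
    have L0: "0 \<le> L" using L(1)[of y] r by simp
    define C where "C = max \<bar>a\<bar> \<bar>c\<bar>"
    have C0: "0 \<le> C" by (simp add: C_def)
    have bd: "\<forall>z. \<bar>z - y\<bar> \<le> r \<longrightarrow> \<bar>us k z\<bar> \<le> C * (L * \<bar>z - y\<bar>) ^ k / fact k \<and> \<bar>ps k z\<bar> \<le> C * (L * \<bar>z - y\<bar>) ^ k / fact k" for k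
    proof (induction k)
      case 0 then show ?case by (simp add: it0 C_def)
    next
      case (Suc k)
      define H where "H t = C * (L * t) ^ Suc k / fact (Suc k)" for t
      define h where "h t = L * (C * (L * t) ^ k / fact k)" for t
      have H: "(H has_real_derivative h t) (at t)" for t
      proof -
        have "(H has_real_derivative (C * (real (Suc k) * (L * t) ^ k * L) / fact (Suc k))) (at t)"
          unfolding H_def[abs_def] by (auto intro!: derivative_eq_intros simp del: of_nat_Suc fact_Suc power_Suc)
        also have "C * (real (Suc k) * (L * t) ^ k * L) / fact (Suc k) = h t"
          by (simp add: h_def field_simps del: of_nat_Suc)
        finally show ?thesis .
      qed
      have H0: "H 0 = 0" by (simp add: H_def)
      show ?case
      proof (intro allI impI conjI)
        fix z assume z: "\<bar>z - y\<bar> \<le> r"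
        have "\<bar>us (Suc k) z\<bar> \<le> H \<bar>z - y\<bar>"
        proof (rule derivative_comparison[of "us (Suc k)" "\<lambda>x. s x * ps k x" y H h r z, OF _ y0(1) H H0 _ z])
          show "(us (Suc k) has_real_derivative s x * ps k x) (at x)" for x
            using du[of "Suc k" x] by (simp add: us'_def)
          show "\<bar>s x * ps k x\<bar> \<le> h \<bar>x - y\<bar>" if "\<bar>x - y\<bar> \<le> r" for x
            unfolding abs_mult h_def using L(1)[OF that] Suc that L0 by (intro mult_mono) auto
        qed
        then show "\<bar>us (Suc k) z\<bar> \<le> C * (L * \<bar>z - y\<bar>) ^ Suc k / fact (Suc k)" by (simp only: H_def)
        have "\<bar>ps (Suc k) z\<bar> \<le> H \<bar>z - y\<bar>"
        proof (rule derivative_comparison[of "ps (Suc k)" "\<lambda>x. m x * us k x" y H h r z, OF _ y0(2) H H0 _ z])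
          show "(ps (Suc k) has_real_derivative m x * us k x) (at x)" for x
            using dp[of "Suc k" x] by (simp add: ps'_def)
          show "\<bar>m x * us k x\<bar> \<le> h \<bar>x - y\<bar>" if "\<bar>x - y\<bar> \<le> r" for x
            unfolding abs_mult h_def using L(2)[OF that] Suc that L0 by (intro mult_mono) auto
        qed
        then show "\<bar>ps (Suc k) z\<bar> \<le> C * (L * \<bar>z - y\<bar>) ^ Suc k / fact (Suc k)" by (simp only: H_def)
      qed
    qed
    have bd': "\<bar>us k z\<bar> \<le> C * (L * r) ^ k / fact k" "\<bar>ps k z\<bar> \<le> C * (L * r) ^ k / fact k" if "\<bar>z - y\<bar> \<le> r" for k z
    proof -
      have "C * (L * \<bar>z - y\<bar>) ^ k / fact k \<le> C * (L * r) ^ k / fact k"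
        using that L0 C0 by (intro divide_right_mono mult_left_mono power_mono) auto
      then show "\<bar>us k z\<bar> \<le> C * (L * r) ^ k / fact k" "\<bar>ps k z\<bar> \<le> C * (L * r) ^ k / fact k"
        using bd[of k] that by (auto intro: order_trans)
    qed
    have sm: "summable (\<lambda>k. C * (L * r) ^ k / fact k)"
    proof -
      have "(\<lambda>k. C * (inverse (fact k) * (L * r) ^ k)) = (\<lambda>k. C * (L * r) ^ k / fact k)"
        by (simp add: fun_eq_iff divide_inverse)
      then show ?thesis using summable_mult[OF summable_exp[of "L * r"], of C] by simp
    qed
    have sm': "summable (\<lambda>k. L * (C * (L * r) ^ k / fact k))" by (rule summable_mult[OF sm])
    define Mb where "Mb k = (case k of 0 \<Rightarrow> 0 | Suc j \<Rightarrow> L * (C * (L * r) ^ j / fact j))" for k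
    have sMb: "summable Mb" using sm' by (subst summable_Suc_iff[symmetric]) (simp add: Mb_def)
    have S: "z \<in> ?S \<longleftrightarrow> \<bar>z - y\<bar> \<le> r" for z by auto
    have ub: "norm (us' k z) \<le> Mb k" "norm (ps' k z) \<le> Mb k" if "z \<in> ?S" for k z
    proof -
      have z: "\<bar>z - y\<bar> \<le> r" using that S by blast
      have "\<bar>s z\<bar> * \<bar>ps j z\<bar> \<le> L * (C * (L * r) ^ j / fact j)" "\<bar>m z\<bar> * \<bar>us j z\<bar> \<le> L * (C * (L * r) ^ j / fact j)" for j
        using L[OF z] bd'[OF z, of j] L0 by (auto intro!: mult_mono simp del: times_divide_eq_right)
      then show "norm (us' k z) \<le> Mb k" "norm (ps' k z) \<le> Mb k"
        unfolding us'_def ps'_def Mb_def real_norm_def by (simp_all add: abs_mult split: nat.split)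
    qed
    have uc: "uniformly_convergent_on ?S (\<lambda>n x. \<Sum>i<n. us' i x)" "uniformly_convergent_on ?S (\<lambda>n x. \<Sum>i<n. ps' i x)"
      using Weierstrass_m_test'[of ?S us' Mb, OF ub(1) sMb] Weierstrass_m_test'[of ?S ps' Mb, OF ub(2) sMb] by blast+
    have sx: "summable (\<lambda>k. us k x)" "summable (\<lambda>k. ps k x)"
      by (rule summable_comparison_test'[OF sm, of 0]; use bd'[of x] in \<open>simp add: r_def\<close>)+
    have int: "x \<in> interior ?S" by (simp add: r_def abs_if)
    have yS: "y \<in> ?S" using r by simp
    have sy: "summable (\<lambda>k. us k y)" "summable (\<lambda>k. ps k y)"
      by (rule summable_comparison_test'[OF sm, of 0]; use bd'[of y] r in simp)+
    show ?thesis
      using sx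
      has_field_derivative_series'(2)[of ?S us us' y x, OF convex_real_interval(5) has_field_derivative_at_within[OF du] uc(1) yS sy(1) int]
      has_field_derivative_series'(2)[of ?S ps ps' y x, OF convex_real_interval(5) has_field_derivative_at_within[OF dp] uc(2) yS sy(2) int]
      by blast
  qed
  have sum': "(\<Sum>k. us' k x) = s x * (\<Sum>k. ps k x)" "(\<Sum>k. ps' k x) = m x * (\<Sum>k. us k x)" for x
  proof -
    have s1: "summable (\<lambda>k. us k x)" "summable (\<lambda>k. ps k x)" using main by auto
    have "(\<lambda>k. us' (Suc k) x) sums (s x * (\<Sum>k. ps k x))" "(\<lambda>k. ps' (Suc k) x) sums (m x * (\<Sum>k. us k x))"
      using s1 by (auto simp: us'_def ps'_def intro!: sums_mult summable_sums)
    then have "(\<lambda>k. us' k x) sums (s x * (\<Sum>k. ps k x) + us' 0 x)" "(\<lambda>k. ps' k x) sums (m x * (\<Sum>k. us k x) + ps' 0 x)"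
      by (auto intro: sums_Suc)
    then show "(\<Sum>k. us' k x) = s x * (\<Sum>k. ps k x)" "(\<Sum>k. ps' k x) = m x * (\<Sum>k. us k x)"
      by (auto simp: us'_def ps'_def dest: sums_unique)
  qed
  have "(\<Sum>k. us k y) = a" "(\<Sum>k. ps k y) = c"
  proof -
    have "(\<lambda>k. if k = 0 then us k y else 0) = (\<lambda>k. us k y)" "(\<lambda>k. if k = 0 then ps k y else 0) = (\<lambda>k. ps k y)"
      using y0 by (auto simp: fun_eq_iff gr0_conv_Suc)
    then have "(\<lambda>k. us k y) sums us 0 y" "(\<lambda>k. ps k y) sums ps 0 y"
      using sums_single[of 0 "\<lambda>k. us k y"] sums_single[of 0 "\<lambda>k. ps k y"] by simp_all
    then show "(\<Sum>k. us k y) = a" "(\<Sum>k. ps k y) = c" by (auto simp: it0 dest: sums_unique)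
  qed
  with main sum' that[of "\<lambda>x. \<Sum>k. us k x" "\<lambda>x. \<Sum>k. ps k x"] show ?thesis by auto
qed

section \<open>Smooth truncation\<close>

lemma max0_power_has_derivative:
  fixes z :: real
  shows "((\<lambda>z. max 0 z ^ Suc (Suc n)) has_real_derivative real (Suc (Suc n)) * max 0 z ^ Suc n) (at z)"
proof -
  consider "z > 0" | "z < 0" | "z = 0" by linarith
  then show ?thesis
  proof cases
    case 1
    have "((\<lambda>z. z ^ Suc (Suc n)) has_real_derivative real (Suc (Suc n)) * z ^ Suc n) (at z)"
      using DERIV_pow[of "Suc (Suc n)" z UNIV] by (simp del: of_nat_Suc power_Suc)
    then have "((\<lambda>z. max 0 z ^ Suc (Suc n)) has_real_derivative real (Suc (Suc n)) * z ^ Suc n) (at z)"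
      by (rule has_field_derivative_transform_within_open[of _ _ _ "{0<..}"]) (use 1 in auto)
    then show ?thesis using 1 by simp
  next
    case 2
    have "((\<lambda>z. 0) has_real_derivative 0) (at z)" by simp
    then have "((\<lambda>z. max 0 z ^ Suc (Suc n)) has_real_derivative 0) (at z)"
      by (rule has_field_derivative_transform_within_open[of _ _ _ "{..<0}"]) (use 2 in auto)
    then show ?thesis using 2 by simp
  next
    case 3
    have "((\<lambda>h::real. max 0 h ^ Suc (Suc n) / h) \<longlongrightarrow> 0) (at 0)"
    proof (rule Lim_null_comparison)
      show "\<forall>\<^sub>F h in at 0. norm (max 0 h ^ Suc (Suc n) / h) \<le> \<bar>h::real\<bar> ^ Suc n"
      proof (intro always_eventually allI)
        fix h :: real
        show "norm (max 0 h ^ Suc (Suc n) / h) \<le> \<bar>h\<bar> ^ Suc n" 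
        proof (cases "h > 0")
          case False
          then have "norm (max 0 h ^ Suc (Suc n) / h) = 0" by simp
          also have "0 \<le> \<bar>h\<bar> ^ Suc n" by (rule zero_le_power[OF abs_ge_zero])
          finally show ?thesis .
        qed simp
      qed
      have "((\<lambda>h::real. \<bar>h\<bar> ^ Suc n) \<longlongrightarrow> \<bar>0\<bar> ^ Suc n) (at 0)"
        by (intro tendsto_power tendsto_rabs tendsto_ident_at)
      then show "((\<lambda>h::real. \<bar>h\<bar> ^ Suc n) \<longlongrightarrow> 0) (at 0)" by simp
    qed
    then show ?thesis using 3 by (simp add: DERIV_def)
  qed
qed

lemma local_const_deriv_0:
  fixes g :: "real \<Rightarrow> real"
  assumes "(g has_real_derivative l) (at x)" "open S" "x \<in> S" "\<And>z. z \<in> S \<Longrightarrow> g z = c"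
  shows "l = 0"
proof -
  have "((\<lambda>_. c) has_real_derivative l) (at x)"
    by (rule has_field_derivative_transform_within_open[OF assms(1-3)]) (use assms(4) in auto)
  then show ?thesis by (rule DERIV_unique[OF _ DERIV_const])
qed

text \<open>The truncated cube \<open>P\<close> is twice continuously differentiable, which is all
  that a second-order expansion asks for. \<open>P (1 - P (x - 1))\<close> equals 1 for
  \<open>x \<le> 1\<close> and 0 for \<open>x \<ge> 2\<close>; its product with its mirror image is
  the cutoff.\<close>

lemma smooth_cutoff_exists:
  obtains k k' k'' :: "real \<Rightarrow> real" where
    "\<And>x. (k has_real_derivative k' x) (at x)" "\<And>x. (k' has_real_derivative k'' x) (at x)"
    "continuous_on UNIV k''" "\<And>x. \<bar>x\<bar> \<le> 1 \<Longrightarrow> k x = 1" "\<And>x. 2 \<le> \<bar>x\<bar> \<Longrightarrow> k x = 0"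
proof -
  define P Q T :: "real \<Rightarrow> real" where "P z = max 0 z ^ 3" and "Q z = 3 * max 0 z ^ 2" and "T z = 6 * max 0 z" for z
  have dP: "(P has_real_derivative Q z) (at z)" for z
    using max0_power_has_derivative[of 1 z] by (simp add: P_def[abs_def] Q_def eval_nat_numeral)
  have dQ: "(Q has_real_derivative T z) (at z)" for z
    using DERIV_cmult[OF max0_power_has_derivative[of 0 z], of 3] by (simp add: Q_def[abs_def] T_def eval_nat_numeral)
  have cT: "continuous_on UNIV T" unfolding T_def by (intro continuous_intros)
  have cQ: "continuous_on UNIV Q" unfolding Q_def by (intro continuous_intros)
  have cP: "continuous_on UNIV P" unfolding P_def by (intro continuous_intros)
  define \<phi> \<phi>1 \<phi>2 where "\<phi> x = P (1 - P (x - 1))" and "\<phi>1 x = Q (1 - P (x - 1)) * (- Q (x - 1))"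
    and "\<phi>2 x = T (1 - P (x - 1)) * (- Q (x - 1)) * (- Q (x - 1)) + Q (1 - P (x - 1)) * (- T (x - 1))" for x
  have shift: "((\<lambda>x. g (x - 1)) has_real_derivative g' (x - 1)) (at x)"
    if "\<And>z. (g has_real_derivative g' z) (at z)" for g g' :: "real \<Rightarrow> real" and x
  proof -
    have "((\<lambda>x. x - 1) has_real_derivative 1) (at x)" by (auto intro!: derivative_eq_intros)
    from DERIV_chain2[OF that[of "x - 1"] this] show ?thesis by simp
  qed
  have inner: "((\<lambda>x. 1 - P (x - 1)) has_real_derivative - Q (x - 1)) (at x)" for x
    using DERIV_diff[OF DERIV_const[of 1] shift[OF dP]] by simp
  have d\<phi>: "(\<phi> has_real_derivative \<phi>1 x) (at x)" for x
    unfolding \<phi>_def[abs_def] \<phi>1_def by (rule DERIV_chain2[OF dP inner])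
  have d\<phi>1: "(\<phi>1 has_real_derivative \<phi>2 x) (at x)" for x
    unfolding \<phi>1_def[abs_def] \<phi>2_def
    by (rule DERIV_cong[OF DERIV_mult[OF DERIV_chain2[OF dQ inner] DERIV_minus[OF shift[OF dQ]]]]) simp
  have cc: "continuous_on UNIV (\<lambda>x. g (h x))" if "continuous_on UNIV g" "continuous_on UNIV h" for g h :: "real \<Rightarrow> real"
    by (rule continuous_on_compose2[OF that]) auto
  have c\<phi>2: "continuous_on UNIV \<phi>2" unfolding \<phi>2_def
    by (intro continuous_intros cc[OF cT] cc[OF cQ] cc[OF cP])
  have c\<phi>1: "continuous_on UNIV \<phi>1" and c\<phi>: "continuous_on UNIV \<phi>"
    using d\<phi>1 d\<phi> by (auto simp: continuous_on_eq_continuous_at intro: DERIV_isCont)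
  have \<phi>_1: "\<phi> x = 1" if "x \<le> 1" for x using that by (simp add: \<phi>_def P_def)
  have \<phi>_2: "\<phi> x = 0" if "2 \<le> x" for x
  proof -
    have "1 \<le> P (x - 1)" using that by (simp add: P_def one_le_power)
    then show ?thesis by (simp add: \<phi>_def P_def)
  qed
  have refl: "((\<lambda>x. g (- x)) has_real_derivative - g' (- x)) (at x)"
    if "\<And>z. (g has_real_derivative g' z) (at z)" for g g' :: "real \<Rightarrow> real" and x
    using DERIV_chain2[OF that DERIV_minus[OF DERIV_ident], of x] by simp
  show thesis
  proof (rule that[of "\<lambda>x. \<phi> x * \<phi> (- x)" "\<lambda>x. \<phi>1 x * \<phi> (- x) + \<phi> x * (- \<phi>1 (- x))"
        "\<lambda>x. \<phi>2 x * \<phi> (- x) + 2 * (\<phi>1 x * (- \<phi>1 (- x))) + \<phi> x * \<phi>2 (- x)"])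
    show "((\<lambda>x. \<phi> x * \<phi> (- x)) has_real_derivative \<phi>1 x * \<phi> (- x) + \<phi> x * (- \<phi>1 (- x))) (at x)" for x
      by (rule DERIV_cong[OF DERIV_mult[OF d\<phi> refl[OF d\<phi>]]]) simp
    show "((\<lambda>x. \<phi>1 x * \<phi> (- x) + \<phi> x * (- \<phi>1 (- x))) has_real_derivative
        \<phi>2 x * \<phi> (- x) + 2 * (\<phi>1 x * (- \<phi>1 (- x))) + \<phi> x * \<phi>2 (- x)) (at x)" for x
      by (rule DERIV_cong[OF DERIV_add[OF DERIV_mult[OF d\<phi>1 refl[OF d\<phi>]] DERIV_mult[OF d\<phi> DERIV_minus[OF refl[OF d\<phi>1]]]]])
         (simp add: algebra_simps)
    show "continuous_on UNIV (\<lambda>x. \<phi>2 x * \<phi> (- x) + 2 * (\<phi>1 x * (- \<phi>1 (- x))) + \<phi> x * \<phi>2 (- x))"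
      by (intro continuous_intros cc[OF c\<phi>2] cc[OF c\<phi>1] cc[OF c\<phi>] c\<phi>2 c\<phi>1 c\<phi>)
    show "\<phi> x * \<phi> (- x) = 1" if "\<bar>x\<bar> \<le> 1" for x using that \<phi>_1[of x] \<phi>_1[of "- x"] by (simp add: abs_if split: if_splits)
    show "\<phi> x * \<phi> (- x) = 0" if "2 \<le> \<bar>x\<bar>" for x using that \<phi>_2[of x] \<phi>_2[of "- x"] by (auto simp: abs_if split: if_splits)
  qed
qed

lemma compact_support_bounded_uc:
  fixes g :: "real \<Rightarrow> real"
  assumes g: "continuous_on UNIV g" and z: "\<And>x. \<bar>x - y\<bar> > 2 \<Longrightarrow> g x = 0"
  shows "\<exists>D. \<forall>x. \<bar>g x\<bar> \<le> D" and "uniformly_continuous_on UNIV g"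
proof -
  \<comment> \<open>The margin around the support ensures that two points at distance below 1 either
    both lie in \<open>?S\<close> or both lie where \<open>g\<close> vanishes.\<close>
  let ?S = "{y - 4..y + 4}"
  have c: "continuous_on ?S g" using g by (rule continuous_on_subset) simp
  have "bounded (g ` ?S)" by (intro compact_imp_bounded compact_continuous_image[OF c]) simp
  then obtain D where "\<forall>v\<in>g ` ?S. norm v \<le> D" by (auto simp: bounded_iff)
  then have D: "\<bar>g x\<bar> \<le> D" if "x \<in> ?S" for x using that by auto
  have "\<bar>g x\<bar> \<le> D" for x
  proof (cases "x \<in> ?S")
    case False
    then have "g x = 0" by (intro z) auto
    moreover have "0 \<le> D" using D[of y] by (auto intro: order_trans[OF abs_ge_zero])
    ultimately show ?thesis by simp
  qed (rule D)
  then show "\<exists>D. \<forall>x. \<bar>g x\<bar> \<le> D" by blast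
  have uc: "uniformly_continuous_on ?S g" by (rule compact_uniformly_continuous[OF c]) simp
  show "uniformly_continuous_on UNIV g"
    unfolding uniformly_continuous_on_def
  proof (intro allI impI)
    fix e :: real assume "e > 0"
    then obtain d where d: "d > 0" "\<And>x x'. x \<in> ?S \<Longrightarrow> x' \<in> ?S \<Longrightarrow> dist x' x < d \<Longrightarrow> dist (g x') (g x) < e"
      using uc unfolding uniformly_continuous_on_def by metis
    have "dist (g x') (g x) < e" if "dist x' x < min d 1" for x x'
    proof (cases "x \<in> ?S \<and> x' \<in> ?S")
      case True
      then show ?thesis using d(2)[of x x'] that by simp
    next
      case False
      then have "\<bar>x - y\<bar> > 2" "\<bar>x' - y\<bar> > 2" using that by (auto simp: dist_real_def)
      then show ?thesis using z \<open>e > 0\<close> by simp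
    qed
    then show "\<exists>d>0. \<forall>x\<in>UNIV. \<forall>x'\<in>UNIV. dist x' x < d \<longrightarrow> dist (g x') (g x) < e"
      using d(1) by (intro exI[of _ "min d 1"]) auto
  qed
qed

text \<open>The values must agree on the closed interval, because the exit takes place at its end
  points; the derivatives only in the open one, where the eigenvalue equation is used.\<close>

lemma bounded_C2_extension:
  fixes u u' u'' :: "real \<Rightarrow> real" and y :: real
  assumes d1: "\<And>x. (u has_real_derivative u' x) (at x)"
    and d2: "\<And>x. (u' has_real_derivative u'' x) (at x)"
    and c2: "continuous_on UNIV u''"
  obtains f f' f'' D where "\<And>x. (f has_real_derivative f' x) (at x)"
    "\<And>x. (f' has_real_derivative f'' x) (at x)"
    "\<And>x. \<bar>f x\<bar> \<le> D" "\<And>x. \<bar>f' x\<bar> \<le> D" "\<And>x. \<bar>f'' x\<bar> \<le> D"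
    "uniformly_continuous_on UNIV f''"
    "\<And>x. \<bar>x - y\<bar> \<le> 1 \<Longrightarrow> f x = u x" "\<And>x. \<bar>x - y\<bar> < 1 \<Longrightarrow> f' x = u' x" "\<And>x. \<bar>x - y\<bar> < 1 \<Longrightarrow> f'' x = u'' x"
proof -
  obtain k0 k0' k0'' :: "real \<Rightarrow> real" where k0: 
    "\<And>x. (k0 has_real_derivative k0' x) (at x)" "\<And>x. (k0' has_real_derivative k0'' x) (at x)"
    "continuous_on UNIV k0''" "\<And>x. \<bar>x\<bar> \<le> 1 \<Longrightarrow> k0 x = 1" "\<And>x. 2 \<le> \<bar>x\<bar> \<Longrightarrow> k0 x = 0"
    using smooth_cutoff_exists by blast
  define k k' k'' where "k x = k0 (x - y)" and "k' x = k0' (x - y)" and "k'' x = k0'' (x - y)" for x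
  have sh: "((\<lambda>x. x - y) has_real_derivative 1) (at x)" for x by (auto intro!: derivative_eq_intros)
  have k1: "(k has_real_derivative k' x) (at x)" for x
    unfolding k_def k'_def using DERIV_chain2[OF k0(1)[of "x - y"] sh] by simp
  have k2: "(k' has_real_derivative k'' x) (at x)" for x
    unfolding k''_def k'_def using DERIV_chain2[OF k0(2)[of "x - y"] sh] by simp
  have ck2: "continuous_on UNIV k''" unfolding k''_def by (rule continuous_on_compose2[OF k0(3)]) (auto intro: continuous_intros)
  have cont: "continuous_on UNIV g" if "\<And>x. (g has_real_derivative g' x) (at x)" for g g' :: "real \<Rightarrow> real"
    using that by (auto simp: continuous_on_eq_continuous_at intro: DERIV_isCont)
  define f f' f'' where "f x = u x * k x" and "f' x = u' x * k x + u x * k' x"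
    and "f'' x = u'' x * k x + 2 * (u' x * k' x) + u x * k'' x" for x
  have f1: "(f has_real_derivative f' x) (at x)" for x
    unfolding f_def[abs_def] f'_def by (rule DERIV_cong[OF DERIV_mult[OF d1 k1]]) simp
  have f2: "(f' has_real_derivative f'' x) (at x)" for x
    unfolding f''_def f'_def[abs_def] by (rule DERIV_cong[OF DERIV_add[OF DERIV_mult[OF d2 k1] DERIV_mult[OF d1 k2]]]) simp
  have cf2: "continuous_on UNIV f''" unfolding f''_def
    by (intro continuous_intros c2 ck2 cont[OF d1] cont[OF d2] cont[OF k1] cont[OF k2])
  let ?O = "{x. \<bar>x - y\<bar> > 2}" and ?I = "{x. \<bar>x - y\<bar> < 1}"
  have op: "open ?O" "open ?I" by (auto intro!: open_Collect_less continuous_intros)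
  have z0: "f x = 0" if "x \<in> ?O" for x using that k0(5)[of "x - y"] by (simp add: f_def k_def)
  have z1: "f' x = 0" if "x \<in> ?O" for x by (rule local_const_deriv_0[OF f1 op(1) that z0])
  have z2: "f'' x = 0" if "x \<in> ?O" for x by (rule local_const_deriv_0[OF f2 op(1) that z1])
  have i0: "k x = 1" if "\<bar>x - y\<bar> \<le> 1" for x using that k0(4)[of "x - y"] by (simp add: k_def)
  have i1: "k' x = 0" if "x \<in> ?I" for x by (rule local_const_deriv_0[OF k1 op(2) that, of 1]) (auto intro: i0)
  have i2: "k'' x = 0" if "x \<in> ?I" for x by (rule local_const_deriv_0[OF k2 op(2) that i1])
  obtain D0 D1 D2 where D: "\<And>x. \<bar>f x\<bar> \<le> D0" "\<And>x. \<bar>f' x\<bar> \<le> D1" "\<And>x. \<bar>f'' x\<bar> \<le> D2"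
    using compact_support_bounded_uc(1)[OF cont[OF f1], of y] compact_support_bounded_uc(1)[OF cont[OF f2], of y]
      compact_support_bounded_uc(1)[OF cf2, of y] z0 z1 z2 by auto
  show thesis
  proof (rule that[of f f' f'' "max D0 (max D1 D2)"])
    show "uniformly_continuous_on UNIV f''" by (rule compact_support_bounded_uc(2)[OF cf2, of y]) (use z2 in auto)
  qed (use f1 f2 D i0 i1 i2 in \<open>auto simp: le_max_iff_disj f_def f'_def f''_def\<close>)
qed

section \<open>Eigenfunctions and the Laplace transform of the exit time\<close>

locale periodic_coefficients =
  fixes b \<sigma> :: "real \<Rightarrow> real"
  assumes b_cont: "continuous_on UNIV b" and \<sigma>_cont: "continuous_on UNIV \<sigma>"
    and \<sigma>_pos: "\<And>x. \<sigma> x > 0"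
    and b_per: "\<And>x. b (x + 1) = b x" and \<sigma>_per: "\<And>x. \<sigma> (x + 1) = \<sigma> x"
begin

text \<open>The increment over one period of the exponent \<open>B\<close> in the scale density
  \<open>exp (- B x)\<close>; it is zero exactly when that density is periodic.\<close>

definition affinity :: real where
  "affinity = 2 * integral {0..1} (\<lambda>z. b z / (\<sigma> z)\<^sup>2)"

lemma scale_exists:
  obtains B where "\<And>x. (B has_real_derivative 2 * b x / (\<sigma> x)\<^sup>2) (at x)" "B y = 0"
    "\<And>x. B (x + 1) = B x + affinity"
proof -
  have \<sigma>0: "\<sigma> x \<noteq> 0" for x using \<sigma>_pos[of x] by simp
  have c: "continuous_on UNIV (\<lambda>x. 2 * b x / (\<sigma> x)\<^sup>2)"
    using b_cont \<sigma>_cont \<sigma>0 by (intro continuous_intros) auto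
  obtain B where B: "\<And>x. (B has_real_derivative 2 * b x / (\<sigma> x)\<^sup>2) (at x)" "B y = 0"
    using antiderivative_exists[OF c, of y] by blast
  have d: "((\<lambda>x. B (x + 1) - B x) has_real_derivative 0) (at x)" for x
  proof -
    have "((\<lambda>x. x + 1) has_real_derivative 1) (at x)" by (auto intro!: derivative_eq_intros)
    from DERIV_diff[OF DERIV_chain2[OF B(1)[of "x + 1"] this] B(1)[of x]]
    show ?thesis by (simp add: b_per \<sigma>_per)
  qed
  have "B (x + 1) - B x = B (0 + 1) - B 0" for x
    using DERIV_isconst_all[of "\<lambda>x. B (x + 1) - B x" x 0] d by blast
  moreover have "B 1 - B 0 = affinity"
  proof -
    have "((\<lambda>x. 2 * b x / (\<sigma> x)\<^sup>2) has_integral B 1 - B 0) {0..1}"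
      using B(1) by (intro fundamental_theorem_of_calculus)
        (auto simp: has_real_derivative_iff_has_vector_derivative[symmetric] intro: has_field_derivative_at_within)
    moreover have "(\<lambda>x. 2 * b x / (\<sigma> x)\<^sup>2) = (\<lambda>x. 2 * (b x / (\<sigma> x)\<^sup>2))" by simp
    ultimately have "integral {0..1} (\<lambda>x. 2 * (b x / (\<sigma> x)\<^sup>2)) = B 1 - B 0" by (simp only: integral_unique)
    then show ?thesis unfolding affinity_def by (subst (asm) integral_mult_right) simp
  qed
  ultimately have *: "B (x + 1) - B x = affinity" for x by simp
  have "B (x + 1) = B x + affinity" for x using *[of x] by linarith
  with B that show thesis by blast
qed

text \<open>With the scale density \<open>s\<close> and \<open>p = u' / s\<close> the equation
  becomes the system \<open>u' = s * p\<close>, \<open>p' = m * u\<close>, where \<open>m\<close> is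
  \<open>\<alpha>\<close> times the speed density; no coefficient has to be differentiated. The
  choice \<open>p y = 1\<close> fixes the slope at \<open>y\<close>, so that the solution with
  \<open>a = 0\<close> is not trivial.\<close>

lemma eigenfunction_exists:
  assumes \<alpha>: "0 < \<alpha>"
  obtains u u' u'' where
    "\<And>x. (u has_real_derivative u' x) (at x)" "\<And>x. (u' has_real_derivative u'' x) (at x)"
    "continuous_on UNIV u''" "\<And>x. b x * u' x + (\<sigma> x)\<^sup>2 / 2 * u'' x = \<alpha> * u x"
    "u y = a" "a = 0 \<Longrightarrow> u (y - 1) \<noteq> 0 \<and> u (y + 1) * exp affinity = - u (y - 1)"
proof -
  obtain B where B: "\<And>x. (B has_real_derivative 2 * b x / (\<sigma> x)\<^sup>2) (at x)" "B y = 0"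
    "\<And>x. B (x + 1) = B x + affinity" using scale_exists by blast
  have \<sigma>0: "\<sigma> x \<noteq> 0" for x using \<sigma>_pos[of x] by simp
  define s m where "s x = exp (- B x)" and "m x = \<alpha> * (2 / (\<sigma> x)\<^sup>2 * exp (B x))" for x
  have contD: "continuous_on UNIV g" if "\<And>x. (g has_real_derivative g' x) (at x)" for g g' :: "real \<Rightarrow> real"
    using that by (auto simp: continuous_on_eq_continuous_at intro: DERIV_isCont)
  have cB: "continuous_on UNIV B" by (rule contD[OF B(1)])
  have cs: "continuous_on UNIV s" unfolding s_def by (intro continuous_intros cB)
  have cm: "continuous_on UNIV m" unfolding m_def by (intro continuous_intros cB \<sigma>_cont) (use \<sigma>0 in auto)
  obtain u p where u: "\<And>x. (u has_real_derivative s x * p x) (at x)"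
    and p: "\<And>x. (p has_real_derivative m x * u x) (at x)" and y: "u y = a" "p y = 1"
    using linear_system_exists[OF cs cm] by blast
  have ds: "(s has_real_derivative - (2 * b x / (\<sigma> x)\<^sup>2) * s x) (at x)" for x
    unfolding s_def[abs_def] by (rule DERIV_cong[OF DERIV_fun_exp[OF DERIV_minus[OF B(1)]]]) simp
  define u' u'' where "u' x = s x * p x" and "u'' x = - (2 * b x / (\<sigma> x)\<^sup>2) * s x * p x + s x * (m x * u x)" for x
  have du': "(u' has_real_derivative u'' x) (at x)" for x
    unfolding u'_def[abs_def] u''_def by (rule DERIV_cong[OF DERIV_mult[OF ds p]]) simp
  have cu'': "continuous_on UNIV u''" unfolding u''_def
    by (intro continuous_intros b_cont \<sigma>_cont cs cm contD[OF u] contD[OF p]) (use \<sigma>0 in auto)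
  have sm: "s x * m x = \<alpha> * 2 / (\<sigma> x)\<^sup>2" for x
    by (simp add: s_def m_def exp_minus field_simps)
  have eig: "b x * u' x + (\<sigma> x)\<^sup>2 / 2 * u'' x = \<alpha> * u x" for x
  proof -
    have "(\<sigma> x)\<^sup>2 / 2 * u'' x = - b x * (s x * p x) + (\<sigma> x)\<^sup>2 / 2 * (s x * m x) * u x"
      unfolding u''_def using \<sigma>0[of x] by (simp add: field_simps)
    also have "\<dots> = - b x * (s x * p x) + \<alpha> * u x"
      unfolding sm using \<sigma>0[of x] by (simp add: field_simps)
    finally have *: "(\<sigma> x)\<^sup>2 / 2 * u'' x = - b x * (s x * p x) + \<alpha> * u x" .
    show ?thesis unfolding * u'_def by simp
  qed
  have "u (y - 1) \<noteq> 0 \<and> u (y + 1) * exp affinity = - u (y - 1)" if a0: "a = 0"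
  proof
    have s_pos: "s x > 0" and m_pos: "m x > 0" for x using \<alpha> \<sigma>_pos[of x] by (auto simp: s_def m_def)
    \<comment> \<open>The product \<open>u * p\<close> is nondecreasing because
      \<open>\<alpha>\<close> is positive. It vanishes at \<open>y\<close> with positive derivative,
      hence is negative on the left of \<open>y\<close>, and so \<open>u\<close> cannot vanish at
      \<open>y - 1\<close>.\<close>
    have dup: "((\<lambda>x. u x * p x) has_real_derivative s x * (p x)\<^sup>2 + m x * (u x)\<^sup>2) (at x)" for x
      by (rule DERIV_cong[OF DERIV_mult[OF u p]]) (simp add: power2_eq_square algebra_simps)
    have "s y * (p y)\<^sup>2 + m y * (u y)\<^sup>2 > 0" using y s_pos[of y] m_pos[of y] a0 by simp
    from DERIV_pos_inc_left[OF dup this] obtain d where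
      d: "d > 0" "\<And>h. h > 0 \<Longrightarrow> h < d \<Longrightarrow> u (y - h) * p (y - h) < u y * p y" by blast
    define h where "h = min (d / 2) 1"
    have "u (y - 1) * p (y - 1) \<le> u (y - h) * p (y - h)"
    proof (rule DERIV_nonneg_imp_nondecreasing[of "y - 1" "y - h" "\<lambda>x. u x * p x"])
      fix x
      have "0 \<le> s x * (p x)\<^sup>2 + m x * (u x)\<^sup>2"
        using s_pos[of x] m_pos[of x] by (intro add_nonneg_nonneg mult_nonneg_nonneg) auto
      with dup show "\<exists>l. ((\<lambda>x. u x * p x) has_real_derivative l) (at x) \<and> 0 \<le> l" by blast
    qed (simp add: h_def)
    also have "\<dots> < 0" using d(2)[of h] d(1) y a0 by (simp add: h_def min_def split: if_splits)
    finally show "u (y - 1) \<noteq> 0" by auto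
    \<comment> \<open>A shift by one period multiplies \<open>s\<close> and \<open>m\<close> by
      mutually inverse constants; this is the origin of the factor \<open>exp affinity\<close> in
      \<open>q\<close>.\<close>
    have sh: "s (x - 1) = s x * exp affinity" "m (x - 1) = m x * exp (- affinity)" for x
    proof -
      have "- B (x - 1) = - B x + affinity" "B (x - 1) = B x + - affinity" using B(3)[of "x - 1"] by simp_all
      then have "exp (- B (x - 1)) = exp (- B x) * exp affinity" "exp (B (x - 1)) = exp (B x) * exp (- affinity)"
        by (simp_all only: exp_add)
      then show "s (x - 1) = s x * exp affinity" "m (x - 1) = m x * exp (- affinity)"
        using \<sigma>_per[of "x - 1"] by (simp_all add: s_def m_def)
    qed
    have dsh: "((\<lambda>x. x - 1) has_real_derivative 1) (at x)" for x by (auto intro!: derivative_eq_intros)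
    \<comment> \<open>the Wronskian of \<open>u\<close> and \<open>u (\<sqdot> - 1)\<close>, divided by the scale density\<close>
    define q where "q x = u x * p (x - 1) * exp affinity - p x * u (x - 1)" for x
    have "(q has_real_derivative 0) (at x)" for x
    proof -
      have "(q has_real_derivative (s x * p x * p (x - 1) + m (x - 1) * u (x - 1) * 1 * u x) * exp affinity
         - (m x * u x * u (x - 1) + s (x - 1) * p (x - 1) * 1 * p x)) (at x)"
        unfolding q_def[abs_def]
        by (rule DERIV_diff[OF DERIV_cmult_right[OF DERIV_mult[OF u DERIV_chain2[OF p dsh]]] DERIV_mult[OF p DERIV_chain2[OF u dsh]]])
      also have "(s x * p x * p (x - 1) + m (x - 1) * u (x - 1) * 1 * u x) * exp affinity
         - (m x * u x * u (x - 1) + s (x - 1) * p (x - 1) * 1 * p x) = 0"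
        unfolding sh by (simp add: exp_minus field_simps)
      finally show ?thesis .
    qed
    \<comment> \<open>With \<open>u y = 0\<close> and \<open>p y = 1\<close> a single term of
      \<open>q\<close> remains at each of the two points.\<close>
    then have "q (y + 1) = q y" using DERIV_isconst_all by blast
    then show "u (y + 1) * exp affinity = - u (y - 1)" using y a0 by (simp add: q_def)
  qed
  with that[of u u' u''] u du' cu'' eig y(1) show thesis by (simp add: u'_def)
qed

end

lemma continuous_periodic_uc:
  fixes g :: "real \<Rightarrow> real"
  assumes g: "continuous_on UNIV g" and per: "\<And>x. g (x + 1) = g x"
  shows "\<exists>D. \<forall>x. \<bar>g x\<bar> \<le> D" and "uniformly_continuous_on UNIV g"
proof -
  have shift: "g (x + of_int k) = g x" for x k
  proof (induction k rule: int_induct[where k=0])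
    case (step1 i)
    then show ?case using per[of "x + of_int i"] by (simp add: add.assoc)
  next
    case (step2 i)
    then show ?case using per[of "x + of_int (i - 1)"] by simp
  qed simp
  have c: "continuous_on {-1..2} g" using g by (rule continuous_on_subset) simp
  have fr: "g x = g (frac x)" for x
    using shift[of "frac x" "\<lfloor>x\<rfloor>"] by (simp add: frac_def)
  have "bounded (g ` {-1..2})" by (intro compact_imp_bounded compact_continuous_image[OF c]) simp
  then obtain D where "\<forall>v\<in>g ` {-1..2}. norm v \<le> D" by (auto simp: bounded_iff)
  then have D: "\<bar>g x\<bar> \<le> D" if "x \<in> {-1..2}" for x using that by auto
  have "\<bar>g x\<bar> \<le> D" for x
  proof -
    have "frac x \<in> {-1..2}" unfolding atLeastAtMost_iff using frac_ge_0[of x] frac_lt_1[of x] by linarith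
    then show ?thesis unfolding fr[of x] by (rule D)
  qed
  then show "\<exists>D. \<forall>x. \<bar>g x\<bar> \<le> D" by blast
  have uc: "uniformly_continuous_on {-1..2} g" by (rule compact_uniformly_continuous[OF c]) simp
  show "uniformly_continuous_on UNIV g"
    unfolding uniformly_continuous_on_def
  proof (intro allI impI)
    fix e :: real assume "e > 0"
    then obtain d where d: "d > 0" "\<And>x x'. x \<in> {-1..2} \<Longrightarrow> x' \<in> {-1..2} \<Longrightarrow> dist x' x < d \<Longrightarrow> dist (g x') (g x) < e"
      using uc unfolding uniformly_continuous_on_def by metis
    have "dist (g x') (g x) < e" if "dist x' x < min d 1" for x x'
    proof -
      \<comment> \<open>Both points are moved by the same integer. It takes \<open>x\<close> into
        the period cell, and \<open>{-1..2}\<close> leaves room of length 1 on either side for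
        \<open>x'\<close>.\<close>
      let ?k = "of_int (- \<lfloor>x\<rfloor>) :: real"
      have "\<bar>x' - x\<bar> < 1" using that by (simp add: dist_real_def)
      then have "x + ?k \<in> {-1..2}" "x' + ?k \<in> {-1..2}"
        unfolding atLeastAtMost_iff of_int_minus by linarith+
      moreover have "dist (x' + ?k) (x + ?k) < d" using that by (simp add: dist_real_def)
      ultimately have "dist (g (x' + ?k)) (g (x + ?k)) < e" by (rule d(2))
      then show ?thesis by (simp only: shift)
    qed
    then show "\<exists>d>0. \<forall>x\<in>UNIV. \<forall>x'\<in>UNIV. dist x' x < d \<longrightarrow> dist (g x') (g x) < e"
      using d(1) by (intro exI[of _ "min d 1"]) auto
  qed
qed

text \<open>Laplace transforms at the positive integers determine a finite measure on the half line:
  with \<open>\<xi> = exp (- T)\<close> they are moments, and Weierstrass approximation applies.\<close>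

lemma (in prob_space) moments_determine_tails:
  fixes \<xi> :: "'a \<Rightarrow> real"
  assumes [measurable]: "\<xi> \<in> borel_measurable M" "A \<in> sets M" "B \<in> sets M"
    and \<xi>: "\<And>\<omega>. \<omega> \<in> space M \<Longrightarrow> 0 \<le> \<xi> \<omega>" "\<And>\<omega>. \<omega> \<in> space M \<Longrightarrow> \<xi> \<omega> \<le> 1"
    and mom: "\<And>n::nat. 0 < n \<Longrightarrow> expectation (\<lambda>\<omega>. \<xi> \<omega> ^ n * indicator A \<omega>) = c * expectation (\<lambda>\<omega>. \<xi> \<omega> ^ n * indicator B \<omega>)"
    and a: "0 < a"
  shows "prob {\<omega> \<in> A. a \<le> \<xi> \<omega>} = c * prob {\<omega> \<in> B. a \<le> \<xi> \<omega>}"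
proof -
  \<comment> \<open>The claim says that the signed measure with density \<open>w\<close>, carried
    over to the line by \<open>\<xi>\<close>, gives no mass to \<open>[a, \<infinity>)\<close>. The
    hypothesis says that its moments of positive order vanish.\<close>
  define w where "w \<omega> = indicator A \<omega> - c * indicator B \<omega>" for \<omega>
  have wm [measurable]: "w \<in> borel_measurable M" unfolding w_def[abs_def] by measurable
  have wb: "\<bar>w \<omega>\<bar> \<le> 1 + \<bar>c\<bar>" for \<omega> by (auto simp: w_def indicator_def)
  have iw: "integrable M (\<lambda>\<omega>. \<phi> (\<xi> \<omega>) * w \<omega>)" if [measurable]: "\<phi> \<in> borel_measurable borel"
    and b: "\<And>x. x \<in> {0..1} \<Longrightarrow> \<bar>\<phi> x\<bar> \<le> D" for \<phi> :: "real \<Rightarrow> real" and D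
  proof (rule bounded_integrable)
    show "\<bar>\<phi> (\<xi> \<omega>) * w \<omega>\<bar> \<le> D * (1 + \<bar>c\<bar>)" if "\<omega> \<in> space M" for \<omega>
      unfolding abs_mult using b[of "\<xi> \<omega>"] wb[of \<omega>] \<xi>[OF that]
      by (intro mult_mono) (auto intro: order_trans[OF abs_ge_zero])
  qed measurable
  have pw: "expectation (\<lambda>\<omega>. \<xi> \<omega> ^ Suc n * w \<omega>) = 0" for n
  proof -
    have i: "integrable M (\<lambda>\<omega>. \<xi> \<omega> ^ Suc n * indicator S \<omega>)" if [measurable]: "S \<in> sets M" for S
      by (rule bounded_integrable[of _ 1]) (use \<xi> in \<open>auto simp: indicator_def abs_mult power_le_one mult_le_one\<close>)
    have "(\<lambda>\<omega>. \<xi> \<omega> ^ Suc n * w \<omega>) = (\<lambda>\<omega>. \<xi> \<omega> ^ Suc n * indicator A \<omega> - c * (\<xi> \<omega> ^ Suc n * indicator B \<omega>))"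
      by (auto simp: w_def algebra_simps)
    then show ?thesis using i[of A] i[of B] mom[of "Suc n"] by (simp del: power_Suc)
  qed
  \<comment> \<open>The extra factor \<open>\<xi> \<omega>\<close> makes up for the moment of order
    zero, which is not given: polynomials without constant term are the ones known to integrate to
    zero.\<close>
  have poly: "expectation (\<lambda>\<omega>. (\<xi> \<omega> * p (\<xi> \<omega>)) * w \<omega>) = 0" if p: "real_polynomial_function p" for p
  proof -
    obtain q n where q: "p = (\<lambda>x. \<Sum>i\<le>n. q i * x ^ i)" using p real_polynomial_function_iff_sum by metis
    have "(\<lambda>\<omega>. (\<xi> \<omega> * p (\<xi> \<omega>)) * w \<omega>) = (\<lambda>\<omega>. \<Sum>i\<le>n. q i * (\<xi> \<omega> ^ Suc i * w \<omega>))"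
      by (auto simp: q sum_distrib_left sum_distrib_right mult_ac)
    moreover have "integrable M (\<lambda>\<omega>. \<xi> \<omega> ^ Suc i * w \<omega>)" for i
      by (rule iw[of "\<lambda>x. x ^ Suc i" 1]) (auto simp: abs_mult power_le_one mult_le_one)
    ultimately show ?thesis using pw by (simp add: Bochner_Integration.integral_sum del: power_Suc)
  qed
  have cont: "expectation (\<lambda>\<omega>. (\<xi> \<omega> * g (\<xi> \<omega>)) * w \<omega>) = 0" if g: "continuous_on UNIV g" for g
  proof -
    have gm [measurable]: "g \<in> borel_measurable borel" using g by (rule borel_measurable_continuous_onI)
    have g01: "continuous_on {0..1} g" using g by (rule continuous_on_subset) simp
    have "bounded (g ` {0..1})" by (intro compact_imp_bounded compact_continuous_image[OF g01]) simp
    then obtain D where "\<forall>v\<in>g ` {0..1}. norm v \<le> D" by (auto simp: bounded_iff)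
    then have D: "\<bar>g x\<bar> \<le> D" if "x \<in> {0..1}" for x using that by auto
    have "\<bar>expectation (\<lambda>\<omega>. (\<xi> \<omega> * g (\<xi> \<omega>)) * w \<omega>)\<bar> \<le> 0 + e" if e: "e > 0" for e
    proof -
      have e': "e / (1 + \<bar>c\<bar>) > 0" using e by (simp add: add_pos_nonneg)
      obtain p where p: "real_polynomial_function p" "\<And>x. x \<in> {0..1} \<Longrightarrow> \<bar>g x - p x\<bar> < e / (1 + \<bar>c\<bar>)"
        using Stone_Weierstrass_real_polynomial_function[OF _ g01 e'] by auto
      have pm [measurable]: "p \<in> borel_measurable borel"
        using p(1) by (intro borel_measurable_continuous_onI continuous_on_polymonial_function) (simp add: real_polynomial_function_eq)
      have pb: "\<bar>p x\<bar> \<le> D + e / (1 + \<bar>c\<bar>)" if "x \<in> {0..1}" for x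
        using D[OF that] p(2)[OF that] by linarith
      have D0: "0 \<le> D" using D[of 0] by (auto intro: order_trans[OF abs_ge_zero])
      have b1: "\<bar>x * z\<bar> \<le> C" if "x \<in> {0..1}" "\<bar>z\<bar> \<le> C" for x z C :: real
        using that mult_mono[of "\<bar>x\<bar>" 1 "\<bar>z\<bar>" C] by (simp add: abs_mult)
      have i1: "integrable M (\<lambda>\<omega>. (\<xi> \<omega> * g (\<xi> \<omega>)) * w \<omega>)"
        by (rule iw[of "\<lambda>x. x * g x" D]) (auto intro!: b1 D)
      have i2: "integrable M (\<lambda>\<omega>. (\<xi> \<omega> * p (\<xi> \<omega>)) * w \<omega>)"
        by (rule iw[of "\<lambda>x. x * p x" "D + e / (1 + \<bar>c\<bar>)"]) (auto intro!: b1 pb)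
      have "expectation (\<lambda>\<omega>. (\<xi> \<omega> * g (\<xi> \<omega>)) * w \<omega>) =
        expectation (\<lambda>\<omega>. (\<xi> \<omega> * g (\<xi> \<omega>)) * w \<omega> - (\<xi> \<omega> * p (\<xi> \<omega>)) * w \<omega>)"
        using i1 i2 poly[OF p(1)] by simp
      also have "\<bar>\<dots>\<bar> \<le> expectation (\<lambda>\<omega>. e)"
      proof (rule order_trans[OF integral_abs_bound integral_mono])
        fix \<omega> assume \<omega>: "\<omega> \<in> space M"
        then have x: "\<xi> \<omega> \<in> {0..1}" using \<xi> by simp
        have "\<bar>(\<xi> \<omega> * g (\<xi> \<omega>)) * w \<omega> - (\<xi> \<omega> * p (\<xi> \<omega>)) * w \<omega>\<bar> = \<bar>\<xi> \<omega> * (g (\<xi> \<omega>) - p (\<xi> \<omega>))\<bar> * \<bar>w \<omega>\<bar>"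
          by (simp add: abs_mult[symmetric] algebra_simps)
        also have "\<dots> \<le> (e / (1 + \<bar>c\<bar>)) * (1 + \<bar>c\<bar>)"
          using p(2)[OF x] wb[of \<omega>] e' by (intro mult_mono b1[OF x]) auto
        also have "\<dots> = e" using add_pos_nonneg[of 1 "\<bar>c\<bar>"] by simp
        finally show "\<bar>(\<xi> \<omega> * g (\<xi> \<omega>)) * w \<omega> - (\<xi> \<omega> * p (\<xi> \<omega>)) * w \<omega>\<bar> \<le> e" .
      qed (use i1 i2 in auto)
      finally show ?thesis by (simp add: prob_space)
    qed
    from field_le_epsilon[OF this] show ?thesis by simp
  qed
  \<comment> \<open>For \<open>x \<ge> 0\<close> the product \<open>x * g k x\<close> tends to the
    indicator of \<open>[a, \<infinity>)\<close>: the numerator is a ramp that reaches 1 at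
    \<open>a\<close> and becomes steeper with \<open>k\<close>, and \<open>max x (a / 2)\<close> in
    place of \<open>x\<close> keeps the quotient continuous at 0.\<close>
  define g where "g k x = min 1 (max 0 (1 - real k * (a - x))) / max x (a / 2)" for k x
  have gc: "continuous_on UNIV (g k)" for k unfolding g_def
    by (intro continuous_intros) (use a in \<open>auto simp: max_def\<close>)
  have gm [measurable]: "g k \<in> borel_measurable borel" for k by (rule borel_measurable_continuous_onI[OF gc])
  have lim: "(\<lambda>k. x * g k x) \<longlonglongrightarrow> indicator {a..} x" if x: "0 \<le> x" for x
  proof (cases "a \<le> x")
    case True
    have "1 \<le> 1 - real k * (a - x)" for k using True by (simp add: mult_nonneg_nonpos)
    moreover have "min 1 (max 0 z) = 1" if "1 \<le> z" for z :: real using that by simp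
    ultimately have "min 1 (max 0 (1 - real k * (a - x))) = 1" for k by blast
    then have "x * g k x = 1" for k using True a by (simp add: g_def max_def)
    then show ?thesis using True by simp
  next
    case False
    obtain N :: nat where N: "1 / (a - x) \<le> N" using real_arch_simple by blast
    have "x * g k x = 0" if "k \<ge> N" for k
    proof -
      have "1 / (a - x) \<le> real k" using N that by linarith
      then have "1 \<le> real k * (a - x)" using False by (simp add: field_simps)
      then show ?thesis by (simp add: g_def)
    qed
    then have "\<forall>\<^sub>F k in sequentially. x * g k x = 0" unfolding eventually_sequentially by blast
    then show ?thesis using False by (simp add: tendsto_eventually)
  qed
  have gb: "\<bar>x * g k x\<bar> \<le> 1" if x: "0 \<le> x" for x k
  proof -
    have q: "0 \<le> min 1 (max 0 (1 - real k * (a - x)))" "min 1 (max 0 (1 - real k * (a - x))) \<le> 1" by auto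
    have mx: "x \<le> max x (a / 2)" "0 < max x (a / 2)" using a by (auto simp: max_def)
    have "\<bar>x * g k x\<bar> = min 1 (max 0 (1 - real k * (a - x))) * (x / max x (a / 2))"
      unfolding g_def using q mx x by (simp add: abs_mult)
    also have "\<dots> \<le> 1 * 1" using q mx x by (intro mult_mono) auto
    finally show ?thesis by simp
  qed
  have "(\<lambda>k. expectation (\<lambda>\<omega>. (\<xi> \<omega> * g k (\<xi> \<omega>)) * w \<omega>)) \<longlonglongrightarrow> expectation (\<lambda>\<omega>. indicator {a..} (\<xi> \<omega>) * w \<omega>)"
  proof (rule integral_dominated_convergence[where w="\<lambda>_. 1 * (1 + \<bar>c\<bar>)"])
    show "AE \<omega> in M. (\<lambda>k. \<xi> \<omega> * g k (\<xi> \<omega>) * w \<omega>) \<longlonglongrightarrow> indicator {a..} (\<xi> \<omega>) * w \<omega>"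
      by (rule AE_I2) (intro tendsto_mult tendsto_const lim \<xi>)
    show "AE \<omega> in M. norm (\<xi> \<omega> * g k (\<xi> \<omega>) * w \<omega>) \<le> 1 * (1 + \<bar>c\<bar>)" for k
      by (rule AE_I2) (unfold real_norm_def abs_mult[of "_ * _" "w _"], intro mult_mono gb wb \<xi>, auto)
  qed auto
  then have z: "expectation (\<lambda>\<omega>. indicator {a..} (\<xi> \<omega>) * w \<omega>) = 0" using cont[OF gc] by (simp add: LIMSEQ_const_iff)
  have "(\<lambda>\<omega>. indicator {a..} (\<xi> \<omega>) * w \<omega>) = (\<lambda>\<omega>. indicator {\<omega> \<in> A. a \<le> \<xi> \<omega>} \<omega> - c * indicator {\<omega> \<in> B. a \<le> \<xi> \<omega>} \<omega>)"
    by (auto simp: w_def indicator_def)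
  moreover have ss: "{\<omega> \<in> S. a \<le> \<xi> \<omega>} \<in> sets M" if [measurable]: "S \<in> sets M" for S
  proof -
    have "{\<omega> \<in> S. a \<le> \<xi> \<omega>} = S \<inter> {\<omega> \<in> space M. a \<le> \<xi> \<omega>}" using sets.sets_into_space[OF that] by auto
    then show ?thesis by simp
  qed
  have "integrable M (indicator {\<omega> \<in> S. a \<le> \<xi> \<omega>} :: 'a \<Rightarrow> real)" if "S \<in> sets M" for S
    using ss[OF that] by (simp add: integrable_indicator_iff emeasure_eq_measure)
  ultimately show ?thesis using z ss[OF assms(2)] ss[OF assms(3)] assms(2,3) by simp
qed

section \<open>Fluctuation identity\<close>

context bounded_sde
begin

lemma forward_exit_iff:
  assumes "\<omega> \<in> space M"
  shows "T_plus (\<lambda>t. X t \<omega>) < T_minus (\<lambda>t. X t \<omega>) \<longleftrightarrow> \<omega> \<in> exit_at 1"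
    and "T_minus (\<lambda>t. X t \<omega>) < T_plus (\<lambda>t. X t \<omega>) \<longleftrightarrow> \<omega> \<in> exit_at (-1)"
  using first_cycle_cases(1,2)[OF X_cont[OF assms]] X_0[OF assms] assms
  by (auto simp: exit_at_def exit_time_def)

lemma exit_time_le_iff:
  assumes "exit_time \<omega> = ereal r"
  shows "exit_time \<omega> \<le> ereal u \<longleftrightarrow> exp (- u) \<le> exit_discount \<omega>"
  using assms by (simp add: exit_discount_def)

lemma forward_exit_before_eq:
  "{\<omega> \<in> space M. T_plus (\<lambda>t. X t \<omega>) \<le> ereal u \<and> T_plus (\<lambda>t. X t \<omega>) < T_minus (\<lambda>t. X t \<omega>)} =
    {\<omega> \<in> exit_at 1. exp (- u) \<le> exit_discount \<omega>}" (is "?L = ?R")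
  "{\<omega> \<in> space M. T_minus (\<lambda>t. X t \<omega>) \<le> ereal u \<and> T_minus (\<lambda>t. X t \<omega>) < T_plus (\<lambda>t. X t \<omega>)} =
    {\<omega> \<in> exit_at (-1). exp (- u) \<le> exit_discount \<omega>}" (is "?L' = ?R'")
proof -
  have sp: "\<omega> \<in> space M" "\<exists>r. exit_time \<omega> = ereal r" if "\<omega> \<in> exit_at d" for \<omega> d
    using that by (auto simp: exit_at_def)
  have "\<omega> \<in> ?L \<longleftrightarrow> \<omega> \<in> ?R" for \<omega>
  proof (cases "\<omega> \<in> exit_at 1")
    case True
    then have "T_plus (\<lambda>t. X t \<omega>) = exit_time \<omega>"
      using first_cycle_cases(3)[OF X_cont] forward_exit_iff(1) sp[OF True] by (simp add: exit_time_def)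
    moreover have "T_plus (\<lambda>t. X t \<omega>) < T_minus (\<lambda>t. X t \<omega>)" using True forward_exit_iff(1) sp(1)[OF True] by blast
    moreover have "exit_time \<omega> \<le> ereal u \<longleftrightarrow> exp (- u) \<le> exit_discount \<omega>"
      using sp(2)[OF True] exit_time_le_iff by blast
    ultimately show ?thesis using True sp(1)[OF True] by simp
  qed (use forward_exit_iff(1) in auto)
  then show "?L = ?R" by blast
  have "\<omega> \<in> ?L' \<longleftrightarrow> \<omega> \<in> ?R'" for \<omega>
  proof (cases "\<omega> \<in> exit_at (-1)")
    case True
    then have "T_minus (\<lambda>t. X t \<omega>) = exit_time \<omega>"
      using first_cycle_cases(4)[OF X_cont] forward_exit_iff(2) sp[OF True] by (simp add: exit_time_def)
    moreover have "T_minus (\<lambda>t. X t \<omega>) < T_plus (\<lambda>t. X t \<omega>)" using True forward_exit_iff(2) sp(1)[OF True] by blast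
    moreover have "exit_time \<omega> \<le> ereal u \<longleftrightarrow> exp (- u) \<le> exit_discount \<omega>"
      using sp(2)[OF True] exit_time_le_iff by blast
    ultimately show ?thesis using True sp(1)[OF True] by simp
  qed (use forward_exit_iff(2) in auto)
  then show "?L' = ?R'" by blast
qed

text \<open>Recovers total probabilities from tails: \<open>exit_at d\<close> contains only paths
  that exit in finite time, so the events of exit by time \<open>n\<close> exhaust it.\<close>

lemma exit_at_tail_tendsto:
  "(\<lambda>n. prob {\<omega> \<in> exit_at d. exp (- real n) \<le> exit_discount \<omega>}) \<longlonglongrightarrow> prob (exit_at d)"
proof -
  let ?A = "\<lambda>n::nat. {\<omega> \<in> exit_at d. exp (- real n) \<le> exit_discount \<omega>}"
  have eq: "?A n = exit_at d \<inter> {\<omega> \<in> space M. exp (- real n) \<le> exit_discount \<omega>}" for n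
    using sets.sets_into_space[OF exit_at_event[of d]] by auto
  have "(\<lambda>n. prob (?A n)) \<longlonglongrightarrow> prob (\<Union>n. ?A n)"
  proof (rule finite_Lim_measure_incseq)
    show "range ?A \<subseteq> sets M" unfolding eq by auto
    show "incseq ?A"
    proof (rule incseq_SucI, rule subsetI)
      fix n \<omega> assume *: "\<omega> \<in> ?A n"
      have le: "exp (- real (Suc n)) \<le> exp (- real n)" by simp
      show "\<omega> \<in> ?A (Suc n)"
        using * order_trans[OF le, of "exit_discount \<omega>"] by (simp del: of_nat_Suc)
    qed
  qed
  moreover have "(\<Union>n. ?A n) = exit_at d"
  proof (intro equalityI subsetI)
    fix \<omega> assume \<omega>: "\<omega> \<in> exit_at d"
    then obtain r where r: "exit_time \<omega> = ereal r" by (auto simp: exit_at_def)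
    obtain n :: nat where "r \<le> real n" using real_arch_simple by blast
    then have "exp (- real n) \<le> exit_discount \<omega>" using r by (simp add: exit_discount_def)
    with \<omega> show "\<omega> \<in> (\<Union>n. ?A n)" by auto
  qed auto
  ultimately show ?thesis by simp
qed

text \<open>Removes the growth conditions on the eigenfunction: the cut-off function has the same
  values at \<open>y - 1\<close>, \<open>y\<close> and \<open>y + 1\<close> and satisfies the same
  equation in between, which is all that \<open>exit_laplace\<close> sees.\<close>

lemma exit_laplace_C2:
  fixes u u' u'' :: "real \<Rightarrow> real" and n :: nat
  assumes "\<And>x. (u has_real_derivative u' x) (at x)" "\<And>x. (u' has_real_derivative u'' x) (at x)"
    and "continuous_on UNIV u''" "\<And>x. b x * u' x + (\<sigma> x)\<^sup>2 / 2 * u'' x = real n * u x" and "0 < n"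
  shows "u y = u (y + 1) * expectation (\<lambda>\<omega>. exit_discount \<omega> ^ n * indicator (exit_at 1) \<omega>)
    + u (y - 1) * expectation (\<lambda>\<omega>. exit_discount \<omega> ^ n * indicator (exit_at (-1)) \<omega>)"
proof -
  obtain f f' f'' D where f: "\<And>x. (f has_real_derivative f' x) (at x)"
    "\<And>x. (f' has_real_derivative f'' x) (at x)"
    "\<And>x. \<bar>f x\<bar> \<le> D" "\<And>x. \<bar>f' x\<bar> \<le> D" "\<And>x. \<bar>f'' x\<bar> \<le> D"
    "uniformly_continuous_on UNIV f''"
    and eq: "\<And>x. \<bar>x - y\<bar> \<le> 1 \<Longrightarrow> f x = u x" "\<And>x. \<bar>x - y\<bar> < 1 \<Longrightarrow> f' x = u' x" "\<And>x. \<bar>x - y\<bar> < 1 \<Longrightarrow> f'' x = u'' x"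
    using bounded_C2_extension[OF assms(1-3), of y] by blast
  have "b x * f' x + (\<sigma> x)\<^sup>2 / 2 * f'' x = real n * f x" if "\<bar>x - y\<bar> < 1" for x
    using that eq assms(4)[of x] by simp
  from exit_laplace[OF f assms(5) this] eq(1) show ?thesis by simp
qed

end

text \<open>The identity in \<open>u\<close> is a product because at \<open>u = 0\<close> both
  probabilities vanish, the exit time being positive. The other quotients are genuine, since neither
  direction has probability zero.\<close>

theorem theorem3p1:
  fixes M :: "'a measure" and F :: "real \<Rightarrow> 'a measure"
    and W X :: "real \<Rightarrow> 'a \<Rightarrow> real" and b \<sigma> :: "real \<Rightarrow> real" and y :: real
  assumes "continuous_on UNIV b" and "continuous_on UNIV \<sigma>"
    and "\<And>x. \<sigma> x > 0"
    and "\<And>x. b (x + 1) = b x" and "\<And>x. \<sigma> (x + 1) = \<sigma> x"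
    and "sde_solution M F W b \<sigma> y X"
  shows
    "(\<forall>u\<ge>0.
        measure M {\<omega> \<in> space M. T_plus (\<lambda>t. X t \<omega>) \<le> ereal u \<and> T_plus (\<lambda>t. X t \<omega>) < T_minus (\<lambda>t. X t \<omega>)}
      = exp (2 * integral {0..1} (\<lambda>z. b z / (\<sigma> z)\<^sup>2)) *
        measure M {\<omega> \<in> space M. T_minus (\<lambda>t. X t \<omega>) \<le> ereal u \<and> T_minus (\<lambda>t. X t \<omega>) < T_plus (\<lambda>t. X t \<omega>)})
     \<and> measure M {\<omega> \<in> space M. T_plus (\<lambda>t. X t \<omega>) < T_minus (\<lambda>t. X t \<omega>)}
       / measure M {\<omega> \<in> space M. T_minus (\<lambda>t. X t \<omega>) < T_plus (\<lambda>t. X t \<omega>)}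
       = exp (2 * integral {0..1} (\<lambda>z. b z / (\<sigma> z)\<^sup>2))
     \<and> (\<forall>u\<ge>0.
        measure M {\<omega> \<in> space M. T_plus (\<lambda>t. X t \<omega>) \<le> ereal u \<and> T_plus (\<lambda>t. X t \<omega>) < T_minus (\<lambda>t. X t \<omega>)}
          / measure M {\<omega> \<in> space M. T_plus (\<lambda>t. X t \<omega>) < T_minus (\<lambda>t. X t \<omega>)}
        = measure M {\<omega> \<in> space M. T_minus (\<lambda>t. X t \<omega>) \<le> ereal u \<and> T_minus (\<lambda>t. X t \<omega>) < T_plus (\<lambda>t. X t \<omega>)}
          / measure M {\<omega> \<in> space M. T_minus (\<lambda>t. X t \<omega>) < T_plus (\<lambda>t. X t \<omega>)})"
proof -
  interpret periodic_coefficients b \<sigma> by unfold_locales (use assms in auto)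
  obtain Kb Ks where K: "\<And>x. \<bar>b x\<bar> \<le> Kb" "\<And>x. \<bar>\<sigma> x\<bar> \<le> Ks"
    using continuous_periodic_uc(1)[OF b_cont b_per] continuous_periodic_uc(1)[OF \<sigma>_cont \<sigma>_per] by blast
  interpret prob_space M using assms(6) by (simp add: sde_solution_def)
  interpret bounded_sde M F W b \<sigma> y X "max Kb Ks"
  proof unfold_locales
    show "is_filtration M F" "brownian_motion M F W" using assms(6) by (simp_all add: sde_solution_def)
    show "\<bar>b x\<bar> \<le> max Kb Ks" "\<bar>\<sigma> x\<bar> \<le> max Kb Ks" for x using K[of x] by auto
    show "uniformly_continuous_on UNIV b" "uniformly_continuous_on UNIV \<sigma>"
      using continuous_periodic_uc(2)[OF b_cont b_per] continuous_periodic_uc(2)[OF \<sigma>_cont \<sigma>_per] by blast+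
  qed (rule assms(6))
  define L where "L n d = expectation (\<lambda>\<omega>. exit_discount \<omega> ^ n * indicator (exit_at d) \<omega>)" for n d
  have L: "L n 1 = exp affinity * L n (-1)" if "0 < n" for n
  proof -
    have rn: "0 < real n" using that by simp
    obtain u u' u'' where u: "\<And>x. (u has_real_derivative u' x) (at x)" "\<And>x. (u' has_real_derivative u'' x) (at x)"
      "continuous_on UNIV u''" "\<And>x. b x * u' x + (\<sigma> x)\<^sup>2 / 2 * u'' x = real n * u x"
      "u y = 0" "u (y - 1) \<noteq> 0 \<and> u (y + 1) * exp affinity = - u (y - 1)"
      using eigenfunction_exists[OF rn, of y 0] by metis
    have "0 = u (y + 1) * L n 1 + u (y - 1) * L n (-1)"
      using exit_laplace_C2[OF u(1-4) that] u(5) by (simp add: L_def)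
    also have "u (y - 1) = - (u (y + 1) * exp affinity)" using u(6) by simp
    finally have "u (y + 1) * (L n 1 - exp affinity * L n (-1)) = 0" by (simp only: right_diff_distrib) simp
    moreover have "u (y + 1) \<noteq> 0" using u(6) by auto
    ultimately show ?thesis by simp
  qed
  have tails: "prob {\<omega> \<in> exit_at 1. a \<le> exit_discount \<omega>} = exp affinity * prob {\<omega> \<in> exit_at (-1). a \<le> exit_discount \<omega>}"
    if "0 < a" for a
    by (rule moments_determine_tails[OF _ _ _ _ _ _ that])
       (use L exit_discount_bounds in \<open>auto simp: L_def\<close>)
  have total: "prob (exit_at 1) = exp affinity * prob (exit_at (-1))"
  proof (rule LIMSEQ_unique[OF exit_at_tail_tendsto])
    show "(\<lambda>n. prob {\<omega> \<in> exit_at 1. exp (- real n) \<le> exit_discount \<omega>}) \<longlonglongrightarrow> exp affinity * prob (exit_at (-1))"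
      unfolding tails[OF exp_gt_zero] by (intro tendsto_mult tendsto_const exit_at_tail_tendsto)
  qed
  have pos: "prob (exit_at (-1)) \<noteq> 0"
  proof
    assume "prob (exit_at (-1)) = 0"
    \<comment> \<open>By \<open>total\<close> a null exit on one side makes the other null as well,
      so both Laplace transforms would vanish.\<close>
    with total have z: "prob (exit_at d) = 0" if "d \<in> {1, -1}" for d using that by auto
    have "L 1 d = 0" if "d \<in> {1, -1}" for d
    proof -
      have "AE \<omega> in M. \<omega> \<notin> exit_at d"
        using z[OF that] by (intro AE_not_in) (simp add: null_sets_def emeasure_eq_measure)
      then have "AE \<omega> in M. exit_discount \<omega> ^ 1 * indicator (exit_at d) \<omega> = 0" by eventually_elim simp
      then show ?thesis unfolding L_def by (rule integral_eq_zero_AE)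
    qed
    then have L0: "L 1 1 = 0" "L 1 (-1) = 0" by auto
    obtain u u' u'' where u: "\<And>x. (u has_real_derivative u' x) (at x)" "\<And>x. (u' has_real_derivative u'' x) (at x)"
      "continuous_on UNIV u''" "\<And>x. b x * u' x + (\<sigma> x)\<^sup>2 / 2 * u'' x = real 1 * u x" "u y = 1"
      using eigenfunction_exists[of "real 1" y 1] by (metis of_nat_0_less_iff zero_less_one)
    from exit_laplace_C2[OF u(1-4)] L0 u(5) show False by (simp add: L_def)
  qed
  have sets_eq: "{\<omega> \<in> space M. T_plus (\<lambda>t. X t \<omega>) < T_minus (\<lambda>t. X t \<omega>)} = exit_at 1"
    "{\<omega> \<in> space M. T_minus (\<lambda>t. X t \<omega>) < T_plus (\<lambda>t. X t \<omega>)} = exit_at (-1)"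
    using forward_exit_iff sets.sets_into_space[OF exit_at_event] by blast+
  have "exp (2 * integral {0..1} (\<lambda>z. b z / (\<sigma> z)\<^sup>2)) = exp affinity" by (simp add: affinity_def)
  \<comment> \<open>In the conditional probabilities the common factor \<open>exp affinity\<close>
    of \<open>tails\<close> and \<open>total\<close> cancels.\<close>
  then show ?thesis
    unfolding forward_exit_before_eq sets_eq using tails[OF exp_gt_zero] total pos by simp
qed

end
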